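(* Let $0<c_1<c_2$, and let $A_1,A_2$ be real constants. Consider the Cauchy problem for $$\begin{cases}\square_{c_1}u_1=A_1(\partial_tu_2)^2,\\ \square_{c_2}u_2=A_2(\partial_tu_1)^2\end{cases}\quad\text{in }(0,\infty)\times\mathbb{R}^3.$$ If $A_1\ne0$, then there exist $(f,g)\in C_0^\infty(\mathbb{R}^3;\mathbb{R}^2)\times C_0^\infty(\mathbb{R}^3;\mathbb{R}^2)$, $M>0$, $T_0\ge2$, and $C>0$ such that, for all sufficiently small $\varepsilon>0$, $$C^{-1}\varepsilon\bigl(1+\varepsilon\log(2+t)\bigr)\le|r\,u_1(t,x)|\le C\varepsilon\bigl(1+\varepsilon\log(2+t)\bigr)$$ for any $(t,x)$ satisfying $T_0\le c_1t\le r\le c_1t+M$, where $r=|x|$ and $u=(u_1,u_2)$ is the global solution to $\square_{c_1}u_1=A_1(\partial_tu_2)^2$, $\square_{c_2}u_2=A_2(\partial_tu_1)^2$ in $(0,\infty)\times\mathbb{R}^3$ with initial data $u=\varepsilon f$ and $\partial_tu=\varepsilon g$ at $t=0$.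
   Context: $\square_c=\partial_t^2-c^2\Delta_x$ on $(0,\infty)\times\mathbb{R}^3$. It is known that for any $f,g\in C_0^\infty(\mathbb{R}^3;\mathbb{R}^2)$ the Cauchy problem for $\square_{c_1}u_1=A_1(\partial_tu_2)^2$, $\square_{c_2}u_2=A_2(\partial_tu_1)^2$ with initial data $u=\varepsilon f$, $\partial_tu=\varepsilon g$ at $t=0$ has a unique global smooth solution on $[0,\infty)\times\mathbb{R}^3$ when $\varepsilon>0$ is sufficiently small; this is "the global solution". The data $f,g$ and the constants $M,T_0,C$ do not depend on $\varepsilon$. *)

theory Defs
  imports "HOL-Analysis.Analysis"
begin

text \<open>Derivatives are taken relative to \<open>S\<close>.  On a closed half-space they are one-sided at the
  boundary, and still unique, so smoothness there means smoothness up to the boundary.\<close>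

primrec continuously_differentiable_on ::
  "nat \<Rightarrow> 'a::real_normed_vector set \<Rightarrow> ('a \<Rightarrow> 'b::real_normed_vector) \<Rightarrow> bool" where
  "continuously_differentiable_on 0 S f \<longleftrightarrow> continuous_on S f"
| "continuously_differentiable_on (Suc k) S f \<longleftrightarrow>
     f differentiable_on S \<and>
     (\<forall>v. continuously_differentiable_on k S (\<lambda>x. frechet_derivative f (at x within S) v))"

definition smooth_on :: "'a::real_normed_vector set \<Rightarrow> ('a \<Rightarrow> 'b::real_normed_vector) \<Rightarrow> bool" where
  "smooth_on S f \<longleftrightarrow> (\<forall>k. continuously_differentiable_on k S f)"

definition smooth_compactly_supported ::
  "('a::real_normed_vector \<Rightarrow> 'b::real_normed_vector) \<Rightarrow> bool" where
  "smooth_compactly_supported f \<longleftrightarrow> smooth_on UNIV f \<and> compact (closure (support_on UNIV f))"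

definition laplacian :: "('a::euclidean_space \<Rightarrow> real) \<Rightarrow> 'a \<Rightarrow> real" where
  "laplacian f x = (\<Sum>b\<in>Basis. (deriv ^^ 2) (\<lambda>s. f (x + s *\<^sub>R b)) 0)"

definition dalembertian ::
  "real \<Rightarrow> (real \<Rightarrow> 'a::euclidean_space \<Rightarrow> real) \<Rightarrow> real \<Rightarrow> 'a \<Rightarrow> real" where
  "dalembertian c v t x = (deriv ^^ 2) (\<lambda>s. v s x) t - c\<^sup>2 * laplacian (v t) x"

text \<open>A solution is a function on \<open>[0, \<infinity>) \<times> \<real>\<^sup>3\<close>; the values of \<open>u\<close> at negative times are
  unconstrained, so the time derivative at \<open>t = 0\<close> is one-sided.\<close>

definition global_smooth_solution ::
  "real \<Rightarrow> real \<Rightarrow> real \<Rightarrow> real \<Rightarrow> (real^3 \<Rightarrow> real^2) \<Rightarrow> (real^3 \<Rightarrow> real^2) \<Rightarrow>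
   (real \<Rightarrow> real^3 \<Rightarrow> real^2) \<Rightarrow> bool" where
  "global_smooth_solution c1 c2 A1 A2 \<phi> \<psi> u \<longleftrightarrow>
     smooth_on ({0..} \<times> UNIV) (\<lambda>(t, x). u t x) \<and>
     (\<forall>t>0. \<forall>x.
        dalembertian c1 (\<lambda>t x. u t x $ 1) t x = A1 * (deriv (\<lambda>s. u s x $ 2) t)\<^sup>2 \<and>
        dalembertian c2 (\<lambda>t x. u t x $ 2) t x = A2 * (deriv (\<lambda>s. u s x $ 1) t)\<^sup>2) \<and>
     (\<forall>x. u 0 x = \<phi> x) \<and>
     (\<forall>x. ((\<lambda>t. u t x) has_vector_derivative \<psi> x) (at 0 within {0..}))"

end

theory Submission
  imports Defs
begin

text \<open>Take \<open>f = 0\<close> and \<open>g = (sgn A1, 1) \<chi>\<close> with a radial bump \<open>\<chi> \<ge> 0\<close>.  Uniqueness in backward cones and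
  rotation invariance make the solution radial, so \<open>v\<^sub>i = r u\<^sub>i\<close> solves a wave equation in \<open>(t, r)\<close>
  with source \<open>A\<^sub>i r (\<partial>\<^sub>t u\<^sub>j)\<^sup>2\<close>, and \<open>w\<^sub>i = (\<partial>\<^sub>t - c\<^sub>i \<partial>\<^sub>r) v\<^sub>i\<close> is transported along \<open>r - c\<^sub>i t = \<rho>\<close>.
  A characteristic of one speed crosses the cone of the other speed at time of order \<open>\<bar>\<rho>\<bar>\<close> and spends
  bounded time near it, so the source, which carries a factor \<open>1/r\<close>, contributes \<open>O(\<epsilon>\<^sup>2 / (1 + \<bar>\<rho>\<bar>))\<close>;
  this closes a bootstrap for \<open>w\<^sub>i\<close> and \<open>\<partial>\<^sub>r w\<^sub>i\<close>.
  Finally \<open>v\<^sub>1\<close> is an integral of \<open>w\<^sub>1\<close> over \<open>\<rho>\<close> in \<open>[r - c\<^sub>1 t, r + c\<^sub>1 t]\<close>, where \<open>\<rho> \<ge> 0\<close> makes both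
  the free part, of size \<open>\<epsilon>\<close>, and the Duhamel part have the sign of \<open>A1\<close>.  The latter is also bounded
  below by \<open>\<epsilon>\<^sup>2 / \<rho>\<close> for \<open>\<rho> \<lesssim> t\<close>, since the bump in \<open>u\<^sub>2\<close> along its own cone persists, and
  integrating \<open>1/\<rho>\<close> produces the logarithm.\<close>

subsection \<open>The kernel of the Duhamel terms\<close>

text \<open>This is why \<partial>w, the radial derivative of w, is carried in the bootstrap: near
  the axis the mean value theorem turns the quotient into a value of \<partial>w. No further
  derivative is lost, because \<partial>(r q^2) = 2 q \<partial>(r q) - q^2 and \<partial>(r q) is
  an average of two values of \<partial>w. The weight 1 / (1 + |\<rho>|) is exactly the rate that
  the quadratic source reproduces. Different speeds matter here: with equal speeds a characteristic
  would stay at a fixed distance from the cone for all time, and the factor 1/r alone is not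
  integrable. The same rate just fails to be integrable in \<rho>, which is the logarithm in the
  upper bound. Equal signs of the free part and the Duhamel part are imposed through the data
  because at times with \<epsilon> log t of order 1 both have the same size and might otherwise
  cancel.\<close>

lemma has_real_derivative_divide_one_plus_abs:
  "((\<lambda>y. y / (1 + \<bar>y\<bar>)) has_real_derivative 1 / (1 + \<bar>y\<bar>)\<^sup>2) (at (y::real))"
proof -
  consider "y = 0" | "y > 0" | "y < 0" by linarith
  then show ?thesis
  proof cases
    case 1
    have "isCont (\<lambda>z::real. 1 / (1 + \<bar>z\<bar>)) 0"
      by (intro continuous_intros) auto
    then show ?thesis
      unfolding 1 CARAT_DERIV by (intro exI[of _ "\<lambda>z. 1 / (1 + \<bar>z\<bar>)"]) auto
  next
    case 2
    have "((\<lambda>y. y / (1 + y)) has_real_derivative 1 / (1 + y)\<^sup>2) (at y)"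
      using 2 by (auto intro!: derivative_eq_intros simp: power2_eq_square)
    then have "((\<lambda>y. y / (1 + \<bar>y\<bar>)) has_real_derivative 1 / (1 + y)\<^sup>2) (at y)"
      by (rule has_field_derivative_transform_within_open[of _ _ _ "{0<..}"]) (use 2 in auto)
    then show ?thesis using 2 by simp
  next
    case 3
    have "((\<lambda>y. y / (1 - y)) has_real_derivative 1 / (1 - y)\<^sup>2) (at y)"
      using 3 by (auto intro!: derivative_eq_intros simp: power2_eq_square)
    then have "((\<lambda>y. y / (1 + \<bar>y\<bar>)) has_real_derivative 1 / (1 - y)\<^sup>2) (at y)"
      by (rule has_field_derivative_transform_within_open[of _ _ _ "{..<0}"]) (use 3 in auto)
    then show ?thesis using 3 by simp
  qed
qed

lemma one_plus_abs_nonzero [simp]: "1 + \<bar>x::real\<bar> \<noteq> 0" "1 + \<bar>x::real\<bar> > 0"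
  by auto

text \<open>The antiderivative \<open>G (\<alpha> + \<beta> * s) / \<beta>\<close> with
  \<open>G y = y / (1 + \<bar>y\<bar>)\<close> is bounded by 1 / |\<beta>|, so the estimate is
  uniform in the interval and in \<alpha>.\<close>

lemma integral_inverse_square_affine_le:
  fixes \<alpha> \<beta> :: real
  assumes "\<beta> \<noteq> 0" "a \<le> b"
  shows "integral {a..b} (\<lambda>s. 1 / (1 + \<bar>\<alpha> + \<beta> * s\<bar>)\<^sup>2) \<le> 2 / \<bar>\<beta>\<bar>"
proof -
  define G where "G y = y / (1 + \<bar>y\<bar>)" for y :: real
  have G: "\<bar>G y\<bar> \<le> 1" for y
    by (auto simp: G_def divide_simps)
  have "((\<lambda>s. 1 / (1 + \<bar>\<alpha> + \<beta> * s\<bar>)\<^sup>2) has_integral (G (\<alpha> + \<beta> * b) / \<beta> - G (\<alpha> + \<beta> * a) / \<beta>)) {a..b}"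
  proof (rule fundamental_theorem_of_calculus[OF \<open>a \<le> b\<close>])
    fix s
    have "((\<lambda>s. G (\<alpha> + \<beta> * s)) has_real_derivative (1 / (1 + \<bar>\<alpha> + \<beta> * s\<bar>)\<^sup>2) * \<beta>) (at s)"
      unfolding G_def
      by (rule DERIV_chain2[OF has_real_derivative_divide_one_plus_abs]) (auto intro!: derivative_eq_intros)
    then have "((\<lambda>s. G (\<alpha> + \<beta> * s) / \<beta>) has_real_derivative 1 / (1 + \<bar>\<alpha> + \<beta> * s\<bar>)\<^sup>2) (at s)"
      by (drule_tac DERIV_cdivide[where c=\<beta>]) (use assms in simp)
    then show "((\<lambda>s. G (\<alpha> + \<beta> * s) / \<beta>) has_vector_derivative 1 / (1 + \<bar>\<alpha> + \<beta> * s\<bar>)\<^sup>2) (at s within {a..b})"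
      by (simp add: has_real_derivative_iff_has_vector_derivative has_vector_derivative_at_within)
  qed
  then have "integral {a..b} (\<lambda>s. 1 / (1 + \<bar>\<alpha> + \<beta> * s\<bar>)\<^sup>2) = (G (\<alpha> + \<beta> * b) - G (\<alpha> + \<beta> * a)) / \<beta>"
    by (simp add: integral_unique diff_divide_distrib)
  also have "\<dots> \<le> \<bar>G (\<alpha> + \<beta> * b) - G (\<alpha> + \<beta> * a)\<bar> / \<bar>\<beta>\<bar>"
    by (metis abs_divide abs_ge_self)
  also have "\<dots> \<le> 2 / \<bar>\<beta>\<bar>"
    using G[of "\<alpha> + \<beta> * b"] G[of "\<alpha> + \<beta> * a"] by (intro divide_right_mono) auto
  finally show ?thesis .
qed

text \<open>Size of the source y q^2 at y = \<rho> + c s when the component of speed c' obeys the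
  bootstrap bound: q is of order 1 / ((1 + |y|) (1 + | |y| - c' s |)), and the factor y cancels one
  power of 1 + |y|.\<close>

definition kern :: "real \<Rightarrow> real \<Rightarrow> real \<Rightarrow> real \<Rightarrow> real" where
  "kern c c' \<rho> s = 1 / ((1 + \<bar>\<rho> + c * s\<bar>) * (1 + \<bar>\<bar>\<rho> + c * s\<bar> - c' * s\<bar>)\<^sup>2)"

lemma kern_nonneg: "0 \<le> kern c c' \<rho> s"
  by (auto simp: kern_def intro!: divide_nonneg_nonneg mult_nonneg_nonneg)

lemma continuous_on_kern: "continuous_on S (kern c c' \<rho>)"
  unfolding kern_def by (intro continuous_intros) auto

text \<open>If the distance \<open>y\<close> to the axis and the distance \<open>b\<close> to the
  other cone are both small, then \<open>c' * s \<le> y + b\<close> forces s, and with it \<rho>, to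
  be small. Hence 1 + |\<rho>| is dominated by the sum of the two weights, which cancels one factor
  of the kernel in each term; the remaining mixed product is split into squares.\<close>

lemma kern_pointwise:
  assumes "0 < c" "0 < c'" "0 \<le> s"
  shows "(1 + \<bar>\<rho>\<bar>) * kern c c' \<rho> s \<le> (1 + c / c') *
    (3/2 * (1 / (1 + \<bar>\<rho> + (c - c') * s\<bar>)\<^sup>2 + 1 / (1 + \<bar>\<rho> + (c + c') * s\<bar>)\<^sup>2) + 1/2 * (1 / (1 + \<bar>\<rho> + c * s\<bar>)\<^sup>2))"
proof -
  define y where "y = \<bar>\<rho> + c * s\<bar>"
  define b where "b = \<bar>y - c' * s\<bar>"
  have y: "y \<ge> 0" and b: "b \<ge> 0" by (auto simp: y_def b_def)
  have "c' * s \<le> y + b" by (auto simp: y_def b_def)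
  then have "c / c' * (c' * s) \<le> c / c' * (y + b)" using assms by (intro mult_left_mono) auto
  then have "c * s \<le> c / c' * (y + b)" using assms by simp
  moreover have "\<bar>\<rho>\<bar> \<le> y + c * s"
  proof -
    have "0 \<le> c * s" using assms by simp
    then show ?thesis unfolding y_def by linarith
  qed
  ultimately have "\<bar>\<rho>\<bar> \<le> y + c / c' * (y + b)" by linarith
  also have "\<dots> \<le> (1 + c / c') * (y + b)" using b by (simp add: algebra_simps)
  also have "\<dots> \<le> (1 + c / c') * ((1 + y) + (1 + b)) - 1"
    using assms by (simp add: distrib_left)
  finally have "1 + \<bar>\<rho>\<bar> \<le> (1 + c / c') * ((1 + y) + (1 + b))" by simp
  then have "(1 + \<bar>\<rho>\<bar>) * kern c c' \<rho> s \<le> (1 + c / c') * ((1 + y) + (1 + b)) * kern c c' \<rho> s"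
    by (rule mult_right_mono[OF _ kern_nonneg])
  also have "\<dots> = (1 + c / c') * (((1 + y) + (1 + b)) * kern c c' \<rho> s)" by simp
  also have "((1 + y) + (1 + b)) * kern c c' \<rho> s = (1 / (1 + b))\<^sup>2 + (1 / (1 + y)) * (1 / (1 + b))"
  proof -
    have "(Y + B) * (1 / (Y * B\<^sup>2)) = (1 / B)\<^sup>2 + (1 / Y) * (1 / B)" if "Y > 0" "B > 0" for Y B :: real
      using that by (simp add: field_simps power2_eq_square)
    from this[of "1 + y" "1 + b"] show ?thesis
      using y b unfolding kern_def y_def[symmetric] b_def[symmetric] by simp
  qed
  also have "(1 / (1 + y)) * (1 / (1 + b)) \<le> ((1 / (1 + y))\<^sup>2 + (1 / (1 + b))\<^sup>2) / 2"
    using sum_squares_bound[of "1 / (1 + y)" "1 / (1 + b)"] by simp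
  finally have "(1 + \<bar>\<rho>\<bar>) * kern c c' \<rho> s \<le> (1 + c / c') * ((1 / (1 + b))\<^sup>2 + ((1 / (1 + y))\<^sup>2 + (1 / (1 + b))\<^sup>2) / 2)"
    using assms by (simp add: mult_left_mono)
  also have "\<dots> = (1 + c / c') * (3/2 * (1 / (1 + b)\<^sup>2) + 1/2 * (1 / (1 + y)\<^sup>2))"
  proof -
    have "p + (p' + p) / 2 = 3/2 * p + 1/2 * p'" for p p' :: real by (simp add: field_simps)
    then show ?thesis by (simp only: power_divide power_one)
  qed
  \<comment> \<open>The sign of \<open>\<rho> + c * s\<close> decides which affine function
    \<open>b\<close> is the modulus of; bounding by the sum of both avoids splitting the time
    interval.\<close>
  also have "1 / (1 + b)\<^sup>2 \<le> 1 / (1 + \<bar>\<rho> + (c - c') * s\<bar>)\<^sup>2 + 1 / (1 + \<bar>\<rho> + (c + c') * s\<bar>)\<^sup>2"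
  proof (cases "\<rho> + c * s \<ge> 0")
    case True
    then have "b = \<bar>\<rho> + (c - c') * s\<bar>" by (simp add: b_def y_def algebra_simps)
    then show ?thesis by simp
  next
    case False
    then have "b = \<bar>\<rho> + (c + c') * s\<bar>" by (simp add: b_def y_def algebra_simps)
    then show ?thesis by simp
  qed
  finally show ?thesis using assms by (simp add: y_def mult_left_mono)
qed

text \<open>The term with slope \<open>c - c'\<close> measures the passage through the other cone,
  whose duration is of order 1 / |c - c'|; this is where the speeds must differ.\<close>

lemma integral_kern_le:
  assumes "0 < c" "0 < c'" "c \<noteq> c'" "0 \<le> t"
  shows "integral {0..t} (kern c c' \<rho>)
    \<le> (1 + c / c') * (3 / \<bar>c - c'\<bar> + 3 / (c + c') + 1 / c) / (1 + \<bar>\<rho>\<bar>)"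
proof -
  define P where "P \<beta> s = 1 / (1 + \<bar>\<rho> + \<beta> * s\<bar>)\<^sup>2" for \<beta> s
  have cP: "continuous_on {0..t} (P \<beta>)" for \<beta>
    unfolding P_def by (intro continuous_intros) auto
  have iP: "P \<beta> integrable_on {0..t}" for \<beta>
    by (rule integrable_continuous_real[OF cP])
  have I: "integral {0..t} (P \<beta>) \<le> 2 / \<bar>\<beta>\<bar>" if "\<beta> \<noteq> 0" for \<beta>
    unfolding P_def using integral_inverse_square_affine_le[OF that \<open>0 \<le> t\<close>] .
  have "(1 + \<bar>\<rho>\<bar>) * integral {0..t} (kern c c' \<rho>) = integral {0..t} (\<lambda>s. (1 + \<bar>\<rho>\<bar>) * kern c c' \<rho> s)"
    by simp
  also have "\<dots> \<le> integral {0..t} (\<lambda>s. (1 + c / c') * (3/2 * (P (c - c') s + P (c + c') s) + 1/2 * P c s))"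
  proof (rule integral_le)
    show "(\<lambda>s. (1 + \<bar>\<rho>\<bar>) * kern c c' \<rho> s) integrable_on {0..t}"
      by (intro integrable_continuous_real continuous_intros continuous_on_kern)
    show "(\<lambda>s. (1 + c / c') * (3/2 * (P (c - c') s + P (c + c') s) + 1/2 * P c s)) integrable_on {0..t}"
      by (intro integrable_continuous_real continuous_intros cP)
    show "(1 + \<bar>\<rho>\<bar>) * kern c c' \<rho> s \<le> (1 + c / c') * (3/2 * (P (c - c') s + P (c + c') s) + 1/2 * P c s)"
      if "s \<in> {0..t}" for s
      using kern_pointwise[of c c' s \<rho>] assms that by (simp add: P_def)
  qed
  also have "\<dots> = (1 + c / c') * (3/2 * (integral {0..t} (P (c - c')) + integral {0..t} (P (c + c')))
      + 1/2 * integral {0..t} (P c))"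
    by (simp add: integral_add integrable_add iP)
  also have "\<dots> \<le> (1 + c / c') * (3/2 * (2 / \<bar>c - c'\<bar> + 2 / \<bar>c + c'\<bar>) + 1/2 * (2 / \<bar>c\<bar>))"
    using assms by (intro mult_left_mono add_mono I) auto
  also have "\<dots> = (1 + c / c') * (3 / \<bar>c - c'\<bar> + 3 / (c + c') + 1 / c)"
    using assms by (simp only: distrib_left)
  finally show ?thesis by (simp add: field_simps)
qed

subsection \<open>A priori bounds for the radial system\<close>

text \<open>In the type \<^typ>\<open>2\<close> the index \<open>i + 1\<close> denotes the component other than \<open>i\<close>.\<close>

lemma three_eq_one [simp]: "(3::2) = 1"
proof -
  have "(2::2) = 0" using exhaust_2[of 0] by auto
  then have "(2::2) + 1 = 1" by (simp del: one_add_one add: numeral_plus_one)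
  then show ?thesis by simp
qed

text \<open>Here \<open>q i\<close> stands for \<open>\<partial>\<^sub>t u\<^sub>i\<close>, \<open>w i\<close> for \<open>(\<partial>\<^sub>t - c i \<partial>\<^sub>r) (r u\<^sub>i)\<close> and \<open>z i\<close> for \<open>\<partial>\<^sub>r w i\<close>.
  The radial function \<open>u\<^sub>i\<close> is extended to \<open>r < 0\<close> as an even function, so that \<open>- w i t (- r)\<close> is the
  other null derivative of \<open>r u\<^sub>i\<close> and no boundary condition at \<open>r = 0\<close> is needed.\<close>

lemma continuous_on_half_plane_comp:
  assumes "continuous_on ({0..} \<times> UNIV) (\<lambda>(t, r). f t r :: real)"
    and "continuous_on S a" "continuous_on S b" "\<And>p. p \<in> S \<Longrightarrow> 0 \<le> a p"
  shows "continuous_on S (\<lambda>p. f (a p) (b p :: real))"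
  using continuous_on_compose2[OF assms(1) continuous_on_Pair[OF assms(2,3)]] assms(4)
  by (auto simp: image_subset_iff)

locale radial_pair =
  fixes c A :: "2 \<Rightarrow> real" and w z q dq :: "2 \<Rightarrow> real \<Rightarrow> real \<Rightarrow> real"
  assumes c_pos: "0 < c i" and c_less: "c 1 < c 2"
    and cont_w: "continuous_on ({0..} \<times> UNIV) (\<lambda>(t, r). w i t r)"
    and cont_z: "continuous_on ({0..} \<times> UNIV) (\<lambda>(t, r). z i t r)"
    and cont_q: "continuous_on ({0..} \<times> UNIV) (\<lambda>(t, r). q i t r)"
    and cont_dq: "continuous_on ({0..} \<times> UNIV) (\<lambda>(t, r). dq i t r)"
    and deriv_w: "0 \<le> t \<Longrightarrow> (w i t has_real_derivative z i t r) (at r)"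
    and deriv_q: "0 \<le> t \<Longrightarrow> (q i t has_real_derivative dq i t r) (at r)"
    and odd_part: "0 \<le> t \<Longrightarrow> 2 * r * q i t r = w i t r - w i t (- r)"
    and transport: "0 \<le> t \<Longrightarrow> w i t (\<rho> + c i * t) =
      w i 0 \<rho> + integral {0..t} (\<lambda>s. A i * (\<rho> + c i * s) * (q (i + 1) s (\<rho> + c i * s))\<^sup>2)"
begin

lemma c_le: "c i \<le> c 2"
  using exhaust_2[of i] c_less by auto

lemma even_part: 
  assumes "0 \<le> t"
  shows "2 * q i t r + 2 * r * dq i t r = z i t r + z i t (- r)"
proof -
  have "((\<lambda>r. 2 * r * q i t r) has_real_derivative 2 * q i t r + 2 * r * dq i t r) (at r)"
    by (auto intro!: derivative_eq_intros deriv_q assms)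
  moreover have "((\<lambda>r. w i t r - w i t (- r)) has_real_derivative z i t r + z i t (- r)) (at r)"
  proof -
    have "((\<lambda>r. w i t (- r)) has_real_derivative z i t (- r) * (-1)) (at r)"
      by (rule DERIV_chain2[OF deriv_w]) (auto intro!: derivative_eq_intros assms)
    from DERIV_diff[OF deriv_w this] show ?thesis using assms by simp
  qed
  ultimately show ?thesis
    using odd_part[OF assms] by (auto intro: DERIV_unique)
qed

lemmas cont_comps [continuous_intros] =
  continuous_on_half_plane_comp[OF cont_w] continuous_on_half_plane_comp[OF cont_z]
  continuous_on_half_plane_comp[OF cont_q] continuous_on_half_plane_comp[OF cont_dq]

text \<open>By \<open>even_part\<close> this is \<open>q + r * dq\<close>, the radial derivative of
  r q. Written through \<open>z\<close> it is controlled by the bootstrap, whereas \<open>dq\<close>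
  has no bound of its own.\<close>

definition m where "m i t r = (z i t r + z i t (- r)) / 2"

text \<open>Differentiation of \<open>transport\<close> in \<rho> under the integral. Completing the
  derivative of y q^2 to 2 q \<partial>(y q) - q^2 eliminates \<open>dq\<close>.\<close>

lemma transport_deriv:
  assumes "0 \<le> t"
  shows "z i t (\<rho> + c i * t) = z i 0 \<rho> + integral {0..t}
    (\<lambda>s. A i * (2 * q (i + 1) s (\<rho> + c i * s) * m (i + 1) s (\<rho> + c i * s) - (q (i + 1) s (\<rho> + c i * s))\<^sup>2))"
proof -
  let ?h = "\<lambda>\<rho> s. A i * (\<rho> + c i * s) * (q (i + 1) s (\<rho> + c i * s))\<^sup>2"
  let ?h' = "\<lambda>\<rho> s. A i * (2 * q (i + 1) s (\<rho> + c i * s) * m (i + 1) s (\<rho> + c i * s) - (q (i + 1) s (\<rho> + c i * s))\<^sup>2)"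
  have 1: "((\<lambda>\<rho>. w i t (\<rho> + c i * t)) has_real_derivative z i t (\<rho> + c i * t)) (at \<rho>)"
    using deriv_w[OF assms] by (simp add: DERIV_shift[symmetric])
  have q': "((\<lambda>\<rho>. q (i + 1) s (\<rho> + c i * s)) has_real_derivative dq (i + 1) s (\<rho> + c i * s)) (at \<rho>)" 
    if "0 \<le> s" for s \<rho>
    using deriv_q[OF that] by (simp add: DERIV_shift[symmetric])
  have "((\<lambda>\<rho>. integral (cbox 0 t) (?h \<rho>)) has_real_derivative integral (cbox 0 t) (?h' \<rho>)) (at \<rho> within UNIV)"
  proof (rule leibniz_rule_field_derivative)
    show "((\<lambda>\<rho>. ?h \<rho> s) has_real_derivative ?h' \<rho> s) (at \<rho> within UNIV)" if "s \<in> cbox 0 t" for \<rho> s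
    proof -
      have s: "0 \<le> s" using that by simp
      let ?y = "\<rho> + c i * s"
      have "((\<lambda>\<rho>. ?h \<rho> s) has_real_derivative
          A i * ((q (i + 1) s ?y)\<^sup>2 + 2 * ?y * q (i + 1) s ?y * dq (i + 1) s ?y)) (at \<rho>)"
        by (rule derivative_eq_intros q'[OF s] refl)+ (simp add: algebra_simps power2_eq_square)
      also have "(q (i + 1) s ?y)\<^sup>2 + 2 * ?y * q (i + 1) s ?y * dq (i + 1) s ?y
        = q (i + 1) s ?y * (2 * q (i + 1) s ?y + 2 * ?y * dq (i + 1) s ?y) - (q (i + 1) s ?y)\<^sup>2"
        by (simp add: algebra_simps power2_eq_square)
      also have "2 * q (i + 1) s ?y + 2 * ?y * dq (i + 1) s ?y = 2 * m (i + 1) s ?y"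
        using even_part[OF s, of "i + 1" ?y] by (simp add: m_def)
      finally show ?thesis by (simp only: mult_ac UNIV_I)
    qed
    show "(?h \<rho>) integrable_on cbox 0 t" for \<rho>
      by (intro integrable_continuous continuous_intros) auto
    show "continuous_on (UNIV \<times> cbox 0 t) (\<lambda>(\<rho>, s). ?h' \<rho> s)"
      unfolding m_def split_beta by (intro continuous_intros) auto
  qed auto
  from DERIV_add[OF deriv_w[of 0 i \<rho>] this]
  have "((\<lambda>\<rho>. w i t (\<rho> + c i * t)) has_real_derivative z i 0 \<rho> + integral {0..t} (?h' \<rho>)) (at \<rho>)"
    by (simp add: transport[OF assms])
  from DERIV_unique[OF 1 this] show ?thesis .
qed

text \<open>For |y| \<ge> 1 it suffices to divide \<open>odd_part\<close> by y. For |y| < 1 the mean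
  value theorem makes q(y) a value of \<open>z\<close> at some |x| \<le> |y|, which is why the
  hypotheses cover that whole range. The constant 6 comes from this case: a factor 3 for moving the
  weight from x to y and a factor 2 for 1 + |y|.\<close>

lemma q_bound:
  assumes t: "0 \<le> t" and "0 \<le> \<kappa>"
    and w: "\<And>x. \<bar>x\<bar> \<le> \<bar>y\<bar> \<Longrightarrow> \<bar>w i t x\<bar> \<le> \<kappa> / (1 + \<bar>x - c i * t\<bar>)"
    and z: "\<And>x. \<bar>x\<bar> \<le> \<bar>y\<bar> \<Longrightarrow> \<bar>z i t x\<bar> \<le> \<kappa> / (1 + \<bar>x - c i * t\<bar>)"
  shows "\<bar>q i t y\<bar> \<le> 6 * \<kappa> / ((1 + \<bar>y\<bar>) * (1 + \<bar>\<bar>y\<bar> - c i * t\<bar>))"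
    and "\<bar>m i t y\<bar> \<le> \<kappa> / (1 + \<bar>\<bar>y\<bar> - c i * t\<bar>)"
proof -
  let ?b = "\<bar>\<bar>y\<bar> - c i * t\<bar>"
  have ct: "0 \<le> c i * t" using c_pos[of i] t by simp
  have le: "\<kappa> / (1 + \<bar>x - c i * t\<bar>) \<le> \<kappa> / (1 + ?b)" if "x = y \<or> x = - y" for x
    using that ct \<open>0 \<le> \<kappa>\<close> by (intro divide_left_mono mult_pos_pos) auto
  have avg: "\<bar>(a + b) / 2\<bar> \<le> X" if "\<bar>a\<bar> \<le> X" "\<bar>b\<bar> \<le> X" for a b X :: real
    using that by auto
  show "\<bar>m i t y\<bar> \<le> \<kappa> / (1 + ?b)"
    using avg[OF order_trans[OF z[of y] le[of y]] order_trans[OF z[of "- y"] le[of "- y"]]]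
    by (simp add: m_def)
  show "\<bar>q i t y\<bar> \<le> 6 * \<kappa> / ((1 + \<bar>y\<bar>) * (1 + ?b))"
  proof (cases "1 \<le> \<bar>y\<bar>")
    case True
    have "2 * \<bar>y\<bar> * \<bar>q i t y\<bar> = \<bar>w i t y - w i t (- y)\<bar>"
      using odd_part[OF t, of y i] by (metis abs_mult abs_numeral)
    also have "\<dots> \<le> 2 * (\<kappa> / (1 + ?b))"
      using order_trans[OF w[of y] le[of y]] order_trans[OF w[of "- y"] le[of "- y"]]
      by (intro order_trans[OF abs_triangle_ineq4]) auto
    finally have "\<bar>y\<bar> * \<bar>q i t y\<bar> \<le> \<kappa> / (1 + ?b)" by simp
    moreover have "(1 + \<bar>y\<bar>) * \<bar>q i t y\<bar> \<le> 2 * (\<bar>y\<bar> * \<bar>q i t y\<bar>)"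
      using True mult_right_mono[of 1 "\<bar>y\<bar>" "\<bar>q i t y\<bar>"] by (simp add: algebra_simps)
    ultimately have "(1 + \<bar>y\<bar>) * \<bar>q i t y\<bar> \<le> 6 * (\<kappa> / (1 + ?b))"
      using \<open>0 \<le> \<kappa>\<close> by (smt (verit) divide_nonneg_nonneg abs_ge_zero)
    moreover have "0 < (1 + \<bar>y\<bar>) * (1 + ?b)" by (intro mult_pos_pos) auto
    ultimately show ?thesis by (simp add: pos_le_divide_eq mult_ac)
  next
    case False
    have "\<exists>x. \<bar>x\<bar> \<le> \<bar>y\<bar> \<and> q i t y = z i t x"
    proof (cases "y = 0")
      case True
      then show ?thesis using even_part[OF t, of i 0] by auto
    next
      case False
      then have "- \<bar>y\<bar> < \<bar>y\<bar>" by auto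
      then obtain x where x: "- \<bar>y\<bar> < x" "x < \<bar>y\<bar>" "w i t \<bar>y\<bar> - w i t (- \<bar>y\<bar>) = (\<bar>y\<bar> - - \<bar>y\<bar>) * z i t x"
        using MVT2[of "- \<bar>y\<bar>" "\<bar>y\<bar>" "w i t" "z i t"] deriv_w[OF t] by auto
      have "w i t y - w i t (- y) = 2 * y * z i t x"
      proof (cases "0 \<le> y")
        case True
        with x(3) show ?thesis by simp
      next
        case False
        with x(3) have "w i t (- y) - w i t y = (- y - y) * z i t x" by simp
        then show ?thesis by (simp add: algebra_simps)
      qed
      then have "2 * y * q i t y = 2 * y * z i t x"
        using odd_part[OF t, of y i] by simp
      then have "q i t y = z i t x" using False by simp
      then show ?thesis using x by (intro exI[of _ x]) auto
    qed
    then obtain x where x: "\<bar>x\<bar> \<le> \<bar>y\<bar>" "q i t y = z i t x" by auto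
    then have "(1 + \<bar>x - c i * t\<bar>) * \<bar>q i t y\<bar> \<le> \<kappa>"
      using z[OF x(1)] by (simp add: field_simps)
    moreover have "1 + ?b \<le> 3 * (1 + \<bar>x - c i * t\<bar>)"
    proof -
      have "\<bar>\<bar>y\<bar> - k\<bar> \<le> \<bar>x - k\<bar> + (\<bar>y\<bar> + \<bar>x\<bar>)" for k by arith
      from this[of "c i * t"] x False abs_ge_zero[of "x - c i * t"] show ?thesis
        unfolding not_le by argo
    qed
    then have "(1 + ?b) * \<bar>q i t y\<bar> \<le> 3 * (1 + \<bar>x - c i * t\<bar>) * \<bar>q i t y\<bar>"
      by (rule mult_right_mono) simp
    ultimately have "(1 + ?b) * \<bar>q i t y\<bar> \<le> 3 * \<kappa>"
      by (simp only: mult.assoc)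
    then have "(1 + \<bar>y\<bar>) * ((1 + ?b) * \<bar>q i t y\<bar>) \<le> 2 * (3 * \<kappa>)"
      using False \<open>0 \<le> \<kappa>\<close> by - (rule mult_mono, auto)
    moreover have "0 < (1 + \<bar>y\<bar>) * (1 + ?b)" by (intro mult_pos_pos) auto
    ultimately show ?thesis by (simp add: pos_le_divide_eq mult_ac)
  qed
qed

text \<open>With Q \<le> 6 \<kappa> a b and N \<le> \<kappa> b the differentiated source 2 Q N + Q^2
  costs 12 + 36 = 48; the other one costs 36 and shares the constant. \<open>N\<close> has no decay
  \<open>a\<close> away from the axis, but the factor Q supplies the one power that the kernel
  needs.\<close>

lemma source_bounds:
  assumes s: "0 \<le> s" and "0 \<le> \<kappa>"
    and w: "\<And>x. \<bar>x\<bar> \<le> \<bar>\<rho> + c i * s\<bar> \<Longrightarrow> \<bar>w (i + 1) s x\<bar> \<le> \<kappa> / (1 + \<bar>x - c (i + 1) * s\<bar>)"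
    and z: "\<And>x. \<bar>x\<bar> \<le> \<bar>\<rho> + c i * s\<bar> \<Longrightarrow> \<bar>z (i + 1) s x\<bar> \<le> \<kappa> / (1 + \<bar>x - c (i + 1) * s\<bar>)"
  shows "\<bar>A i * (\<rho> + c i * s) * (q (i + 1) s (\<rho> + c i * s))\<^sup>2\<bar> \<le> 48 * \<bar>A i\<bar> * \<kappa>\<^sup>2 * kern (c i) (c (i + 1)) \<rho> s"
    and "\<bar>A i * (2 * q (i + 1) s (\<rho> + c i * s) * m (i + 1) s (\<rho> + c i * s) - (q (i + 1) s (\<rho> + c i * s))\<^sup>2)\<bar>
      \<le> 48 * \<bar>A i\<bar> * \<kappa>\<^sup>2 * kern (c i) (c (i + 1)) \<rho> s"
proof -
  define y where "y = \<rho> + c i * s"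
  define Q where "Q = \<bar>q (i + 1) s y\<bar>"
  define N where "N = \<bar>m (i + 1) s y\<bar>"
  define a where "a = 1 / (1 + \<bar>y\<bar>)"
  define b where "b = 1 / (1 + \<bar>\<bar>y\<bar> - c (i + 1) * s\<bar>)"
  have Q: "Q \<le> 6 * \<kappa> * a * b" and N: "N \<le> \<kappa> * b"
    using q_bound[OF s \<open>0 \<le> \<kappa>\<close> w z, of "\<rho> + c i * s"] by (auto simp: Q_def N_def a_def b_def y_def)
  have a: "0 < a" "a \<le> 1" "\<bar>y\<bar> * a \<le> 1" and b: "0 < b" "b \<le> 1" by (auto simp: a_def b_def)
  have Q0: "0 \<le> Q" and N0: "0 \<le> N" by (auto simp: Q_def N_def)
  have k: "kern (c i) (c (i + 1)) \<rho> s = a * b\<^sup>2"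
    by (simp add: kern_def a_def b_def y_def power_divide)
  have Q2: "Q\<^sup>2 \<le> 36 * \<kappa>\<^sup>2 * a\<^sup>2 * b\<^sup>2"
    using power_mono[OF Q Q0, of 2] by (simp add: power_mult_distrib)
  have "\<bar>y\<bar> * Q\<^sup>2 \<le> \<bar>y\<bar> * (36 * \<kappa>\<^sup>2 * a\<^sup>2 * b\<^sup>2)"
    by (rule mult_left_mono[OF Q2]) auto
  also have "\<dots> = (36 * \<kappa>\<^sup>2 * a * b\<^sup>2) * (\<bar>y\<bar> * a)" by (simp add: power2_eq_square)
  also have "\<dots> \<le> (36 * \<kappa>\<^sup>2 * a * b\<^sup>2) * 1" using a b by (intro mult_left_mono) auto
  also have "\<dots> \<le> 48 * \<kappa>\<^sup>2 * (a * b\<^sup>2)" using a by simp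
  finally have 1: "\<bar>y\<bar> * Q\<^sup>2 \<le> 48 * \<kappa>\<^sup>2 * (a * b\<^sup>2)" .
  have "\<bar>A i * y * (q (i + 1) s y)\<^sup>2\<bar> = \<bar>A i\<bar> * (\<bar>y\<bar> * Q\<^sup>2)"
    by (simp add: abs_mult Q_def)
  also have "\<dots> \<le> \<bar>A i\<bar> * (48 * \<kappa>\<^sup>2 * (a * b\<^sup>2))" by (rule mult_left_mono[OF 1]) auto
  finally show "\<bar>A i * (\<rho> + c i * s) * (q (i + 1) s (\<rho> + c i * s))\<^sup>2\<bar> \<le> 48 * \<bar>A i\<bar> * \<kappa>\<^sup>2 * kern (c i) (c (i + 1)) \<rho> s"
    by (simp add: k y_def mult_ac)
  have "2 * Q * N + Q\<^sup>2 \<le> 2 * (6 * \<kappa> * a * b) * (\<kappa> * b) + 36 * \<kappa>\<^sup>2 * a\<^sup>2 * b\<^sup>2"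
    using Q N Q0 N0 \<open>0 \<le> \<kappa>\<close> a b by (intro add_mono mult_mono Q2) auto
  also have "\<dots> \<le> 12 * \<kappa>\<^sup>2 * (a * b\<^sup>2) + 36 * \<kappa>\<^sup>2 * (a * b\<^sup>2)"
  proof -
    have "a\<^sup>2 \<le> a" using a by (simp add: power2_eq_square mult_left_le_one_le)
    then have "36 * \<kappa>\<^sup>2 * b\<^sup>2 * a\<^sup>2 \<le> 36 * \<kappa>\<^sup>2 * b\<^sup>2 * a" by (rule mult_left_mono) auto
    then show ?thesis by (simp add: mult_ac power2_eq_square)
  qed
  also have "\<dots> = 48 * \<kappa>\<^sup>2 * (a * b\<^sup>2)" by (simp add: algebra_simps)
  finally have 2: "2 * Q * N + Q\<^sup>2 \<le> 48 * \<kappa>\<^sup>2 * (a * b\<^sup>2)" .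
  have "\<bar>2 * q (i + 1) s y * m (i + 1) s y - (q (i + 1) s y)\<^sup>2\<bar> \<le> 2 * Q * N + Q\<^sup>2"
    unfolding Q_def N_def by (rule order_trans[OF abs_triangle_ineq4]) (simp add: abs_mult)
  with 2 have "\<bar>2 * q (i + 1) s y * m (i + 1) s y - (q (i + 1) s y)\<^sup>2\<bar> \<le> 48 * \<kappa>\<^sup>2 * (a * b\<^sup>2)" by linarith
  then have "\<bar>A i\<bar> * \<bar>2 * q (i + 1) s y * m (i + 1) s y - (q (i + 1) s y)\<^sup>2\<bar> \<le> \<bar>A i\<bar> * (48 * \<kappa>\<^sup>2 * (a * b\<^sup>2))"
    by (rule mult_left_mono) auto
  then show "\<bar>A i * (2 * q (i + 1) s (\<rho> + c i * s) * m (i + 1) s (\<rho> + c i * s) - (q (i + 1) s (\<rho> + c i * s))\<^sup>2)\<bar>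
      \<le> 48 * \<bar>A i\<bar> * \<kappa>\<^sup>2 * kern (c i) (c (i + 1)) \<rho> s"
    by (simp add: k y_def abs_mult mult_ac)
qed

end

text \<open>In the continuity argument the bounds are known only strictly before the first bad time,
  while the Duhamel integrals run up to that time.\<close>

lemma abs_integral_le_integral_but_endpoint:
  fixes f g :: "real \<Rightarrow> real"
  assumes f: "f integrable_on {a..b}" and g: "g integrable_on {a..b}"
    and le: "\<And>s. a \<le> s \<Longrightarrow> s < b \<Longrightarrow> \<bar>f s\<bar> \<le> g s"
  shows "\<bar>integral {a..b} f\<bar> \<le> integral {a..b} g"
proof -
  let ?f = "\<lambda>s. if s = b then 0 else f s" and ?g = "\<lambda>s. if s = b then 0 else g s"
  have eq: "integral {a..b} f = integral {a..b} ?f" "integral {a..b} g = integral {a..b} ?g"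
    by (rule integral_spike[of "{b}"]; simp)+
  have "?f integrable_on {a..b}" "?g integrable_on {a..b}"
    by (rule integrable_spike_finite[of "{b}", OF _ _ f] integrable_spike_finite[of "{b}", OF _ _ g]; simp)+
  then have "norm (integral {a..b} ?f) \<le> integral {a..b} ?g"
    by (rule integral_norm_bound_integral) (use le in auto)
  then show ?thesis by (simp add: eq)
qed

section \<open>The bootstrap for the radial system\<close>

context radial_pair
begin

text \<open>Since \<open>c i \<le> c 2\<close>, the backward characteristic of either component
  stays in the backward cone of slope \<open>c 2\<close>; that cone is symmetric in y, as
  \<open>q_bound\<close> requires. The constant is 192 = 48 * 2^2, from the bootstrap level
  \<open>2 * \<delta>\<close>.\<close>

lemma duhamel_bounds:
  assumes t: "0 \<le> t" and "0 \<le> \<delta>"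
    and \<Gamma>: "\<And>i \<rho> t. 0 \<le> t \<Longrightarrow> integral {0..t} (kern (c i) (c (i + 1)) \<rho>) \<le> \<Gamma> / (1 + \<bar>\<rho>\<bar>)"
    and w: "\<And>i s y. 0 \<le> s \<Longrightarrow> s < t \<Longrightarrow> \<bar>y\<bar> \<le> \<bar>r\<bar> + c 2 * (t - s) \<Longrightarrow>
      \<bar>w i s y\<bar> \<le> 2 * \<delta> / (1 + \<bar>y - c i * s\<bar>)"
    and z: "\<And>i s y. 0 \<le> s \<Longrightarrow> s < t \<Longrightarrow> \<bar>y\<bar> \<le> \<bar>r\<bar> + c 2 * (t - s) \<Longrightarrow>
      \<bar>z i s y\<bar> \<le> 2 * \<delta> / (1 + \<bar>y - c i * s\<bar>)"
  shows "\<bar>w i t r - w i 0 (r - c i * t)\<bar> \<le> 192 * \<bar>A i\<bar> * \<Gamma> * \<delta>\<^sup>2 / (1 + \<bar>r - c i * t\<bar>)"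
    and "\<bar>z i t r - z i 0 (r - c i * t)\<bar> \<le> 192 * \<bar>A i\<bar> * \<Gamma> * \<delta>\<^sup>2 / (1 + \<bar>r - c i * t\<bar>)"
proof -
  define \<rho> where "\<rho> = r - c i * t"
  let ?K = "48 * \<bar>A i\<bar> * (2 * \<delta>)\<^sup>2"
  let ?f = "\<lambda>s. A i * (\<rho> + c i * s) * (q (i + 1) s (\<rho> + c i * s))\<^sup>2"
  let ?g = "\<lambda>s. A i * (2 * q (i + 1) s (\<rho> + c i * s) * m (i + 1) s (\<rho> + c i * s) - (q (i + 1) s (\<rho> + c i * s))\<^sup>2)"
  let ?k = "kern (c i) (c (i + 1)) \<rho>"
  have int: "?f integrable_on {0..t}" "?g integrable_on {0..t}" "(\<lambda>s. ?K * ?k s) integrable_on {0..t}"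
    unfolding m_def by (intro integrable_continuous_real continuous_intros continuous_on_kern; simp)+
  have src: "\<bar>?f s\<bar> \<le> ?K * ?k s" "\<bar>?g s\<bar> \<le> ?K * ?k s" if s: "0 \<le> s" "s < t" for s
  proof -
    have "\<bar>\<rho> + c i * s\<bar> = \<bar>r - c i * (t - s)\<bar>" by (simp add: \<rho>_def algebra_simps)
    also have "\<dots> \<le> \<bar>r\<bar> + c i * (t - s)" using c_pos[of i] s
      by (intro order_trans[OF abs_triangle_ineq4]) (simp add: abs_mult)
    also have "\<dots> \<le> \<bar>r\<bar> + c 2 * (t - s)" using c_le[of i] s by (simp add: mult_right_mono)
    finally have y: "\<bar>\<rho> + c i * s\<bar> \<le> \<bar>r\<bar> + c 2 * (t - s)" .
    show "\<bar>?f s\<bar> \<le> ?K * ?k s" "\<bar>?g s\<bar> \<le> ?K * ?k s"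
      using s y \<open>0 \<le> \<delta>\<close> by (intro source_bounds w z; linarith)+
  qed
  have "integral {0..t} (\<lambda>s. ?K * ?k s) = ?K * integral {0..t} ?k" by simp
  also have "\<dots> \<le> ?K * (\<Gamma> / (1 + \<bar>\<rho>\<bar>))" by (intro mult_left_mono \<Gamma> t) auto
  finally have K: "integral {0..t} (\<lambda>s. ?K * ?k s) \<le> 192 * \<bar>A i\<bar> * \<Gamma> * \<delta>\<^sup>2 / (1 + \<bar>\<rho>\<bar>)"
    by (simp add: mult_ac)
  have r: "r = \<rho> + c i * t" by (simp add: \<rho>_def)
  have "\<bar>integral {0..t} ?f\<bar> \<le> integral {0..t} (\<lambda>s. ?K * ?k s)"
       "\<bar>integral {0..t} ?g\<bar> \<le> integral {0..t} (\<lambda>s. ?K * ?k s)"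
    by (intro abs_integral_le_integral_but_endpoint int src; assumption)+
  with K transport[OF t, of i \<rho>] transport_deriv[OF t, of i \<rho>]
  show "\<bar>w i t r - w i 0 (r - c i * t)\<bar> \<le> 192 * \<bar>A i\<bar> * \<Gamma> * \<delta>\<^sup>2 / (1 + \<bar>r - c i * t\<bar>)"
    "\<bar>z i t r - z i 0 (r - c i * t)\<bar> \<le> 192 * \<bar>A i\<bar> * \<Gamma> * \<delta>\<^sup>2 / (1 + \<bar>r - c i * t\<bar>)"
    by (simp_all only: \<rho>_def[symmetric] r[symmetric]) linarith+
qed

text \<open>Continuity argument: at an earliest point where the weighted bound is attained, the Duhamel formula
  along the backward characteristic, which stays in a truncated cone, gives the strict bound.\<close>

lemma decay:
  assumes \<delta>: "0 < \<delta>"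
    and \<Gamma>: "\<And>i \<rho> t. 0 \<le> t \<Longrightarrow> integral {0..t} (kern (c i) (c (i + 1)) \<rho>) \<le> \<Gamma> / (1 + \<bar>\<rho>\<bar>)"
    and small: "\<And>i. 192 * \<bar>A i\<bar> * \<Gamma> * \<delta> < 1"
    and w0: "\<And>i r. \<bar>w i 0 r\<bar> \<le> \<delta> / (1 + \<bar>r\<bar>)"
    and z0: "\<And>i r. \<bar>z i 0 r\<bar> \<le> \<delta> / (1 + \<bar>r\<bar>)"
    and "0 \<le> T"
  shows "\<bar>w i T R\<bar> \<le> 2 * \<delta> / (1 + \<bar>R - c i * T\<bar>) \<and> \<bar>z i T R\<bar> \<le> 2 * \<delta> / (1 + \<bar>R - c i * T\<bar>)"
proof (rule ccontr)
  assume neg: "\<not> ?thesis"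
  define Wb where "Wb i = (\<lambda>(s, y). \<bar>w i s y\<bar> * (1 + \<bar>y - c i * s\<bar>))" for i
  define Zb where "Zb i = (\<lambda>(s, y). \<bar>z i s y\<bar> * (1 + \<bar>y - c i * s\<bar>))" for i
  \<comment> \<open>With the fastest speed as slope, \<open>K\<close> contains the backward cone of
    each of its points.\<close>
  define K where "K = {p \<in> {0..T} \<times> {- (\<bar>R\<bar> + c 2 * T)..\<bar>R\<bar> + c 2 * T}. \<bar>snd p\<bar> \<le> \<bar>R\<bar> + c 2 * (T - fst p)}"
  \<comment> \<open>Non-strict inequalities make the bad set closed, so an earliest bad point
    exists; in return the contradiction needs strict bounds at that point.\<close>
  define Z where "Z = (\<Union>i. {p \<in> K. 2 * \<delta> \<le> Wb i p} \<union> {p \<in> K. 2 * \<delta> \<le> Zb i p})"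
  have K_iff: "(s, y) \<in> K \<longleftrightarrow> 0 \<le> s \<and> s \<le> T \<and> \<bar>y\<bar> \<le> \<bar>R\<bar> + c 2 * (T - s)" for s y
  proof -
    have "0 \<le> s \<Longrightarrow> 0 \<le> c 2 * s" using c_pos[of 2] by simp
    then show ?thesis by (auto simp: K_def algebra_simps)
  qed
  have "closed K"
    unfolding K_def by (intro continuous_on_closed_Collect_le continuous_intros closed_Times)
  have contb: "continuous_on K (Wb i)" "continuous_on K (Zb i)" for i
    unfolding Wb_def Zb_def split_beta by (intro continuous_intros; auto simp: K_def)+
  have "closed Z"
    unfolding Z_def by (intro closed_UN ballI closed_Un continuous_on_closed_Collect_le contb continuous_intros \<open>closed K\<close>) auto
  have "compact Z"
  proof (rule compact_Int_closed[of "{0..T} \<times> {- (\<bar>R\<bar> + c 2 * T)..\<bar>R\<bar> + c 2 * T}" Z, THEN back_subst[of compact]])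
    show "({0..T} \<times> {- (\<bar>R\<bar> + c 2 * T)..\<bar>R\<bar> + c 2 * T}) \<inter> Z = Z" by (auto simp: Z_def K_def)
  qed (use \<open>closed Z\<close> in \<open>auto intro: compact_Times\<close>)
  have bad_iff: "(s, y) \<in> Z \<longleftrightarrow> (s, y) \<in> K \<and> (\<exists>i. \<not> \<bar>w i s y\<bar> < 2 * \<delta> / (1 + \<bar>y - c i * s\<bar>) \<or> \<not> \<bar>z i s y\<bar> < 2 * \<delta> / (1 + \<bar>y - c i * s\<bar>))" for s y
    by (simp add: Z_def Wb_def Zb_def pos_less_divide_eq not_less) blast
  have "(T, R) \<in> Z"
    using neg \<open>0 \<le> T\<close> by (auto simp: bad_iff K_iff intro!: exI[of _ i])
  then obtain t r where tr: "(t, r) \<in> Z" and min: "\<And>p. p \<in> Z \<Longrightarrow> t \<le> fst p"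
    using continuous_attains_inf[OF \<open>compact Z\<close>, of fst] by (fastforce intro: continuous_intros)
  have K: "(t, r) \<in> K" and t: "0 \<le> t" using tr by (auto simp: bad_iff K_iff)
  have good: "\<bar>w i s y\<bar> \<le> 2 * \<delta> / (1 + \<bar>y - c i * s\<bar>)" "\<bar>z i s y\<bar> \<le> 2 * \<delta> / (1 + \<bar>y - c i * s\<bar>)"
    if "0 \<le> s" "s < t" "\<bar>y\<bar> \<le> \<bar>r\<bar> + c 2 * (t - s)" for i s y
  proof -
    have "(s, y) \<in> K" using that K by (auto simp: K_iff algebra_simps)
    moreover have "(s, y) \<notin> Z" using min[of "(s, y)"] that by auto
    ultimately show "\<bar>w i s y\<bar> \<le> 2 * \<delta> / (1 + \<bar>y - c i * s\<bar>)" "\<bar>z i s y\<bar> \<le> 2 * \<delta> / (1 + \<bar>y - c i * s\<bar>)"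
      unfolding bad_iff by (meson less_imp_le)+
  qed
  note db = duhamel_bounds[OF t less_imp_le[OF \<delta>] \<Gamma> good]
  have "192 * \<bar>A i\<bar> * \<Gamma> * \<delta>\<^sup>2 / (1 + \<bar>\<rho>\<bar>) < \<delta> / (1 + \<bar>\<rho>\<bar>)" for i \<rho>
    using mult_strict_right_mono[OF small[of i] \<delta>] by (intro divide_strict_right_mono) (auto simp: power2_eq_square mult_ac)
  note sm = this
  have comb: "\<bar>a\<bar> < 2 * \<delta> / (1 + X)" if "\<bar>a - b\<bar> \<le> U" "\<bar>b\<bar> \<le> \<delta> / (1 + X)" "U < \<delta> / (1 + X)" for a b U X
  proof -
    have "2 * \<delta> / (1 + X) = \<delta> / (1 + X) + \<delta> / (1 + X)" by (simp only: mult_2 add_divide_distrib)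
    with that show ?thesis by linarith
  qed
  have "\<bar>w i t r\<bar> < 2 * \<delta> / (1 + \<bar>r - c i * t\<bar>) \<and> \<bar>z i t r\<bar> < 2 * \<delta> / (1 + \<bar>r - c i * t\<bar>)" for i
    using comb[OF db(1) w0 sm] comb[OF db(2) z0 sm] by blast
  with tr show False by (auto simp: bad_iff)
qed

end

subsection \<open>Logarithmic growth near the slower cone\<close>

text \<open>\<eta> is the initial profile of \<open>w\<close> up to sign and \<epsilon>. Its
  inverse-square decay keeps the free part of r u of size \<epsilon>. \<open>small1\<close> is the
  smallness that \<open>decay\<close> asks for at level \<open>\<epsilon> * B\<close>, and
  \<open>small2\<close> keeps the Duhamel correction below a quarter of the bump height
  \<open>k0 * \<epsilon>\<close>.\<close>

locale radial_pair_data = radial_pair +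
  fixes \<eta> \<eta>' :: "real \<Rightarrow> real" and B k0 \<Gamma> D \<epsilon> :: real
  assumes A1: "A 1 \<noteq> 0"
    and B: "0 < B" and k0: "0 < k0"
    and \<eta>_nonneg: "0 \<le> \<rho> \<Longrightarrow> 0 \<le> \<eta> \<rho>" and \<eta>_nonpos: "\<rho> \<le> 0 \<Longrightarrow> \<eta> \<rho> \<le> 0"
    and \<eta>_lower: "1 \<le> \<rho> \<Longrightarrow> \<rho> \<le> 2 \<Longrightarrow> k0 \<le> \<eta> \<rho>"
    and \<eta>_bound: "\<bar>\<eta> \<rho>\<bar> \<le> B / (1 + \<bar>\<rho>\<bar>)\<^sup>2" and \<eta>'_bound: "\<bar>\<eta>' \<rho>\<bar> \<le> B / (1 + \<bar>\<rho>\<bar>)\<^sup>2"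
    and \<eta>_deriv: "(\<eta> has_real_derivative \<eta>' \<rho>) (at \<rho>)"
    and \<Gamma>: "0 \<le> t \<Longrightarrow> integral {0..t} (kern (c i) (c (i + 1)) \<rho>) \<le> \<Gamma> / (1 + \<bar>\<rho>\<bar>)"
    and D_def: "D = 192 * (\<bar>A 1\<bar> + \<bar>A 2\<bar>) * \<Gamma> * B\<^sup>2"
    and \<epsilon>: "0 < \<epsilon>" "\<epsilon> \<le> 1" and small1: "192 * (\<bar>A 1\<bar> + \<bar>A 2\<bar>) * \<Gamma> * B * \<epsilon> < 1"
    and small2: "D * \<epsilon> \<le> k0 / 4"
    and init: "w i 0 \<rho> = \<epsilon> * (if i = 1 then sgn (A 1) else 1) * \<eta> \<rho>"
begin

lemma A_le: "\<bar>A i\<bar> \<le> \<bar>A 1\<bar> + \<bar>A 2\<bar>"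
  using exhaust_2[of i] by auto

lemma \<Gamma>_nonneg: "0 \<le> \<Gamma>"
  using \<Gamma>[of 0 1 0] by simp

lemma D_nonneg: "0 \<le> D"
  using \<Gamma>_nonneg by (simp add: D_def)

lemma deriv_init: "z i 0 \<rho> = \<epsilon> * (if i = 1 then sgn (A 1) else 1) * \<eta>' \<rho>"
proof -
  have "(w i 0 has_real_derivative \<epsilon> * (if i = 1 then sgn (A 1) else 1) * \<eta>' \<rho>) (at \<rho>)"
    using DERIV_cmult[OF \<eta>_deriv[of \<rho>], of "\<epsilon> * (if i = 1 then sgn (A 1) else 1)"]
    by (simp only: init[abs_def])
  with deriv_w[of 0 i \<rho>] show ?thesis by (auto intro: DERIV_unique)
qed

lemma init_bounds:
  "\<bar>w i 0 \<rho>\<bar> \<le> \<epsilon> * B / (1 + \<bar>\<rho>\<bar>)\<^sup>2" "\<bar>w i 0 \<rho>\<bar> \<le> \<epsilon> * B / (1 + \<bar>\<rho>\<bar>)" "\<bar>z i 0 \<rho>\<bar> \<le> \<epsilon> * B / (1 + \<bar>\<rho>\<bar>)"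
proof -
  have "1 + \<bar>\<rho>\<bar> \<le> (1 + \<bar>\<rho>\<bar>)\<^sup>2" by (simp add: power2_eq_square algebra_simps)
  then have le: "\<epsilon> * B / (1 + \<bar>\<rho>\<bar>)\<^sup>2 \<le> \<epsilon> * B / (1 + \<bar>\<rho>\<bar>)"
    using B \<epsilon> by (intro divide_left_mono) auto
  have s: "\<bar>if i = 1 then sgn (A 1) else 1\<bar> = (1::real)" using A1 by (simp add: abs_sgn_eq)
  show 1: "\<bar>w i 0 \<rho>\<bar> \<le> \<epsilon> * B / (1 + \<bar>\<rho>\<bar>)\<^sup>2"
    using mult_left_mono[OF \<eta>_bound[of \<rho>], of \<epsilon>] \<epsilon> by (simp only: init abs_mult s) simp
  have 2: "\<bar>z i 0 \<rho>\<bar> \<le> \<epsilon> * B / (1 + \<bar>\<rho>\<bar>)\<^sup>2"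
    using mult_left_mono[OF \<eta>'_bound[of \<rho>], of \<epsilon>] \<epsilon> by (simp only: deriv_init abs_mult s) simp
  show "\<bar>w i 0 \<rho>\<bar> \<le> \<epsilon> * B / (1 + \<bar>\<rho>\<bar>)" "\<bar>z i 0 \<rho>\<bar> \<le> \<epsilon> * B / (1 + \<bar>\<rho>\<bar>)"
    using order_trans[OF 1 le] order_trans[OF 2 le] .
qed

text \<open>The bootstrap bounds of \<open>decay\<close> at level \<open>\<epsilon> * B\<close> are
  fed once more into the Duhamel formula, which shows that the deviation from free transport is of
  second order in \<epsilon>.\<close>

lemma duhamel_decay:
  assumes "0 \<le> t"
  shows "\<bar>w i t r - w i 0 (r - c i * t)\<bar> \<le> D * \<epsilon>\<^sup>2 / (1 + \<bar>r - c i * t\<bar>)"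
proof -
  have pos: "0 < \<epsilon> * B" using \<epsilon> B by simp
  have "192 * \<bar>A i\<bar> * \<Gamma> * (\<epsilon> * B) \<le> 192 * (\<bar>A 1\<bar> + \<bar>A 2\<bar>) * \<Gamma> * (\<epsilon> * B)" for i
    using A_le[of i] \<Gamma>_nonneg \<epsilon> B by (intro mult_right_mono mult_left_mono) auto
  then have sm: "192 * \<bar>A i\<bar> * \<Gamma> * (\<epsilon> * B) < 1" for i
    by (rule le_less_trans) (use small1 in \<open>simp add: mult_ac\<close>)
  note dec = decay[OF pos \<Gamma> sm init_bounds(2,3)]
  have "\<bar>w i t r - w i 0 (r - c i * t)\<bar> \<le> 192 * \<bar>A i\<bar> * \<Gamma> * (\<epsilon> * B)\<^sup>2 / (1 + \<bar>r - c i * t\<bar>)"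
    by (rule duhamel_bounds(1)[OF assms less_imp_le[OF pos] \<Gamma>]) (use dec in blast)+
  also have "\<dots> \<le> D * \<epsilon>\<^sup>2 / (1 + \<bar>r - c i * t\<bar>)"
  proof (rule divide_right_mono)
    have "192 * \<bar>A i\<bar> * \<Gamma> * (\<epsilon> * B)\<^sup>2 \<le> 192 * (\<bar>A 1\<bar> + \<bar>A 2\<bar>) * \<Gamma> * (\<epsilon> * B)\<^sup>2"
      using A_le[of i] \<Gamma>_nonneg \<epsilon> B by (intro mult_right_mono mult_left_mono) auto
    then show "192 * \<bar>A i\<bar> * \<Gamma> * (\<epsilon> * B)\<^sup>2 \<le> D * \<epsilon>\<^sup>2"
      by (simp add: D_def power_mult_distrib mult_ac)
  qed simp
  finally show ?thesis .
qed

text \<open>In 2 y q = w(y) - w(-y) the free part of w(y) is at least k0 \<epsilon>, the free part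
  of w(-y) is nonpositive, and each Duhamel error is at most k0 \<epsilon> / 4. So y q \<ge> k0
  \<epsilon> / 4, and y q^2 = (y q)^2 / y.\<close>

lemma source_lower:
  assumes t: "0 \<le> t" and y: "0 < y" and near: "1 \<le> y - c 2 * t" "y - c 2 * t \<le> 2"
  shows "(k0 * \<epsilon> / 4)\<^sup>2 / y \<le> y * (q 2 t y)\<^sup>2"
proof -
  have le: "D * \<epsilon>\<^sup>2 / (1 + \<bar>x\<bar>) \<le> k0 * \<epsilon> / 4" for x
  proof -
    have "D * \<epsilon>\<^sup>2 / (1 + \<bar>x\<bar>) \<le> D * \<epsilon>\<^sup>2"
      using D_nonneg by (simp add: divide_le_eq mult_right_mono algebra_simps)
    also have "\<dots> \<le> k0 / 4 * \<epsilon>"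
      using mult_right_mono[OF small2, of \<epsilon>] \<epsilon> by (simp add: power2_eq_square mult_ac)
    finally show ?thesis by simp
  qed
  have ct: "0 \<le> c 2 * t" using c_pos[of 2] t by simp
  have "\<epsilon> * k0 \<le> w 2 0 (y - c 2 * t)"
    using \<eta>_lower[OF near] \<epsilon> by (simp add: init)
  moreover have "w 2 0 (- y - c 2 * t) \<le> 0"
    using \<eta>_nonpos[of "- y - c 2 * t"] y ct \<epsilon> by (simp add: init mult_le_0_iff)
  moreover note duhamel_decay[OF t, of 2 y] duhamel_decay[OF t, of 2 "- y"]
    le[of "y - c 2 * t"] le[of "- y - c 2 * t"]
  moreover have "2 * y * q 2 t y = w 2 t y - w 2 t (- y)" by (rule odd_part[OF t])
  ultimately have "k0 * \<epsilon> / 4 \<le> y * q 2 t y" by (simp only: mult.commute[of \<epsilon> k0])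
  then have "(k0 * \<epsilon> / 4)\<^sup>2 \<le> (y * q 2 t y)\<^sup>2"
    using k0 \<epsilon> by (intro power_mono) auto
  then have "(k0 * \<epsilon> / 4)\<^sup>2 / y \<le> (y * q 2 t y)\<^sup>2 / y" using y by (intro divide_right_mono) auto
  also have "\<dots> = y * (q 2 t y)\<^sup>2" using y by (simp add: power2_eq_square)
  finally show ?thesis .
qed

lemma duhamel_1: 
  assumes "0 \<le> s"
  shows "sgn (A 1) * (w 1 s (\<rho> + c 1 * s) - w 1 0 \<rho>)
    = integral {0..s} (\<lambda>\<sigma>. \<bar>A 1\<bar> * ((\<rho> + c 1 * \<sigma>) * (q 2 \<sigma> (\<rho> + c 1 * \<sigma>))\<^sup>2))"
proof -
  have "sgn (A 1) * (w 1 s (\<rho> + c 1 * s) - w 1 0 \<rho>)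
    = integral {0..s} (\<lambda>\<sigma>. sgn (A 1) * (A 1 * (\<rho> + c 1 * \<sigma>) * (q 2 \<sigma> (\<rho> + c 1 * \<sigma>))\<^sup>2))"
    by (simp add: transport[OF assms, of 1 \<rho>])
  also have "(\<lambda>\<sigma>. sgn (A 1) * (A 1 * (\<rho> + c 1 * \<sigma>) * (q 2 \<sigma> (\<rho> + c 1 * \<sigma>))\<^sup>2))
    = (\<lambda>\<sigma>. \<bar>A 1\<bar> * ((\<rho> + c 1 * \<sigma>) * (q 2 \<sigma> (\<rho> + c 1 * \<sigma>))\<^sup>2))"
    by (simp add: abs_sgn mult_ac)
  finally show ?thesis .
qed

lemma integrable_source:
  assumes "0 \<le> a"
  shows "(\<lambda>\<sigma>. \<bar>A 1\<bar> * ((\<rho> + c 1 * \<sigma>) * (q 2 \<sigma> (\<rho> + c 1 * \<sigma>))\<^sup>2)) integrable_on {a..b}"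
  using assms by (intro integrable_continuous_real continuous_intros) auto

text \<open>A characteristic with \<rho> \<ge> 0 stays in r \<ge> 0, where the source A r q^2 has
  the sign of A.\<close>

lemma duhamel_1_nonneg:
  assumes "0 \<le> s" "0 \<le> \<rho>"
  shows "0 \<le> sgn (A 1) * (w 1 s (\<rho> + c 1 * s) - w 1 0 \<rho>)"
  unfolding duhamel_1[OF assms(1)]
  using assms c_pos[of 1] by (intro integral_nonneg integrable_source mult_nonneg_nonneg add_nonneg_nonneg) auto

text \<open>By time \<open>\<rho> / (c 2 - c 1)\<close> the characteristic has crossed the bump
  carried by the faster cone. As the source never changes sign, what was gained during the crossing
  is kept.\<close>

lemma duhamel_1_lower:
  assumes \<rho>: "2 \<le> \<rho>" and s: "\<rho> / (c 2 - c 1) \<le> s"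
  shows "\<bar>A 1\<bar> * k0\<^sup>2 / (16 * c 2) * \<epsilon>\<^sup>2 / \<rho> \<le> sgn (A 1) * (w 1 s (\<rho> + c 1 * s) - w 1 0 \<rho>)"
proof -
  have c: "0 < c 1" "0 < c 2" "0 < c 2 - c 1" using c_pos c_less by auto
  \<comment> \<open>Along the characteristic y - c2 \<sigma> = \<rho> - (c2 - c1) \<sigma>, which
    lies in [1, 2] exactly for \<sigma> between \<open>a\<close> and \<open>b\<close>; \<rho> \<ge>
    2 keeps \<open>a\<close> nonnegative.\<close>
  define a where "a = (\<rho> - 2) / (c 2 - c 1)"
  define b where "b = (\<rho> - 1) / (c 2 - c 1)"
  have ab: "0 \<le> a" "a \<le> b" "b \<le> \<rho> / (c 2 - c 1)"
    using c \<rho> by (auto simp: a_def b_def divide_simps)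
  have s0: "0 \<le> s" using ab s by linarith
  let ?f = "\<lambda>\<sigma>. \<bar>A 1\<bar> * ((\<rho> + c 1 * \<sigma>) * (q 2 \<sigma> (\<rho> + c 1 * \<sigma>))\<^sup>2)"
  define K where "K = \<bar>A 1\<bar> * ((k0 * \<epsilon> / 4)\<^sup>2 * (c 2 - c 1) / (c 2 * \<rho>))"
  have "K * (b - a) = integral {a..b} (\<lambda>\<sigma>. K)" using ab by simp
  also have "\<dots> \<le> integral {a..b} ?f"
  proof (rule integral_le)
    show "?f integrable_on {a..b}" by (rule integrable_source[OF ab(1)])
    show "K \<le> ?f \<sigma>" if \<sigma>: "\<sigma> \<in> {a..b}" for \<sigma>
    proof -
      let ?y = "\<rho> + c 1 * \<sigma>"
      have \<sigma>0: "0 \<le> \<sigma>" using \<sigma> ab by auto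
      have y: "0 < ?y" using \<sigma>0 c \<rho> by (intro add_pos_nonneg) auto
      have bounds: "\<rho> - 2 \<le> (c 2 - c 1) * \<sigma>" "(c 2 - c 1) * \<sigma> \<le> \<rho> - 1"
        using \<sigma> c by (auto simp: a_def b_def divide_simps mult.commute)
      then have near: "1 \<le> ?y - c 2 * \<sigma>" "?y - c 2 * \<sigma> \<le> 2" by (auto simp: algebra_simps)
      have "\<sigma> \<le> \<rho> / (c 2 - c 1)" using \<sigma> ab by auto
      then have "c 1 * \<sigma> \<le> c 1 * (\<rho> / (c 2 - c 1))" using c by (intro mult_left_mono) auto
      \<comment> \<open>At the crossing the radius is at most a multiple of \<rho>, so the lower
        bound of order 1 / y becomes one of order 1 / \<rho>.\<close>
      then have "?y \<le> c 2 * \<rho> / (c 2 - c 1)" using c by (simp add: field_simps)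
      then have "(k0 * \<epsilon> / 4)\<^sup>2 / (c 2 * \<rho> / (c 2 - c 1)) \<le> (k0 * \<epsilon> / 4)\<^sup>2 / ?y"
        using y c \<rho> by (intro divide_left_mono mult_pos_pos) auto
      also have "\<dots> \<le> ?y * (q 2 \<sigma> ?y)\<^sup>2" by (rule source_lower[OF \<sigma>0 y near])
      finally have "(k0 * \<epsilon> / 4)\<^sup>2 * (c 2 - c 1) / (c 2 * \<rho>) \<le> ?y * (q 2 \<sigma> ?y)\<^sup>2" by simp
      then show ?thesis unfolding K_def by (rule mult_left_mono) simp
    qed
  qed (rule integrable_const_ivl)
  also have "\<dots> \<le> integral {0..s} ?f"
  proof (rule integral_subset_le)
    show "{a..b} \<subseteq> {0..s}" using ab s by auto
    show "\<forall>\<sigma>\<in>{0..s}. 0 \<le> ?f \<sigma>"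
      using c \<rho> by (intro ballI mult_nonneg_nonneg add_nonneg_nonneg) auto
  qed (use integrable_source ab in auto)
  also have "K * (b - a) = \<bar>A 1\<bar> * k0\<^sup>2 / (16 * c 2) * \<epsilon>\<^sup>2 / \<rho>"
  proof -
    have "b - a = 1 / (c 2 - c 1)" by (simp add: a_def b_def diff_divide_distrib[symmetric])
    then show ?thesis using c \<rho> by (simp add: K_def power_mult_distrib power_divide)
  qed
  finally show ?thesis unfolding duhamel_1[OF s0] .
qed

text \<open>The free part of r u. As s grows, \<rho> decreases at rate 2 c1 from r + c1 t to r - c1
  t; the hypotheses give r - c1 t \<le> 1 and r + c1 t \<ge> 2, so it passes through the whole
  window [1, 2] where \<eta> is at least \<open>k0\<close>, which takes time 1 / (2 c1).\<close>

lemma profile_integrals: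
  assumes t: "2 \<le> c 1 * t" and r: "c 1 * t \<le> r" "r \<le> c 1 * t + 1"
  defines "\<rho> \<equiv> \<lambda>s. r + c 1 * t - 2 * c 1 * s"
  shows "k0 * \<epsilon> / (2 * c 1) \<le> integral {0..t} (\<lambda>s. \<epsilon> * \<eta> (\<rho> s))"
    and "integral {0..t} (\<lambda>s. \<epsilon> * \<eta> (\<rho> s)) \<le> \<epsilon> * B / c 1"
proof -
  have c: "0 < c 1" using c_pos .
  have t0: "0 \<le> t" using t c zero_le_mult_iff[of "c 1" t] by linarith
  have \<rho>0: "0 \<le> \<rho> s" if "s \<le> t" for s
  proof -
    have "2 * c 1 * s \<le> 2 * c 1 * t" using that c by (intro mult_left_mono) auto
    then show ?thesis using r by (simp add: \<rho>_def)
  qed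
  have "continuous_on UNIV \<eta>"
    using \<eta>_deriv by (intro continuous_at_imp_continuous_on) (blast intro: DERIV_isCont)
  then have cont: "continuous_on S (\<lambda>s. \<eta> (\<rho> s))" for S
    unfolding \<rho>_def by (rule continuous_on_compose2) (auto intro!: continuous_intros)
  have int: "(\<lambda>s. \<epsilon> * \<eta> (\<rho> s)) integrable_on {a..b}" for a b
    by (intro integrable_continuous_real continuous_intros cont)
  define a where "a = (r + c 1 * t - 2) / (2 * c 1)"
  define b where "b = (r + c 1 * t - 1) / (2 * c 1)"
  have ab: "0 \<le> a" "a \<le> b" "b \<le> t" "b - a = 1 / (2 * c 1)"
    using c r t by (auto simp: a_def b_def divide_simps algebra_simps)
  have "k0 * \<epsilon> / (2 * c 1) = integral {a..b} (\<lambda>s. \<epsilon> * k0)"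
    using ab by (simp add: mult.commute)
  also have "\<dots> \<le> integral {a..b} (\<lambda>s. \<epsilon> * \<eta> (\<rho> s))"
  proof (rule integral_le)
    show "\<epsilon> * k0 \<le> \<epsilon> * \<eta> (\<rho> s)" if "s \<in> {a..b}" for s
      using that c \<epsilon> by (intro mult_left_mono \<eta>_lower) (auto simp: \<rho>_def a_def b_def divide_simps algebra_simps)
  qed (intro int integrable_const_ivl)+
  also have "\<dots> \<le> integral {0..t} (\<lambda>s. \<epsilon> * \<eta> (\<rho> s))"
    using ab \<epsilon> by (intro integral_subset_le int) (auto intro!: mult_nonneg_nonneg \<eta>_nonneg \<rho>0)
  finally show "k0 * \<epsilon> / (2 * c 1) \<le> integral {0..t} (\<lambda>s. \<epsilon> * \<eta> (\<rho> s))" .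
  let ?P = "\<lambda>s. 1 / (1 + \<bar>(r + c 1 * t) + (- 2 * c 1) * s\<bar>)\<^sup>2"
  have "integral {0..t} (\<lambda>s. \<epsilon> * \<eta> (\<rho> s)) \<le> integral {0..t} (\<lambda>s. \<epsilon> * B * ?P s)"
  proof (intro integral_le int)
    show "(\<lambda>s. \<epsilon> * B * ?P s) integrable_on {0..t}"
      by (intro integrable_continuous_real continuous_intros) auto
    show "\<epsilon> * \<eta> (\<rho> s) \<le> \<epsilon> * B * ?P s" for s
      using mult_left_mono[OF order_trans[OF abs_ge_self \<eta>_bound[of "\<rho> s"]], of \<epsilon>] \<epsilon>
      by (simp add: \<rho>_def)
  qed
  also have "\<dots> = \<epsilon> * B * integral {0..t} ?P" by (rule integral_mult_right)
  also have "\<dots> \<le> \<epsilon> * B * (2 / \<bar>- 2 * c 1\<bar>)"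
    using integral_inverse_square_affine_le[of "- 2 * c 1" 0 t "r + c 1 * t"] c t0 B \<epsilon>
    by (intro mult_left_mono) auto
  finally show "integral {0..t} (\<lambda>s. \<epsilon> * \<eta> (\<rho> s)) \<le> \<epsilon> * B / c 1" using c by simp
qed

lemma has_integral_inverse_affine:
  fixes a b k p :: real
  assumes "0 < k" "a \<le> b" "0 < p - k * b"
  shows "((\<lambda>s. 1 / (p - k * s)) has_integral (ln (p - k * a) - ln (p - k * b)) / k) {a..b}"
proof -
  have "((\<lambda>s. 1 / (p - k * s)) has_integral (- ln (p - k * b) / k - - ln (p - k * a) / k)) {a..b}"
  proof (rule fundamental_theorem_of_calculus[OF \<open>a \<le> b\<close>])
    fix s assume "s \<in> {a..b}"
    then have "k * s \<le> k * b" using assms by (intro mult_left_mono) auto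
    then have "0 < p - k * s" using assms by linarith
    then show "((\<lambda>s. - ln (p - k * s) / k) has_vector_derivative 1 / (p - k * s)) (at s within {a..b})"
      unfolding has_real_derivative_iff_has_vector_derivative[symmetric]
      using assms by (auto intro!: derivative_eq_intros simp: field_simps)
  qed
  then show ?thesis by (simp add: diff_divide_distrib)
qed

text \<open>Both terms of the integral representation have the sign of \<open>A 1\<close>, hence add up in absolute value.\<close>

lemma two_sided:
  assumes t: "2 \<le> c 1 * t" and r: "c 1 * t \<le> r" "r \<le> c 1 * t + 1"
    and v: "v = integral {0..t} (\<lambda>s. w 1 s (r + c 1 * (t - s)))"
  defines "d \<equiv> 2 * c 1 * (c 2 - c 1) / (c 1 + c 2)"
  shows "k0 * \<epsilon> / (2 * c 1) + \<bar>A 1\<bar> * k0\<^sup>2 / (16 * c 2) * \<epsilon>\<^sup>2 * (max 0 (ln (d * t / 2)) / (2 * c 1)) \<le> \<bar>v\<bar>"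
    and "\<bar>v\<bar> \<le> \<epsilon> * B / c 1 + D * \<epsilon>\<^sup>2 * (ln (2 + 2 * c 1 * t) / (2 * c 1))"
proof -
  have c: "0 < c 1" "0 < c 2" "0 < c 2 - c 1" using c_pos c_less by auto
  have t0: "0 \<le> t" using t c zero_le_mult_iff[of "c 1" t] by linarith
  define \<rho> where "\<rho> s = r + c 1 * t - 2 * c 1 * s" for s
  define W where "W s = sgn (A 1) * (w 1 s (\<rho> s + c 1 * s) - w 1 0 (\<rho> s))" for s
  define h where "h s = \<epsilon> * \<eta> (\<rho> s)" for s
  have \<rho>0: "0 \<le> \<rho> s" if "s \<le> t" for s
  proof -
    have "2 * c 1 * s \<le> 2 * c 1 * t" using that c by (intro mult_left_mono) auto
    then show ?thesis using r by (simp add: \<rho>_def)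
  qed
  have cw: "continuous_on {0..t} (\<lambda>s. w 1 s (r + c 1 * (t - s)))"
    by (intro continuous_intros) auto
  have sgn: "sgn (A 1) * sgn (A 1) = 1" using A1 by (simp add: sgn_if)
  have h: "h s = sgn (A 1) * w 1 0 (\<rho> s)" for s
    using sgn by (simp add: h_def init mult.assoc[symmetric] mult.commute[of "sgn (A 1)"])
  have W: "W s = sgn (A 1) * w 1 s (r + c 1 * (t - s)) - h s" for s
    by (simp add: W_def h \<rho>_def algebra_simps)
  have ch: "continuous_on {0..t} h"
    unfolding h[abs_def] \<rho>_def by (intro continuous_intros) auto
  have cW: "continuous_on {0..t} W"
    unfolding W[abs_def] by (intro continuous_intros cw ch)
  have W0: "0 \<le> W s" if "0 \<le> s" "s \<le> t" for s
    unfolding W_def using that \<rho>0 by (intro duhamel_1_nonneg)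
  have "sgn (A 1) * v = integral {0..t} (\<lambda>s. h s + W s)"
    unfolding v W by simp
  also have "\<dots> = integral {0..t} h + integral {0..t} W"
    by (intro integral_add integrable_continuous_real ch cW)
  finally have split: "sgn (A 1) * v = integral {0..t} h + integral {0..t} W" .
  have IW: "0 \<le> integral {0..t} W"
    by (intro integral_nonneg integrable_continuous_real cW W0) auto
  note pi = profile_integrals[OF t r, folded \<rho>_def h_def]
  have "0 < k0 * \<epsilon> / (2 * c 1)" using k0 \<epsilon> c by simp
  with pi IW split have "0 < sgn (A 1) * v" by linarith
  then have "\<bar>v\<bar> = \<bar>sgn (A 1) * v\<bar>" using A1 by (simp add: abs_mult abs_sgn_eq)
  also have "\<dots> = sgn (A 1) * v" using \<open>0 < sgn (A 1) * v\<close> by simp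
  finally have v_eq: "\<bar>v\<bar> = integral {0..t} h + integral {0..t} W" using split by simp
  let ?\<kappa> = "\<bar>A 1\<bar> * k0\<^sup>2 / (16 * c 2) * \<epsilon>\<^sup>2"
  have "?\<kappa> * (max 0 (ln (d * t / 2)) / (2 * c 1)) \<le> integral {0..t} W"
  proof (cases "2 \<le> d * t")
    case False
    have "0 \<le> d * t" using c t0 by (simp add: d_def)
    then have "ln (d * t / 2) \<le> 0"
    proof (cases "d * t = 0")
      case True
      then show ?thesis by (simp only:) simp
    next
      case nz: False
      then have "0 < d * t / 2" using \<open>0 \<le> d * t\<close> by linarith
      then show ?thesis using False ln_le_zero_iff by simp
    qed
    then show ?thesis using IW by simp
  next
    case True
    have "d \<le> 2 * c 1" using c by (simp add: d_def divide_simps)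
    then have dt: "d * t \<le> 2 * c 1 * t" using t0 by (rule mult_right_mono)
    \<comment> \<open>The times at which \<rho> equals \<open>d * t\<close> and 2. The integral of 1
      / \<rho> between them is the logarithm of their ratio, divided by 2 c1.\<close>
    define a where "a = (r + c 1 * t - d * t) / (2 * c 1)"
    define b where "b = (r + c 1 * t - 2) / (2 * c 1)"
    have ab: "0 \<le> a" "a \<le> b" "b \<le> t"
      using c r t dt True by (auto simp: a_def b_def divide_simps algebra_simps)
    have \<rho>ab: "\<rho> a = d * t" "\<rho> b = 2" using c by (auto simp: \<rho>_def a_def b_def)
    have \<rho>_range: "2 \<le> \<rho> s" "\<rho> s \<le> d * t" if "s \<in> {a..b}" for s
    proof -
      have "2 * c 1 * a \<le> 2 * c 1 * s" "2 * c 1 * s \<le> 2 * c 1 * b"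
        using that c by (auto intro!: mult_left_mono)
      then show "2 \<le> \<rho> s" "\<rho> s \<le> d * t" using \<rho>ab by (auto simp: \<rho>_def)
    qed
    have I: "((\<lambda>s. 1 / \<rho> s) has_integral (ln (d * t) - ln 2) / (2 * c 1)) {a..b}"
      using has_integral_inverse_affine[of "2 * c 1" a b "r + c 1 * t"] c ab \<rho>ab
      by (simp add: \<rho>_def[symmetric])
    have "?\<kappa> * (max 0 (ln (d * t / 2)) / (2 * c 1)) = ?\<kappa> * ((ln (d * t) - ln 2) / (2 * c 1))"
      using True ln_divide_pos[of "d * t" 2] ln_mono[of 2 "d * t"] by simp
    also have "\<dots> = integral {a..b} (\<lambda>s. ?\<kappa> * (1 / \<rho> s))"
      using integral_unique[OF has_integral_mult_right[OF I, of ?\<kappa>]] by simp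
    also have "\<dots> \<le> integral {a..b} W"
    proof (rule integral_le)
      show "(\<lambda>s. ?\<kappa> * (1 / \<rho> s)) integrable_on {a..b}"
        using has_integral_mult_right[OF I, of ?\<kappa>] by (rule has_integral_integrable)
      show "W integrable_on {a..b}"
        using ab by (intro integrable_continuous_real continuous_on_subset[OF cW]) auto
      show "?\<kappa> * (1 / \<rho> s) \<le> W s" if s: "s \<in> {a..b}" for s
      proof -
        \<comment> \<open>This fixes the value of \<open>d\<close>. The crossing is over by time s =
          (r + c1 t - \<rho>) / (2 c1) exactly if \<rho> (c1 + c2) \<le> (c2 - c1) (r + c1 t), and
          since r \<ge> c1 t it is enough that \<rho> \<le> d t.\<close>
        have "\<rho> s \<le> 2 * c 1 * (c 2 - c 1) / (c 1 + c 2) * t" using \<rho>_range[OF s] by (simp add: d_def)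
        then have "\<rho> s * (c 1 + c 2) \<le> 2 * c 1 * (c 2 - c 1) * t"
          using c by (simp add: field_simps)
        also have "\<dots> = (c 2 - c 1) * (2 * (c 1 * t))" by simp
        also have "\<dots> \<le> (c 2 - c 1) * (r + c 1 * t)" using c(3) r(1) by (intro mult_left_mono) linarith+
        also have "r + c 1 * t = \<rho> s + 2 * c 1 * s" by (simp add: \<rho>_def)
        finally have "2 * c 1 * \<rho> s \<le> 2 * c 1 * ((c 2 - c 1) * s)" by (simp add: algebra_simps)
        then have "\<rho> s \<le> (c 2 - c 1) * s"
          using c mult_le_cancel_left_pos[of "2 * c 1"] by (simp del: mult.assoc)
        then have "\<rho> s / (c 2 - c 1) \<le> s" using c by (simp add: pos_divide_le_eq mult.commute)
        from duhamel_1_lower[OF \<rho>_range(1)[OF s] this] show ?thesis by (simp add: W_def)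
      qed
    qed
    also have "\<dots> \<le> integral {0..t} W"
      using ab by (intro integral_subset_le integrable_continuous_real continuous_on_subset[OF cW]) (auto intro: W0)
    finally show ?thesis .
  qed
  with pi(1) v_eq show "k0 * \<epsilon> / (2 * c 1) + ?\<kappa> * (max 0 (ln (d * t / 2)) / (2 * c 1)) \<le> \<bar>v\<bar>" by linarith
  have "0 < 1 + r + c 1 * t - 2 * c 1 * t" using r(1) by linarith
  then have I: "((\<lambda>s. 1 / (1 + r + c 1 * t - 2 * c 1 * s)) has_integral
      (ln (1 + r + c 1 * t - 2 * c 1 * 0) - ln (1 + r + c 1 * t - 2 * c 1 * t)) / (2 * c 1)) {0..t}"
    using c t0 by (intro has_integral_inverse_affine) auto
  have "integral {0..t} W \<le> integral {0..t} (\<lambda>s. D * \<epsilon>\<^sup>2 * (1 / (1 + r + c 1 * t - 2 * c 1 * s)))"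
  proof (rule integral_le)
    show "W integrable_on {0..t}" by (rule integrable_continuous_real[OF cW])
    show "(\<lambda>s. D * \<epsilon>\<^sup>2 * (1 / (1 + r + c 1 * t - 2 * c 1 * s))) integrable_on {0..t}"
      by (rule has_integral_integrable[OF has_integral_mult_right[OF I]])
    show "W s \<le> D * \<epsilon>\<^sup>2 * (1 / (1 + r + c 1 * t - 2 * c 1 * s))" if "s \<in> {0..t}" for s
    proof -
      have "W s \<le> \<bar>w 1 s (\<rho> s + c 1 * s) - w 1 0 (\<rho> s)\<bar>"
        using abs_ge_self[of "W s"] A1 by (simp add: W_def abs_mult abs_sgn_eq)
      also have "\<dots> \<le> D * \<epsilon>\<^sup>2 / (1 + \<bar>\<rho> s\<bar>)"
        using duhamel_decay[of s 1 "\<rho> s + c 1 * s"] that by simp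
      also have "\<dots> = D * \<epsilon>\<^sup>2 * (1 / (1 + r + c 1 * t - 2 * c 1 * s))"
        using \<rho>0[of s] that by (simp add: \<rho>_def algebra_simps)
      finally show ?thesis .
    qed
  qed
  also have "\<dots> = D * \<epsilon>\<^sup>2 * ((ln (1 + r + c 1 * t - 2 * c 1 * 0) - ln (1 + r + c 1 * t - 2 * c 1 * t)) / (2 * c 1))"
    by (rule integral_unique[OF has_integral_mult_right[OF I, of "D * \<epsilon>\<^sup>2"]])
  also have "\<dots> = D * \<epsilon>\<^sup>2 * ((ln (1 + r + c 1 * t) - ln (1 + r - c 1 * t)) / (2 * c 1))"
    by (simp add: algebra_simps)
  also have "\<dots> \<le> D * \<epsilon>\<^sup>2 * (ln (2 + 2 * c 1 * t) / (2 * c 1))"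
  proof -
    have "ln (1 + r + c 1 * t) \<le> ln (2 + 2 * c 1 * t)" using r t by (intro ln_mono; linarith)
    moreover have "0 \<le> ln (1 + r - c 1 * t)" using r by (intro ln_ge_zero) auto
    ultimately show ?thesis using c D_nonneg by (intro mult_left_mono divide_right_mono) auto
  qed
  finally show "\<bar>v\<bar> \<le> \<epsilon> * B / c 1 + D * \<epsilon>\<^sup>2 * (ln (2 + 2 * c 1 * t) / (2 * c 1))"
    using pi(2) v_eq by linarith
qed

end

text \<open>The constants \<open>C\<close> and \<open>\<epsilon>0\<close> are fixed before
  \<epsilon>, the solution and the point, so they depend only on speeds, coefficients and profile.
  The remaining work replaces the logarithms of \<open>two_sided\<close> by
  \<open>ln (2 + t)\<close>.\<close>

theorem radial_pair_two_sided:
  fixes c A :: "2 \<Rightarrow> real" and \<eta> \<eta>' :: "real \<Rightarrow> real" and B k0 :: real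
  assumes c_pos: "\<And>i. 0 < c i" and c_less: "c 1 < c 2" and A1: "A 1 \<noteq> 0" and B: "0 < B" and k0: "0 < k0"
    and \<eta>_nonneg: "\<And>\<rho>. 0 \<le> \<rho> \<Longrightarrow> 0 \<le> \<eta> \<rho>" and \<eta>_nonpos: "\<And>\<rho>. \<rho> \<le> 0 \<Longrightarrow> \<eta> \<rho> \<le> 0"
    and \<eta>_lower: "\<And>\<rho>. 1 \<le> \<rho> \<Longrightarrow> \<rho> \<le> 2 \<Longrightarrow> k0 \<le> \<eta> \<rho>"
    and \<eta>_bound: "\<And>\<rho>. \<bar>\<eta> \<rho>\<bar> \<le> B / (1 + \<bar>\<rho>\<bar>)\<^sup>2" and \<eta>'_bound: "\<And>\<rho>. \<bar>\<eta>' \<rho>\<bar> \<le> B / (1 + \<bar>\<rho>\<bar>)\<^sup>2"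
    and \<eta>_deriv: "\<And>\<rho>. (\<eta> has_real_derivative \<eta>' \<rho>) (at \<rho>)"
  obtains C \<epsilon>0 where "0 < C" "0 < \<epsilon>0"
    "\<And>\<epsilon> w z q dq t r v. 0 < \<epsilon> \<Longrightarrow> \<epsilon> < \<epsilon>0 \<Longrightarrow> radial_pair c A w z q dq \<Longrightarrow>
      (\<And>i \<rho>. w i 0 \<rho> = \<epsilon> * (if i = 1 then sgn (A 1) else 1) * \<eta> \<rho>) \<Longrightarrow>
      2 \<le> c 1 * t \<Longrightarrow> c 1 * t \<le> r \<Longrightarrow> r \<le> c 1 * t + 1 \<Longrightarrow>
      v = integral {0..t} (\<lambda>s. w 1 s (r + c 1 * (t - s))) \<Longrightarrow>
      inverse C * \<epsilon> * (1 + \<epsilon> * ln (2 + t)) \<le> \<bar>v\<bar> \<and> \<bar>v\<bar> \<le> C * \<epsilon> * (1 + \<epsilon> * ln (2 + t))"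
proof -
  have c: "0 < c 1" "0 < c 2" "0 < c 2 - c 1" using c_pos c_less by auto
  have c_ne: "c i \<noteq> c (i + 1)" for i using exhaust_2[of i] c_less by auto
  define G where "G i = (1 + c i / c (i + 1)) * (3 / \<bar>c i - c (i + 1)\<bar> + 3 / (c i + c (i + 1)) + 1 / c i)" for i
  define \<Gamma> where "\<Gamma> = max (G 1) (G 2)"
  have G_le: "G i \<le> \<Gamma>" for i using exhaust_2[of i] by (auto simp: \<Gamma>_def)
  have \<Gamma>: "integral {0..t} (kern (c i) (c (i + 1)) \<rho>) \<le> \<Gamma> / (1 + \<bar>\<rho>\<bar>)" if "0 \<le> t" for t i \<rho>
    using integral_kern_le[OF c_pos c_pos c_ne that, of i \<rho>]
    by (rule order_trans) (auto simp: G_def[symmetric] intro!: divide_right_mono G_le)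
  have "0 \<le> \<Gamma>" using \<Gamma>[of 0 1 0] by simp
  define a where "a = \<bar>A 1\<bar> + \<bar>A 2\<bar>"
  define D where "D = 192 * a * \<Gamma> * B\<^sup>2"
  have a0: "0 \<le> a" and D0: "0 \<le> D" using \<open>0 \<le> \<Gamma>\<close> by (auto simp: a_def D_def)
  define d where "d = 2 * c 1 * (c 2 - c 1) / (c 1 + c 2)"
  have d: "0 < d" using c by (simp add: d_def)
  \<comment> \<open>The slack in that replacement: \<open>2 \<le> c 1 * t\<close> gives
    \<open>2 + t \<le> (1 + c 1) * t\<close>, hence
    \<open>ln (2 + t) \<le> max 0 (ln (d * t / 2)) + L\<close>.\<close>
  define L where "L = \<bar>ln (2 * (1 + c 1) / d)\<bar>"
  \<comment> \<open>Dividing the first entry by \<open>1 + L\<close> lets the free part pay for the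
    slack as well, since \<open>\<epsilon> * L \<le> L\<close> for \<epsilon> \<le> 1.\<close>
  define \<mu> where "\<mu> = min (k0 / (2 * c 1) / (1 + L)) (\<bar>A 1\<bar> * k0\<^sup>2 / (16 * c 2) / (2 * c 1))"
  have L0: "0 \<le> L" by (simp add: L_def)
  have \<mu>: "0 < \<mu>" using c k0 A1 L0 by (simp add: \<mu>_def)
  define Cu where "Cu = B / c 1 + D / (2 * c 1) * (ln (2 + 2 * c 1) + 1)"
  define C where "C = max Cu (1 / \<mu>)"
  have C: "0 < C" using \<mu> by (simp add: C_def less_max_iff_disj)
  \<comment> \<open>One entry each for \<epsilon> \<le> 1, \<open>small1\<close> and
    \<open>small2\<close>; the added 1 makes the denominators positive from nonnegativity of the
    constants alone.\<close>
  define \<epsilon>0 where "\<epsilon>0 = min 1 (min (1 / (192 * a * \<Gamma> * B + 1)) (k0 / 4 / (D + 1)))"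
  have pos: "0 < 192 * a * \<Gamma> * B + 1" using a0 \<open>0 \<le> \<Gamma>\<close> B by (intro add_nonneg_pos mult_nonneg_nonneg) auto
  have \<epsilon>0: "0 < \<epsilon>0" using pos k0 D0 by (simp add: \<epsilon>0_def)
  have main: "inverse C * \<epsilon> * (1 + \<epsilon> * ln (2 + t)) \<le> \<bar>v\<bar> \<and> \<bar>v\<bar> \<le> C * \<epsilon> * (1 + \<epsilon> * ln (2 + t))"
    if \<epsilon>: "0 < \<epsilon>" "\<epsilon> < \<epsilon>0" and rp: "radial_pair c A w z q dq"
      and init: "\<And>i \<rho>. w i 0 \<rho> = \<epsilon> * (if i = 1 then sgn (A 1) else 1) * \<eta> \<rho>"
      and t: "2 \<le> c 1 * t" and r: "c 1 * t \<le> r" "r \<le> c 1 * t + 1"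
      and v: "v = integral {0..t} (\<lambda>s. w 1 s (r + c 1 * (t - s)))" for \<epsilon> w z q dq t r v
  proof -
    have \<epsilon>1: "\<epsilon> \<le> 1" using \<epsilon> by (simp add: \<epsilon>0_def)
    have "\<epsilon> < 1 / (192 * a * \<Gamma> * B + 1)" using \<epsilon> by (simp add: \<epsilon>0_def)
    then have "(192 * a * \<Gamma> * B + 1) * \<epsilon> < 1" using pos by (simp only: pos_less_divide_eq mult.commute)
    then have s1: "192 * (\<bar>A 1\<bar> + \<bar>A 2\<bar>) * \<Gamma> * B * \<epsilon> < 1" using \<epsilon> unfolding a_def[symmetric] distrib_right by linarith
    have "\<epsilon> < k0 / 4 / (D + 1)" using \<epsilon> by (simp add: \<epsilon>0_def)
    then have "(D + 1) * \<epsilon> < k0 / 4" using D0 by (simp add: field_simps)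
    then have s2: "D * \<epsilon> \<le> k0 / 4" using \<epsilon> unfolding distrib_right by linarith
    interpret radial_pair c A w z q dq by (rule rp)
    interpret radial_pair_data c A w z q dq \<eta> \<eta>' B k0 \<Gamma> D \<epsilon>
      by unfold_locales (use assms \<Gamma> s1 s2 \<epsilon> \<epsilon>1 init D_def[unfolded a_def] in auto)
    define X where "X = max 0 (ln (d * t / 2))"
    have t0: "0 < t" using t c zero_less_mult_iff[of "c 1" t] by linarith
    have "2 + t \<le> (1 + c 1) * t" using t by (simp add: algebra_simps)
    then have "ln (2 + t) \<le> ln ((1 + c 1) * t)" using t0 by (intro ln_mono) auto
    also have "(1 + c 1) * t = (d * t / 2) * (2 * (1 + c 1) / d)" using d by simp
    also have "ln \<dots> = ln (d * t / 2) + ln (2 * (1 + c 1) / d)"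
      using d t0 c by (subst ln_mult_pos) auto
    also have "\<dots> \<le> X + L" by (auto simp: X_def L_def)
    finally have lnX: "ln (2 + t) \<le> X + L" .
    have ln0: "0 \<le> ln (2 + t)" using t0 by (intro ln_ge_zero) auto
    have X0: "0 \<le> X" by (simp add: X_def)
    have \<mu>1: "\<mu> * (1 + L) \<le> k0 / (2 * c 1)"
      using L0 by (simp add: \<mu>_def pos_le_divide_eq[symmetric])
    have \<mu>2: "\<mu> \<le> \<bar>A 1\<bar> * k0\<^sup>2 / (16 * c 2) / (2 * c 1)" by (simp add: \<mu>_def)
    have "\<epsilon> * ln (2 + t) \<le> \<epsilon> * (X + L)" using lnX \<epsilon> by (intro mult_left_mono) auto
    also have "\<dots> \<le> \<epsilon> * X + L"
      using mult_right_mono[OF \<epsilon>1 L0] by (simp add: distrib_left)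
    finally have "\<epsilon> * (1 + \<epsilon> * ln (2 + t)) \<le> \<epsilon> * (1 + (\<epsilon> * X + L))"
      using \<epsilon> by (intro mult_left_mono) auto
    then have "\<mu> * (\<epsilon> * (1 + \<epsilon> * ln (2 + t))) \<le> \<mu> * (\<epsilon> * (1 + (\<epsilon> * X + L)))"
      using \<mu> by (rule mult_left_mono[OF _ less_imp_le])
    also have "\<dots> = (\<mu> * (1 + L)) * \<epsilon> + \<mu> * (\<epsilon>\<^sup>2 * X)" by (simp add: algebra_simps power2_eq_square)
    also have "\<dots> \<le> k0 / (2 * c 1) * \<epsilon> + \<bar>A 1\<bar> * k0\<^sup>2 / (16 * c 2) / (2 * c 1) * (\<epsilon>\<^sup>2 * X)"
      using X0 \<epsilon> by (intro add_mono mult_right_mono \<mu>1 \<mu>2) auto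
    also have "\<dots> = k0 * \<epsilon> / (2 * c 1) + \<bar>A 1\<bar> * k0\<^sup>2 / (16 * c 2) * \<epsilon>\<^sup>2 * (X / (2 * c 1))" by simp
    also have "\<dots> \<le> \<bar>v\<bar>"
      unfolding X_def d_def by (rule two_sided(1)[OF t r v])
    finally have lower: "\<mu> * (\<epsilon> * (1 + \<epsilon> * ln (2 + t))) \<le> \<bar>v\<bar>" .
    have nn: "0 \<le> \<epsilon> * (1 + \<epsilon> * ln (2 + t))" using \<epsilon> ln0 by (intro mult_nonneg_nonneg add_nonneg_nonneg) auto
    have "inverse C \<le> \<mu>"
      using \<mu> le_imp_inverse_le[of "1 / \<mu>" C] by (simp add: C_def)
    from order_trans[OF mult_right_mono[OF this nn] lower]
    have 1: "inverse C * \<epsilon> * (1 + \<epsilon> * ln (2 + t)) \<le> \<bar>v\<bar>" by (simp add: mult.assoc)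
    have "2 + 2 * c 1 * t \<le> (2 + 2 * c 1) * (2 + t)"
      using c t0 by (simp add: algebra_simps)
    then have "ln (2 + 2 * c 1 * t) \<le> ln ((2 + 2 * c 1) * (2 + t))"
      using c t0 by (intro ln_mono) (auto intro: add_pos_pos)
    also have "\<dots> = ln (2 + 2 * c 1) + ln (2 + t)" using c t0 by (intro ln_mult_pos) (auto intro: add_pos_pos)
    finally have ln2: "ln (2 + 2 * c 1 * t) \<le> ln (2 + 2 * c 1) + ln (2 + t)" .
    have l2: "0 \<le> ln (2 + 2 * c 1)" using c by (intro ln_ge_zero) auto
    have "\<bar>v\<bar> \<le> \<epsilon> * B / c 1 + D * \<epsilon>\<^sup>2 * (ln (2 + 2 * c 1 * t) / (2 * c 1))"
      by (rule two_sided(2)[OF t r v])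
    also have "\<dots> \<le> \<epsilon> * B / c 1 + D * \<epsilon>\<^sup>2 * ((ln (2 + 2 * c 1) + ln (2 + t)) / (2 * c 1))"
      using ln2 D0 c by (intro add_left_mono mult_left_mono divide_right_mono) auto
    also have "\<dots> = \<epsilon> * (B / c 1 + D / (2 * c 1) * (\<epsilon> * ln (2 + 2 * c 1) + \<epsilon> * ln (2 + t)))"
      using c by (simp add: field_simps power2_eq_square)
    also have "\<dots> \<le> \<epsilon> * (Cu * (1 + \<epsilon> * ln (2 + t)))"
    proof (rule mult_left_mono)
      have "\<epsilon> * ln (2 + 2 * c 1) \<le> ln (2 + 2 * c 1)" using \<epsilon>1 l2 \<epsilon> by (intro mult_left_le_one_le) auto
      moreover have p: "0 \<le> \<epsilon> * ln (2 + t)" using \<epsilon> ln0 by simp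
      moreover have "0 \<le> ln (2 + 2 * c 1) * (\<epsilon> * ln (2 + t))" using p l2 by simp
      ultimately have "\<epsilon> * ln (2 + 2 * c 1) + \<epsilon> * ln (2 + t) \<le> (ln (2 + 2 * c 1) + 1) * (1 + \<epsilon> * ln (2 + t))"
        by (simp add: algebra_simps)
      then have "D / (2 * c 1) * (\<epsilon> * ln (2 + 2 * c 1) + \<epsilon> * ln (2 + t))
          \<le> D / (2 * c 1) * ((ln (2 + 2 * c 1) + 1) * (1 + \<epsilon> * ln (2 + t)))"
        using D0 c by (intro mult_left_mono) auto
      moreover have "B / c 1 * 1 \<le> B / c 1 * (1 + \<epsilon> * ln (2 + t))"
        using B c p by (intro mult_left_mono) auto
      ultimately show "B / c 1 + D / (2 * c 1) * (\<epsilon> * ln (2 + 2 * c 1) + \<epsilon> * ln (2 + t)) \<le> Cu * (1 + \<epsilon> * ln (2 + t))"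
        unfolding Cu_def by (simp only: distrib_right mult.assoc mult_1_right)
    qed (use \<epsilon> in simp)
    also have "\<dots> = Cu * (\<epsilon> * (1 + \<epsilon> * ln (2 + t)))" by simp
    also have "\<dots> \<le> C * (\<epsilon> * (1 + \<epsilon> * ln (2 + t)))"
      using nn by (intro mult_right_mono) (auto simp: C_def)
    finally have 2: "\<bar>v\<bar> \<le> C * \<epsilon> * (1 + \<epsilon> * ln (2 + t))" by (simp add: mult.assoc)
    from 1 2 show ?thesis ..
  qed
  show ?thesis
    by (rule that[OF C \<epsilon>0 main])
qed

subsection \<open>Uniqueness by local energy estimates\<close>

text \<open>Both mixed derivatives have the same integral over every short segment in direction w:
  one integral is D1 v differenced along the segment by the fundamental theorem, the other is the
  v-derivative, taken under the integral, of the same difference of f. Differentiating in the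
  segment length at 0 gives the claim.\<close>

lemma symmetric_second_derivative:
  fixes f :: "'a::real_normed_vector \<Rightarrow> real"
  assumes "open U" "p \<in> U"
    and f1: "\<And>x. x \<in> U \<Longrightarrow> (f has_derivative (\<lambda>v. D1 v x)) (at x)"
    and f2: "\<And>x v. x \<in> U \<Longrightarrow> (D1 v has_derivative (\<lambda>w. D2 v w x)) (at x)"
    and cont: "\<And>v w. continuous_on U (D2 v w)"
  shows "D2 v w p = D2 w v p"
proof -
  define P where "P s t = p + s *\<^sub>R v + t *\<^sub>R w" for s t
  have "open ((\<lambda>(s, t). P s t) -` U)"
    unfolding P_def split_beta using \<open>open U\<close> by (intro open_vimage continuous_intros)
  moreover have "(0, 0) \<in> (\<lambda>(s, t). P s t) -` U" using \<open>p \<in> U\<close> by (simp add: P_def)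
  ultimately obtain A B where AB: "open A" "open B" "(0::real) \<in> A" "(0::real) \<in> B"
    and sub: "A \<times> B \<subseteq> (\<lambda>(s, t). P s t) -` U"
    by (elim open_prod_elim) auto
  obtain e1 where e1: "0 < e1" "cball 0 e1 \<subseteq> A" using AB open_contains_cball by metis
  obtain e2 where e2: "0 < e2" "cball 0 e2 \<subseteq> B" using AB open_contains_cball by metis
  define I where "I = {- e1<..<e1}"
  have I: "open I" "convex I" "0 \<in> I" using e1 by (auto simp: I_def)
  have PU: "P s t \<in> U" if "s \<in> I" "t \<in> {0..e2}" for s t
  proof -
    have "s \<in> A" "t \<in> B" using that e1 e2 by (auto simp: I_def dist_norm)
    then show ?thesis using sub by auto
  qed
  have contP: "continuous_on X (\<lambda>y. h (P (fst y) (snd y)))"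
    if "continuous_on U h" "X \<subseteq> I \<times> {0..e2}" for h :: "'a \<Rightarrow> real" and X
    by (rule continuous_on_compose2[OF that(1)]) (use that PU in \<open>auto simp: P_def intro!: continuous_intros\<close>)
  have contP1: "continuous_on {0..t} (\<lambda>\<tau>. h (P s \<tau>))"
    if "continuous_on U h" "s \<in> I" "t \<le> e2" for h :: "'a \<Rightarrow> real" and s t
    by (rule continuous_on_compose2[OF that(1)]) (use that PU in \<open>auto simp: P_def intro!: continuous_intros\<close>)
  have cont1: "continuous_on U (D1 v)" for v
    using f2 by (meson continuous_at_imp_continuous_on has_derivative_continuous)
  have ds: "((\<lambda>s. h (P s t)) has_real_derivative h' v) (at s)"
    if "(h has_derivative h') (at (P s t))" for h h' s t
  proof -
    have "((\<lambda>s. P s t) has_derivative (\<lambda>r. r *\<^sub>R v)) (at s)"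
      unfolding P_def by (auto intro!: derivative_eq_intros)
    from has_derivative_compose[OF this that] show ?thesis
      using linear_cmul[OF has_derivative_linear[OF that]]
      by (simp add: has_field_derivative_def mult_commute_abs)
  qed
  have dt: "((\<lambda>t. h (P s t)) has_real_derivative h' w) (at t)"
    if "(h has_derivative h') (at (P s t))" for h h' s t
  proof -
    have "((\<lambda>t. P s t) has_derivative (\<lambda>r. r *\<^sub>R w)) (at t)"
      unfolding P_def by (auto intro!: derivative_eq_intros)
    from has_derivative_compose[OF this that] show ?thesis
      using linear_cmul[OF has_derivative_linear[OF that]]
      by (simp add: has_field_derivative_def mult_commute_abs)
  qed
  have eq: "integral {0..t} (\<lambda>\<tau>. D2 v w (P 0 \<tau>)) = integral {0..t} (\<lambda>\<tau>. D2 w v (P 0 \<tau>))"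
    if t: "t \<in> {0..e2}" for t
  proof -
    have fund: "((\<lambda>\<tau>. h' w (P s \<tau>)) has_integral (h (P s t) - h (P s 0))) {0..t}"
      if "s \<in> I" and h': "\<And>x. x \<in> U \<Longrightarrow> (h has_derivative (\<lambda>v. h' v x)) (at x)" for s and h :: "'a \<Rightarrow> real" and h'
    proof (rule fundamental_theorem_of_calculus[where f = "\<lambda>\<tau>. h (P s \<tau>)"])
      show "((\<lambda>\<tau>. h (P s \<tau>)) has_vector_derivative h' w (P s \<tau>)) (at \<tau> within {0..t})" if "\<tau> \<in> {0..t}" for \<tau>
        using dt[OF h'[OF PU[OF \<open>s \<in> I\<close>, of \<tau>]]] that t
        by (auto simp: has_real_derivative_iff_has_vector_derivative intro: has_vector_derivative_at_within)
    qed (use t in simp)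
    have "((\<lambda>s. integral (cbox 0 t) (\<lambda>\<tau>. D1 w (P s \<tau>))) has_real_derivative
        integral (cbox 0 t) (\<lambda>\<tau>. D2 w v (P 0 \<tau>))) (at 0 within I)"
    proof (rule leibniz_rule_field_derivative[where U = I])
      show "((\<lambda>s. D1 w (P s \<tau>)) has_real_derivative D2 w v (P s \<tau>)) (at s within I)"
        if "s \<in> I" "\<tau> \<in> cbox 0 t" for s \<tau>
        using ds[OF f2[OF PU[OF that(1), of \<tau>]]] that t by (auto intro: has_field_derivative_at_within)
      show "(\<lambda>\<tau>. D1 w (P s \<tau>)) integrable_on cbox 0 t" if "s \<in> I" for s
        using contP1[OF cont1 that, of t w] t by (auto intro: integrable_continuous_real)
      show "continuous_on (I \<times> cbox 0 t) (\<lambda>(s, \<tau>). D2 w v (P s \<tau>))"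
        unfolding split_beta by (rule contP[where h = "D2 w v", OF cont]) (use t in auto)
    qed (use I in auto)
    then have "((\<lambda>s. integral {0..t} (\<lambda>\<tau>. D1 w (P s \<tau>))) has_real_derivative
        integral {0..t} (\<lambda>\<tau>. D2 w v (P 0 \<tau>))) (at 0)"
      by (simp add: at_within_open[OF I(3,1)])
    then have "((\<lambda>s. f (P s t) - f (P s 0)) has_real_derivative integral {0..t} (\<lambda>\<tau>. D2 w v (P 0 \<tau>))) (at 0)"
      by (rule has_field_derivative_transform_within_open[OF _ I(1,3)]) (rule integral_unique[OF fund[where h = f and h' = D1, OF _ f1]])
    moreover have "((\<lambda>s. f (P s t) - f (P s 0)) has_real_derivative D1 v (P 0 t) - D1 v (P 0 0)) (at 0)"
      by (intro DERIV_diff ds f1 PU) (use I t e2 in auto)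
    ultimately have "integral {0..t} (\<lambda>\<tau>. D2 w v (P 0 \<tau>)) = D1 v (P 0 t) - D1 v (P 0 0)"
      by (rule DERIV_unique)
    with integral_unique[OF fund[where h = "D1 v" and h' = "D2 v", OF I(3) f2]] show ?thesis by simp
  qed
  have der: "((\<lambda>t. integral {0..t} (\<lambda>\<tau>. D2 a b (P 0 \<tau>))) has_vector_derivative D2 a b (P 0 0)) (at 0 within {0..e2})" for a b
    using integral_has_vector_derivative[OF contP1[OF cont[of a b] I(3) order_refl], of 0] e2 by auto
  have "((\<lambda>t. integral {0..t} (\<lambda>\<tau>. D2 w v (P 0 \<tau>))) has_vector_derivative D2 v w (P 0 0)) (at 0 within {0..e2})"
    by (rule has_vector_derivative_transform[OF _ _ der[of v w]]) (use e2 eq in auto)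
  moreover have "at 0 within {0..e2} \<noteq> bot"
    using e2 by (simp add: at_within_Icc_at_right)
  ultimately have "D2 v w (P 0 0) = D2 w v (P 0 0)"
    using vector_derivative_unique_within[OF _ _ der[of w v]] by blast
  then show ?thesis by (simp add: P_def)
qed

text \<open>Plays the part of the divergence theorem: the integral of a compactly supported function
  does not change under translation along b, and its derivative in the shift is the integral of
  \<open>G'\<close>. The margin 1 keeps the support inside the box for shifts up to 1.\<close>

lemma integral_directional_derivative_eq_0:
  fixes G G' :: "'a::euclidean_space \<Rightarrow> real"
  assumes b: "norm b = 1"
    and deriv: "\<And>x. ((\<lambda>s. G (x + s *\<^sub>R b)) has_real_derivative G' x) (at 0)"
    and cont: "continuous_on UNIV G" "continuous_on UNIV G'"
    and supp: "\<And>x. R \<le> norm x \<Longrightarrow> G x = 0" and "R + 1 \<le> m"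
  shows "integral (cbox (- (m *\<^sub>R One)) (m *\<^sub>R One)) G' = 0"
proof -
  let ?a = "- (m *\<^sub>R One) :: 'a" and ?c = "m *\<^sub>R One :: 'a"
  have out: "m < norm x" if "x \<notin> cbox ?a ?c" for x :: 'a
  proof -
    have "\<exists>i\<in>Basis. \<not> (- m \<le> x \<bullet> i \<and> x \<bullet> i \<le> m)"
      using that by (auto simp: mem_box)
    then obtain i where i: "i \<in> Basis" "\<not> (- m \<le> x \<bullet> i \<and> x \<bullet> i \<le> m)" by blast
    then have "m < \<bar>x \<bullet> i\<bar>" by linarith
    then show ?thesis using Basis_le_norm[OF i(1), of x] by linarith
  qed
  have const: "integral (cbox ?a ?c) (\<lambda>x. G (x + h *\<^sub>R b)) = integral UNIV G" if "\<bar>h\<bar> \<le> 1" for h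
  proof -
    have "integral (cbox ?a ?c) (\<lambda>x. G (x + h *\<^sub>R b)) = integral (cbox (?a + h *\<^sub>R b) (?c + h *\<^sub>R b)) G"
      using integral_shift_cbox_plus[of ?a ?c G "h *\<^sub>R b"] by (simp add: o_def add.commute)
    also have "\<dots> = integral UNIV G"
    proof (rule integral_unique[symmetric], rule has_integral_on_superset)
      show "(G has_integral integral (cbox (?a + h *\<^sub>R b) (?c + h *\<^sub>R b)) G) (cbox (?a + h *\<^sub>R b) (?c + h *\<^sub>R b))"
        by (intro integrable_integral integrable_continuous continuous_on_subset[OF cont(1)]) auto
      fix x assume x: "x \<notin> cbox (?a + h *\<^sub>R b) (?c + h *\<^sub>R b)"
      have "x - h *\<^sub>R b \<notin> cbox ?a ?c"
      proof
        assume "x - h *\<^sub>R b \<in> cbox ?a ?c"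
        then have "x \<in> cbox (?a + h *\<^sub>R b) (?c + h *\<^sub>R b)"
          by (auto simp: mem_box inner_diff_left inner_add_left le_diff_eq diff_le_eq)
        with x show False ..
      qed
      then have "m < norm (x - h *\<^sub>R b)" by (rule out)
      also have "\<dots> \<le> norm x + 1" using norm_triangle_ineq4[of x "h *\<^sub>R b"] b that by simp
      finally show "G x = 0" using \<open>R + 1 \<le> m\<close> by (intro supp) simp
    qed simp
    finally show ?thesis .
  qed
  let ?I = "{-1<..<1::real}"
  have "((\<lambda>h. integral (cbox ?a ?c) (\<lambda>x. G (x + h *\<^sub>R b))) has_real_derivative
      integral (cbox ?a ?c) (\<lambda>x. G' (x + 0 *\<^sub>R b))) (at 0 within ?I)"
  proof (rule leibniz_rule_field_derivative)
    show "((\<lambda>h. G (x + h *\<^sub>R b)) has_real_derivative G' (x + h *\<^sub>R b)) (at h within ?I)" for x h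
    proof -
      have "((\<lambda>s. G ((x + h *\<^sub>R b) + (s - h) *\<^sub>R b)) has_real_derivative G' (x + h *\<^sub>R b)) (at h)"
        using deriv[of "x + h *\<^sub>R b"] DERIV_shift[of "\<lambda>s. G ((x + h *\<^sub>R b) + s *\<^sub>R b)" "G' (x + h *\<^sub>R b)" h "- h"]
        by simp
      then show ?thesis by (simp add: algebra_simps has_field_derivative_at_within)
    qed
    show "(\<lambda>x. G (x + h *\<^sub>R b)) integrable_on cbox ?a ?c" for h
      by (rule integrable_continuous, rule continuous_on_compose2[OF cont(1)]) (auto intro!: continuous_intros)
    show "continuous_on (?I \<times> cbox ?a ?c) (\<lambda>(h, x). G' (x + h *\<^sub>R b))"
      unfolding split_beta by (rule continuous_on_compose2[OF cont(2)]) (auto intro!: continuous_intros)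
  qed auto
  moreover have "at 0 within ?I = at 0" by (rule at_within_open) auto
  ultimately have "((\<lambda>h. integral (cbox ?a ?c) (\<lambda>x. G (x + h *\<^sub>R b))) has_real_derivative integral (cbox ?a ?c) G') (at 0)"
    by (simp only: scaleR_zero_left add_0_right)
  then have "((\<lambda>h. integral UNIV G) has_real_derivative integral (cbox ?a ?c) G') (at 0)"
    by (rule has_field_derivative_transform_within_open[of _ _ _ ?I]) (auto intro!: const)
  from DERIV_unique[OF this DERIV_const] show ?thesis .
qed

lemma gronwall_zero:
  fixes E :: "real \<Rightarrow> real"
  assumes "0 \<le> T" "continuous_on {0..T} E" "E 0 = 0"
    and deriv: "\<And>t. 0 < t \<Longrightarrow> t < T \<Longrightarrow> \<exists>E'. (E has_real_derivative E') (at t) \<and> E' \<le> K * E t"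
  shows "E T \<le> 0"
proof (cases "T = 0")
  case False
  have "exp (- K * T) * E T \<le> exp (- K * 0) * E 0"
  proof (rule DERIV_nonpos_imp_decreasing_open[where f = "\<lambda>t. exp (- K * t) * E t"])
    show "0 \<le> T" using \<open>0 \<le> T\<close> by simp
    show "continuous_on {0..T} (\<lambda>t. exp (- K * t) * E t)" by (intro continuous_intros assms)
    show "\<exists>y. ((\<lambda>t. exp (- K * t) * E t) has_real_derivative y) (at t) \<and> y \<le> 0" if t: "0 < t" "t < T" for t
    proof -
      obtain E' where E': "(E has_real_derivative E') (at t)" "E' \<le> K * E t" using deriv[OF t] by blast
      have "((\<lambda>t. exp (- K * t) * E t) has_real_derivative exp (- K * t) * (E' - K * E t)) (at t)"
        by (rule derivative_eq_intros E'(1) refl)+ (simp add: algebra_simps)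
      moreover have "exp (- K * t) * (E' - K * E t) \<le> 0" using E'(2) by (simp add: mult_le_0_iff)
      ultimately show ?thesis by blast
    qed
  qed
  then show ?thesis using \<open>E 0 = 0\<close> by (simp add: mult_le_0_iff)
qed (use assms in simp)

text \<open>Squaring makes the cone weight continuously differentiable across its zero set.\<close>

lemma DERIV_pos_part_square: "((\<lambda>y. (max 0 y)\<^sup>2) has_real_derivative 2 * max 0 y) (at (y::real))"
proof -
  consider "y = 0" | "y > 0" | "y < 0" by linarith
  then show ?thesis
  proof cases
    case 1
    have "isCont (\<lambda>y::real. max 0 y) 0" by (intro continuous_intros)
    then show ?thesis
      unfolding 1 CARAT_DERIV by (intro exI[of _ "\<lambda>y. max 0 y"]) (auto simp: max_def power2_eq_square)
  next
    case 2
    have "((\<lambda>y. y\<^sup>2) has_real_derivative 2 * max 0 y) (at y)"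
      using 2 by (auto intro!: derivative_eq_intros)
    then show ?thesis
      by (rule has_field_derivative_transform_within_open[of _ _ _ "{0<..}"]) (use 2 in auto)
  next
    case 3
    have "((\<lambda>y. 0) has_real_derivative 2 * max 0 y) (at y)" using 3 by simp
    then show ?thesis
      by (rule has_field_derivative_transform_within_open[of _ _ _ "{..<0}"]) (use 3 in auto)
  qed
qed

lemma partial_time_derivative:
  assumes "(h has_derivative h') (at (t, x))"
  shows "((\<lambda>s. h (s, x)) has_real_derivative h' (1, 0)) (at t)"
proof -
  have "((\<lambda>s. (s, x)) has_derivative (\<lambda>r. (r, 0))) (at t)"
    by (auto intro!: derivative_eq_intros)
  from has_derivative_compose[OF this assms]
  have "((\<lambda>s. h (s, x)) has_derivative (\<lambda>r. h' (r, 0))) (at t)" .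
  moreover have "(\<lambda>r. h' (r, 0)) = (*) (h' (1, 0))"
  proof
    show "h' (r, 0) = h' (1, 0) * r" for r
      using linear_cmul[OF has_derivative_linear[OF assms], of r "(1, 0)"] by (simp add: mult.commute)
  qed
  ultimately show ?thesis by (simp only: has_field_derivative_def)
qed

lemma partial_space_derivative:
  assumes "(h has_derivative h') (at (t, x + r *\<^sub>R b))"
  shows "((\<lambda>s. h (t, x + s *\<^sub>R b)) has_real_derivative h' (0, b)) (at r)"
proof -
  have "((\<lambda>s. (t, x + s *\<^sub>R b)) has_derivative (\<lambda>r. (0, r *\<^sub>R b))) (at r)"
    by (auto intro!: derivative_eq_intros)
  from has_derivative_compose[OF this assms] show ?thesis
    using linear_cmul[OF has_derivative_linear[OF assms], of _ "(0, b)"]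
    by (simp add: has_field_derivative_def mult_commute_abs)
qed

section \<open>Energy with a weight supported in a backward cone\<close>

text \<open>A weight on a fixed box replaces integration over shrinking balls, so no boundary terms
  arise. The function sqrt(1 + |x|^2) stands for |x|: it is smooth at the origin and its gradient is
  shorter than 1.\<close>

definition cone_height :: "real \<Rightarrow> real \<Rightarrow> real \<Rightarrow> 'a::euclidean_space \<Rightarrow> real" where
  "cone_height a k t x = max 0 (a - k * t - sqrt (1 + x \<bullet> x))"

definition energy_density :: "real \<Rightarrow> (real \<times> 'a::euclidean_space \<Rightarrow> real \<times> 'a \<Rightarrow> real) \<Rightarrow> real \<Rightarrow> 'a \<Rightarrow> real" where
  "energy_density c D1 t x = ((D1 (1, 0) (t, x))\<^sup>2 + c\<^sup>2 * (\<Sum>b\<in>Basis. (D1 (0, b) (t, x))\<^sup>2)) / 2"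

definition cube :: "real \<Rightarrow> 'a::euclidean_space set" where
  "cube m = cbox (- (m *\<^sub>R One)) (m *\<^sub>R One)"

text \<open>For nonnegative \<open>k * t\<close> the weight vanishes where |x| \<ge> a, so the cube
  of half-width \<open>a + 1\<close> leaves the margin that
  \<open>integral_directional_derivative_eq_0\<close> asks for.\<close>

definition local_energy :: "real \<Rightarrow> real \<Rightarrow> real \<Rightarrow> (real \<times> 'a::euclidean_space \<Rightarrow> real \<times> 'a \<Rightarrow> real) \<Rightarrow> real \<Rightarrow> real" where
  "local_energy a k c D1 t = integral (cube (a + 1)) (\<lambda>x. (cone_height a k t x)\<^sup>2 * energy_density c D1 t x)"

lemma energy_density_nonneg: "0 \<le> energy_density c D1 t x"
  by (simp add: energy_density_def sum_nonneg)

lemma sqrt_one_plus_gt_norm: "norm x < sqrt (1 + x \<bullet> x)"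
  by (rule real_less_rsqrt) (simp add: power2_norm_eq_inner)

lemma one_plus_inner_pos: "0 < 1 + x \<bullet> (x::'a::real_inner)"
  by (simp add: add_pos_nonneg)

lemma cone_height_eq_0: 
  assumes "a \<le> norm x" "0 \<le> k * t"
  shows "cone_height a k t x = 0"
  using assms sqrt_one_plus_gt_norm[of x] by (simp add: cone_height_def)

lemma continuous_on_cone_height [continuous_intros]:
  assumes "continuous_on S f" "continuous_on S g"
  shows "continuous_on S (\<lambda>p. cone_height a k (f p) (g p))"
  unfolding cone_height_def by (intro continuous_intros assms)

lemma DERIV_cone_height_time:
  "((\<lambda>t. (cone_height a k t x)\<^sup>2) has_real_derivative - k * (2 * cone_height a k t x)) (at t)"
proof -
  have "((\<lambda>t. a - k * t - sqrt (1 + x \<bullet> x)) has_real_derivative - k) (at t)"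
    by (auto intro!: derivative_eq_intros)
  from DERIV_chain2[OF DERIV_pos_part_square this] show ?thesis
    by (simp add: cone_height_def mult_ac)
qed

lemma DERIV_cone_height_space:
  "((\<lambda>s. (cone_height a k t (x + s *\<^sub>R b))\<^sup>2) has_real_derivative
    - (2 * cone_height a k t x) * ((x \<bullet> b) / sqrt (1 + x \<bullet> x))) (at 0)"
proof -
  have "((\<lambda>s. 1 + (x + s *\<^sub>R b) \<bullet> (x + s *\<^sub>R b)) has_real_derivative 2 * (x \<bullet> b)) (at 0)"
    unfolding inner_add_left inner_add_right
    by (auto intro!: derivative_eq_intros simp: inner_commute)
  moreover have "((\<lambda>y. a - k * t - sqrt y) has_real_derivative - (1 / (2 * sqrt (1 + x \<bullet> x)))) (at (1 + (x + 0 *\<^sub>R b) \<bullet> (x + 0 *\<^sub>R b)))"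
    using one_plus_inner_pos[of x] by (auto intro!: derivative_eq_intros simp: field_simps)
  ultimately have "((\<lambda>s. a - k * t - sqrt (1 + (x + s *\<^sub>R b) \<bullet> (x + s *\<^sub>R b))) has_real_derivative
      - (1 / (2 * sqrt (1 + x \<bullet> x))) * (2 * (x \<bullet> b))) (at 0)"
    by (rule DERIV_chain2[rotated])
  from DERIV_chain2[OF DERIV_pos_part_square this] show ?thesis
    by (simp add: cone_height_def)
qed

text \<open>The weight decreases in time at least as fast as energy flows through the level sets of the cone
  height: this is where \<open>c \<le> k\<close> enters.\<close>

lemma flux_le_density:
  fixes D1 :: "real \<times> 'a::euclidean_space \<Rightarrow> real \<times> 'a \<Rightarrow> real"
  assumes c: "0 \<le> c" "c \<le> k"
  shows "c\<^sup>2 * (D1 (1, 0) (t, x) * (\<Sum>b\<in>Basis. (x \<bullet> b) / sqrt (1 + x \<bullet> x) * D1 (0, b) (t, x))) \<le> k * energy_density c D1 t x"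
proof -
  define n where "n b = (x \<bullet> b) / sqrt (1 + x \<bullet> x)" for b
  define P where "P = D1 (1, 0) (t, x)"
  define X where "X = (\<Sum>b\<in>Basis. n b * D1 (0, b) (t, x))"
  define Y where "Y = (\<Sum>b\<in>Basis. (D1 (0, b) (t, x))\<^sup>2)"
  have "(\<Sum>b\<in>Basis. (n b)\<^sup>2) = (x \<bullet> x) / (1 + x \<bullet> x)"
    using one_plus_inner_pos[of x]
    by (simp add: n_def power_divide sum_divide_distrib[symmetric] euclidean_inner[of x x] power2_eq_square[symmetric])
  also have "\<dots> \<le> 1" using one_plus_inner_pos[of x] by (simp add: divide_le_eq)
  finally have n1: "(\<Sum>b\<in>Basis. (n b)\<^sup>2) \<le> 1" .
  have Y0: "0 \<le> Y" by (simp add: Y_def sum_nonneg)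
  have "X\<^sup>2 \<le> (\<Sum>b\<in>Basis. (n b)\<^sup>2) * Y"
    unfolding X_def Y_def by (rule Cauchy_Schwarz_ineq_sum)
  also have "\<dots> \<le> 1 * Y" by (rule mult_right_mono[OF n1 Y0])
  finally have X: "X\<^sup>2 \<le> Y" by simp
  have "2 * (P * (c * X)) \<le> P\<^sup>2 + (c * X)\<^sup>2"
    using sum_squares_bound[of P "c * X"] by simp
  also have "\<dots> \<le> P\<^sup>2 + c\<^sup>2 * Y" using X by (simp add: power_mult_distrib mult_left_mono)
  finally have "P * (c * X) \<le> (P\<^sup>2 + c\<^sup>2 * Y) / 2" by simp
  then have "c * (P * (c * X)) \<le> c * ((P\<^sup>2 + c\<^sup>2 * Y) / 2)" using c by (intro mult_left_mono) auto
  also have "\<dots> \<le> k * ((P\<^sup>2 + c\<^sup>2 * Y) / 2)" using c Y0 by (intro mult_right_mono) auto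
  finally show ?thesis
    by (simp add: energy_density_def P_def X_def Y_def n_def power2_eq_square mult_ac)
qed

lemma continuous_on_slice:
  assumes "continuous_on (T \<times> UNIV) h" "t \<in> T"
  shows "continuous_on S (\<lambda>x. h (t, x))"
  by (rule continuous_on_compose2[OF assms(1)]) (use assms(2) in \<open>auto intro!: continuous_intros\<close>)

text \<open>The weighted energy identity. Integrating by parts in space turns the time derivative of
  the density into the product of the time derivative with the wave operator; the derivative of the
  weight in time then dominates the flux produced by its derivative in space.\<close>

lemma local_energy_estimate:
  fixes D1 :: "real \<times> 'a::euclidean_space \<Rightarrow> real \<times> 'a \<Rightarrow> real"
    and D2 :: "real \<times> 'a \<Rightarrow> real \<times> 'a \<Rightarrow> real \<times> 'a \<Rightarrow> real"
  assumes cont1: "\<And>v. continuous_on ({0..} \<times> UNIV) (D1 v)"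
    and cont2: "\<And>v w. continuous_on ({0<..} \<times> UNIV) (D2 v w)"
    and der: "\<And>t x v. 0 < t \<Longrightarrow> (D1 v has_derivative (\<lambda>w. D2 v w (t, x))) (at (t, x))"
    and sym: "\<And>t x v w. 0 < t \<Longrightarrow> D2 v w (t, x) = D2 w v (t, x)"
    and c: "0 < c" "c \<le> k"
  shows "continuous_on {0..} (local_energy a k c D1)"
    and "0 < t \<Longrightarrow> \<exists>E'. (local_energy a k c D1 has_real_derivative E') (at t) \<and>
      E' \<le> integral (cube (a + 1)) (\<lambda>x. (cone_height a k t x)\<^sup>2 * (D1 (1, 0) (t, x) *
        (D2 (1, 0) (1, 0) (t, x) - c\<^sup>2 * (\<Sum>b\<in>Basis. D2 (0, b) (0, b) (t, x)))))"
proof -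
  have "continuous_on ({0..} \<times> cbox (- ((a + 1) *\<^sub>R One)) ((a + 1) *\<^sub>R One))
      (\<lambda>(t, x). (cone_height a k t x)\<^sup>2 * energy_density c D1 t x)"
    unfolding energy_density_def split_beta prod.collapse
    by (intro continuous_intros continuous_on_subset[OF cont1]) auto
  then show "continuous_on {0..} (local_energy a k c D1)"
    unfolding local_energy_def[abs_def] cube_def by (rule integral_continuous_on_param)
next
  assume t: "0 < t"
  define Q where "Q = (cube (a + 1) :: 'a set)"
  let ?h = "\<lambda>t x. cone_height a k t x"
  let ?n = "\<lambda>x b. (x \<bullet> b) / sqrt (1 + x \<bullet> x)"
  define R0 where "R0 t x = - k * (2 * ?h t x) * energy_density c D1 t x + (?h t x)\<^sup>2 *
    (D1 (1, 0) (t, x) * D2 (1, 0) (1, 0) (t, x) + c\<^sup>2 * (\<Sum>b\<in>Basis. D1 (0, b) (t, x) * D2 (0, b) (1, 0) (t, x)))" for t x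
  have derE: "((\<lambda>t. energy_density c D1 t x) has_real_derivative
      D1 (1, 0) (t, x) * D2 (1, 0) (1, 0) (t, x) + c\<^sup>2 * (\<Sum>b\<in>Basis. D1 (0, b) (t, x) * D2 (0, b) (1, 0) (t, x))) (at t)"
    if "0 < t" for t x
  proof -
    have d: "((\<lambda>s. D1 v (s, x)) has_real_derivative D2 v (1, 0) (t, x)) (at t)" for v
      using partial_time_derivative[OF der[OF that, of v x]] .
    have sq: "((\<lambda>s. (D1 v (s, x))\<^sup>2) has_real_derivative 2 * (D1 v (t, x) * D2 v (1, 0) (t, x))) (at t)" for v
      using DERIV_power[OF d, of v 2] by (simp add: mult_ac)
    have "((\<lambda>s. energy_density c D1 s x) has_real_derivative (2 * (D1 (1, 0) (t, x) * D2 (1, 0) (1, 0) (t, x)) +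
        c\<^sup>2 * (\<Sum>b\<in>Basis. 2 * (D1 (0, b) (t, x) * D2 (0, b) (1, 0) (t, x)))) / 2) (at t)"
      unfolding energy_density_def by (intro DERIV_cdivide DERIV_add DERIV_cmult DERIV_sum sq)
    then show ?thesis by (simp add: sum_distrib_left[symmetric] add_divide_distrib)
  qed
  have "((\<lambda>t. integral (cbox (- ((a + 1) *\<^sub>R One)) ((a + 1) *\<^sub>R One)) (\<lambda>x. (?h t x)\<^sup>2 * energy_density c D1 t x))
      has_real_derivative integral (cbox (- ((a + 1) *\<^sub>R One)) ((a + 1) *\<^sub>R One)) (R0 t)) (at t within {0<..})"
  proof (rule leibniz_rule_field_derivative)
    show "((\<lambda>t. (?h t x)\<^sup>2 * energy_density c D1 t x) has_real_derivative R0 t x) (at t within {0<..})"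
      if "t \<in> {0<..}" for t x
      using DERIV_mult[OF DERIV_cone_height_time derE, of t a k x] that
      by (auto simp: R0_def mult_ac intro: has_field_derivative_at_within)
    show "(\<lambda>x. (?h t x)\<^sup>2 * energy_density c D1 t x) integrable_on cbox (- ((a + 1) *\<^sub>R One)) ((a + 1) *\<^sub>R One)"
      if "t \<in> {0<..}" for t
      unfolding energy_density_def
      using that by (intro integrable_continuous continuous_intros continuous_on_slice[OF cont1]) auto
    show "continuous_on ({0<..} \<times> cbox (- ((a + 1) *\<^sub>R One)) ((a + 1) *\<^sub>R One)) (\<lambda>(t, x). R0 t x)"
      unfolding R0_def energy_density_def split_beta prod.collapse
      by (intro continuous_intros continuous_on_subset[OF cont1] continuous_on_subset[OF cont2]) auto
  qed (use t in auto)
  then have E': "(local_energy a k c D1 has_real_derivative integral Q (R0 t)) (at t)"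
    using t by (simp add: local_energy_def[abs_def] Q_def cube_def at_within_open[of t "{0<..}"])
  \<comment> \<open>The derivative in direction b of the flux term -c^2 h^2 D1(1, 0) D1(0, b). Its
    integral vanishes, so adding it to \<open>R0\<close> is free and cancels the mixed second
    derivatives.\<close>
  define R where "R b x = - (c\<^sup>2) * ((- (2 * ?h t x) * ?n x b) * (D1 (1, 0) (t, x) * D1 (0, b) (t, x)) +
    (?h t x)\<^sup>2 * (D2 (0, b) (1, 0) (t, x) * D1 (0, b) (t, x) + D1 (1, 0) (t, x) * D2 (0, b) (0, b) (t, x)))" for b x
  have contD: "continuous_on S (\<lambda>x. D1 v (t, x))" "continuous_on S (\<lambda>x. D2 v w (t, x))" for S v w
    using t by (auto intro: continuous_on_slice[OF cont1] continuous_on_slice[OF cont2])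
  have contn: "continuous_on S (\<lambda>x. ?n x b)" for S and b :: 'a
  proof -
    have "sqrt (1 + x \<bullet> x) \<noteq> 0" for x :: 'a using one_plus_inner_pos[of x] by simp
    then show ?thesis by (intro continuous_intros) auto
  qed
  have contR: "continuous_on S (R b)" for S b
    unfolding R_def by (intro continuous_intros contD contn)
  have contR0: "continuous_on S (R0 t)" for S
    unfolding R0_def energy_density_def by (intro continuous_intros contD) auto
  have IR: "integral Q (R b) = 0" if b: "b \<in> Basis" for b
    unfolding Q_def cube_def
  proof (rule integral_directional_derivative_eq_0[where b = b and R = a
        and G = "\<lambda>x. - (c\<^sup>2) * ((?h t x)\<^sup>2 * (D1 (1, 0) (t, x) * D1 (0, b) (t, x)))"])
    show "((\<lambda>s. - (c\<^sup>2) * ((?h t (x + s *\<^sub>R b))\<^sup>2 * (D1 (1, 0) (t, x + s *\<^sub>R b) * D1 (0, b) (t, x + s *\<^sub>R b))))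
        has_real_derivative R b x) (at 0)" for x
    proof -
      have d: "((\<lambda>s. D1 v (t, x + s *\<^sub>R b)) has_real_derivative D2 v (0, b) (t, x)) (at 0)" for v
        using partial_space_derivative[of "D1 v" "\<lambda>w. D2 v w (t, x)" t x 0 b] der[OF t] by simp
      show ?thesis
        using DERIV_cmult[OF DERIV_mult[OF DERIV_cone_height_space[of a k t x b]
          DERIV_mult[OF d[of "(1, 0)"] d[of "(0, b)"]]], of "- (c\<^sup>2)"] sym[OF t, of "(1, 0)" "(0, b)" x]
        by (simp add: R_def algebra_simps)
    qed
    show "continuous_on UNIV (\<lambda>x. - (c\<^sup>2) * ((?h t x)\<^sup>2 * (D1 (1, 0) (t, x) * D1 (0, b) (t, x))))"
      by (intro continuous_intros contD)
    show "- (c\<^sup>2) * ((?h t x)\<^sup>2 * (D1 (1, 0) (t, x) * D1 (0, b) (t, x))) = 0" if "a \<le> norm x" for x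
      using cone_height_eq_0[OF that, of k t] c t by simp
  qed (use b contR in auto)
  let ?H = "\<lambda>x. (?h t x)\<^sup>2 * (D1 (1, 0) (t, x) *
        (D2 (1, 0) (1, 0) (t, x) - c\<^sup>2 * (\<Sum>b\<in>Basis. D2 (0, b) (0, b) (t, x))))"
  have int: "R0 t integrable_on Q" "R b integrable_on Q" "?H integrable_on Q" for b
    unfolding Q_def cube_def by (intro integrable_continuous contR0 contR continuous_intros contD)+
  have "integral Q (R0 t) = integral Q (R0 t) + (\<Sum>b\<in>Basis. integral Q (R b))"
    using IR by simp
  also have "(\<Sum>b\<in>Basis. integral Q (R b)) = integral Q (\<lambda>x. \<Sum>b\<in>Basis. R b x)"
    by (rule integral_sum[symmetric]) (auto intro: int)
  also have "integral Q (R0 t) + \<dots> = integral Q (\<lambda>x. R0 t x + (\<Sum>b\<in>Basis. R b x))"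
    by (intro integral_add[symmetric] integrable_sum int) auto
  also have "\<dots> \<le> integral Q ?H"
  proof (rule integral_le)
    show "(\<lambda>x. R0 t x + (\<Sum>b\<in>Basis. R b x)) integrable_on Q"
      by (intro integrable_add integrable_sum int) auto
    show "R0 t x + (\<Sum>b\<in>Basis. R b x) \<le> ?H x" for x
    proof -
      define F where "F = c\<^sup>2 * (D1 (1, 0) (t, x) * (\<Sum>b\<in>Basis. ?n x b * D1 (0, b) (t, x)))"
      have "(\<Sum>b\<in>Basis. R b x) = 2 * ?h t x * F - (?h t x)\<^sup>2 * (c\<^sup>2 * (\<Sum>b\<in>Basis. D1 (0, b) (t, x) * D2 (0, b) (1, 0) (t, x)))
         - (?h t x)\<^sup>2 * (D1 (1, 0) (t, x) * (c\<^sup>2 * (\<Sum>b\<in>Basis. D2 (0, b) (0, b) (t, x))))"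
        unfolding R_def F_def sum_distrib_left sum_subtractf[symmetric]
        by (rule sum.cong[OF refl]) (simp add: algebra_simps)
      then have "R0 t x + (\<Sum>b\<in>Basis. R b x) = 2 * ?h t x * (F - k * energy_density c D1 t x) + ?H x"
        by (simp add: R0_def algebra_simps)
      also have "\<dots> \<le> ?H x"
        using flux_le_density[of c k D1 t x] c
        by (simp add: F_def mult_le_0_iff cone_height_def)
      finally show ?thesis .
    qed
  qed (rule int)
  finally show "\<exists>E'. (local_energy a k c D1 has_real_derivative E') (at t) \<and> E' \<le> integral (cube (a + 1)) ?H"
    using E' by (auto simp: Q_def)
qed

text \<open>Meant for the difference of two solutions: there the quadratic nonlinearity is a
  continuous factor \<Lambda> times the time derivative of the other component. On the compact
  cylinder |\<Lambda>| \<le> L, so both sources are absorbed into the total energy of the two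
  components, which share a cone of slope k above both speeds, and Gronwall applies.\<close>

theorem wave_pair_unique:
  fixes d :: "2 \<Rightarrow> real \<times> 'a::euclidean_space \<Rightarrow> real"
    and D1 :: "2 \<Rightarrow> real \<times> 'a \<Rightarrow> real \<times> 'a \<Rightarrow> real"
    and D2 :: "2 \<Rightarrow> real \<times> 'a \<Rightarrow> real \<times> 'a \<Rightarrow> real \<times> 'a \<Rightarrow> real"
    and \<Lambda> :: "2 \<Rightarrow> real \<times> 'a \<Rightarrow> real"
  assumes cont: "\<And>i. continuous_on ({0..} \<times> UNIV) (d i)"
    and cont1: "\<And>i v. continuous_on ({0..} \<times> UNIV) (D1 i v)"
    and cont2: "\<And>i v w. continuous_on ({0<..} \<times> UNIV) (D2 i v w)"
    and der0: "\<And>i t x. 0 < t \<Longrightarrow> (d i has_derivative (\<lambda>v. D1 i v (t, x))) (at (t, x))"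
    and der: "\<And>i t x v. 0 < t \<Longrightarrow> (D1 i v has_derivative (\<lambda>w. D2 i v w (t, x))) (at (t, x))"
    and sym: "\<And>i t x v w. 0 < t \<Longrightarrow> D2 i v w (t, x) = D2 i w v (t, x)"
    and c: "\<And>i. 0 < c i" "\<And>i. c i \<le> k"
    and cont\<Lambda>: "\<And>i. continuous_on ({0..} \<times> UNIV) (\<Lambda> i)"
    and eq: "\<And>i t x. 0 < t \<Longrightarrow> \<bar>D2 i (1, 0) (1, 0) (t, x) - (c i)\<^sup>2 * (\<Sum>b\<in>Basis. D2 i (0, b) (0, b) (t, x))\<bar>
      \<le> \<bar>\<Lambda> i (t, x)\<bar> * \<bar>D1 (i + 1) (1, 0) (t, x)\<bar>"
    and init0: "\<And>i x. d i (0, x) = 0" and init_t: "\<And>i x. D1 i (1, 0) (0, x) = 0"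
    and init_x: "\<And>i x b. b \<in> Basis \<Longrightarrow> D1 i (0, b) (0, x) = 0"
    and t0: "0 \<le> t0"
  shows "d i (t0, x0) = 0"
proof -
  \<comment> \<open>Chosen so that the weight is still positive on the whole vertical segment from
    (0, x0) to (t0, x0).\<close>
  define a where "a = k * t0 + sqrt (1 + x0 \<bullet> x0) + 1"
  define Q where "Q = (cube (a + 1) :: 'a set)"
  have k: "0 < k" using c[of 1] by linarith
  have "0 \<le> k * t0" using k t0 by simp
  then have a: "norm x0 < a" "0 < a"
    using sqrt_one_plus_gt_norm[of x0] norm_ge_zero[of x0] unfolding a_def by linarith+
  have h_pos: "0 < cone_height a k t x0" if "t \<le> t0" for t
  proof -
    have "k * t \<le> k * t0" using k that by simp
    then show ?thesis by (simp add: a_def cone_height_def less_max_iff_disj)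
  qed
  have "compact ({0..t0} \<times> Q)" by (auto simp: Q_def cube_def intro: compact_Times)
  then have "bounded ((\<lambda>p. (\<Lambda> 1 p, \<Lambda> 2 p)) ` ({0..t0} \<times> Q))"
    by (intro compact_imp_bounded compact_continuous_image continuous_intros continuous_on_subset[OF cont\<Lambda>]) auto
  then obtain L where L: "0 < L" "\<forall>y\<in>(\<lambda>p. (\<Lambda> 1 p, \<Lambda> 2 p)) ` ({0..t0} \<times> Q). norm y \<le> L"
    unfolding bounded_pos by blast
  have \<Lambda>: "\<bar>\<Lambda> i (t, x)\<bar> \<le> L" if "0 \<le> t" "t \<le> t0" "x \<in> Q" for i t x
  proof -
    have "norm (\<Lambda> 1 (t, x), \<Lambda> 2 (t, x)) \<le> L" using L(2) that by auto
    moreover have "\<bar>\<Lambda> i (t, x)\<bar> \<le> norm (\<Lambda> 1 (t, x), \<Lambda> 2 (t, x))"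
      using exhaust_2[of i] norm_fst_le[of "\<Lambda> 1 (t, x)" "\<Lambda> 2 (t, x)"] norm_snd_le[of "\<Lambda> 2 (t, x)" "\<Lambda> 1 (t, x)"] by auto
    ultimately show ?thesis by linarith
  qed
  define e where "e i t x = energy_density (c i) (D1 i) t x" for i t x
  define E where "E t = (\<Sum>i\<in>UNIV. local_energy a k (c i) (D1 i) t)" for t
  let ?h = "\<lambda>t x. cone_height a k t x"
  have contD1: "continuous_on S (\<lambda>x. D1 i v (t, x))" if "0 \<le> t" for i v t S
    using continuous_on_slice[OF cont1] that by auto
  have conte: "continuous_on S (e i t)" if "0 \<le> t" for i t S
    unfolding e_def[abs_def] energy_density_def using that by (intro continuous_intros contD1) auto
  have inte: "(\<lambda>x. (?h t x)\<^sup>2 * e i t x) integrable_on Q" if "0 \<le> t" for i t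
    unfolding Q_def cube_def using that by (intro integrable_continuous continuous_intros conte)
  have E_eq: "local_energy a k (c i) (D1 i) t = integral Q (\<lambda>x. (?h t x)\<^sup>2 * e i t x)" for i t
    by (simp add: local_energy_def e_def Q_def)
  have E_nonneg: "0 \<le> local_energy a k (c i) (D1 i) t" if "0 \<le> t" for i t
    unfolding E_eq using that by (intro integral_nonneg inte) (auto simp: e_def energy_density_nonneg)
  have contE: "continuous_on {0..} E"
    unfolding E_def by (intro continuous_on_sum local_energy_estimate(1)[OF cont1 cont2 der sym c])
  have E0: "E 0 = 0"
    unfolding E_def E_eq by (simp add: e_def energy_density_def init_t init_x)
  have E': "\<exists>E'. (E has_real_derivative E') (at t) \<and> E' \<le> 2 * L * E t" if t: "0 < t" "t \<le> t0" for t
  proof -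
    let ?H = "\<lambda>i x. (?h t x)\<^sup>2 * (D1 i (1, 0) (t, x) * (D2 i (1, 0) (1, 0) (t, x) - (c i)\<^sup>2 * (\<Sum>b\<in>Basis. D2 i (0, b) (0, b) (t, x))))"
    have "\<forall>i. \<exists>E'. (local_energy a k (c i) (D1 i) has_real_derivative E') (at t) \<and> E' \<le> integral Q (?H i)"
    proof
      fix i
      show "\<exists>E'. (local_energy a k (c i) (D1 i) has_real_derivative E') (at t) \<and> E' \<le> integral Q (?H i)"
        unfolding Q_def
        by (rule local_energy_estimate(2)[where ?D1.0 = "D1 i" and ?D2.0 = "D2 i", OF cont1 cont2 der sym c(1) c(2) t(1)])
    qed
    from choice[OF this] obtain F where
      "\<forall>i. (local_energy a k (c i) (D1 i) has_real_derivative F i) (at t) \<and> F i \<le> integral Q (?H i)" ..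
    then have F: "(local_energy a k (c i) (D1 i) has_real_derivative F i) (at t)"
      "F i \<le> integral Q (?H i)" for i by simp_all
    have "(E has_real_derivative (\<Sum>i\<in>UNIV. F i)) (at t)"
      unfolding E_def[abs_def] by (intro DERIV_sum F)
    moreover have "(\<Sum>i\<in>UNIV. F i) \<le> 2 * L * E t"
    proof -
      have contD2: "continuous_on S (\<lambda>x. D2 i v w (t, x))" for i v w S
        using continuous_on_slice[OF cont2] t by auto
      have "?H i x \<le> L * ((?h t x)\<^sup>2 * e 1 t x + (?h t x)\<^sup>2 * e 2 t x)" if "x \<in> Q" for i x
      proof -
        let ?p = "\<bar>D1 1 (1, 0) (t, x)\<bar>" and ?q = "\<bar>D1 2 (1, 0) (t, x)\<bar>"
        let ?box = "D2 i (1, 0) (1, 0) (t, x) - (c i)\<^sup>2 * (\<Sum>b\<in>Basis. D2 i (0, b) (0, b) (t, x))"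
        have "D1 i (1, 0) (t, x) * ?box \<le> \<bar>D1 i (1, 0) (t, x)\<bar> * \<bar>?box\<bar>"
          using abs_ge_self[of "D1 i (1, 0) (t, x) * ?box"] by (simp only: abs_mult)
        also have "\<dots> \<le> \<bar>D1 i (1, 0) (t, x)\<bar> * (L * \<bar>D1 (i + 1) (1, 0) (t, x)\<bar>)"
          using order_trans[OF eq[OF t(1), of i x] mult_right_mono[OF \<Lambda>[of t x i] abs_ge_zero]] t that
          by (intro mult_left_mono) auto
        also have "\<dots> = L * (?p * ?q)" using exhaust_2[of i] by auto
        also have "\<dots> \<le> L * ((?p\<^sup>2 + ?q\<^sup>2) / 2)"
          using L sum_squares_bound[of ?p ?q] by (intro mult_left_mono) auto
        also have "(?p\<^sup>2 + ?q\<^sup>2) / 2 \<le> e 1 t x + e 2 t x"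
          by (simp add: e_def energy_density_def add_divide_distrib add_mono sum_nonneg)
        finally have "D1 i (1, 0) (t, x) * ?box \<le> L * (e 1 t x + e 2 t x)" using L by (simp add: mult_left_mono)
        then have "?H i x \<le> (?h t x)\<^sup>2 * (L * (e 1 t x + e 2 t x))" by (rule mult_left_mono) simp
        then show ?thesis by (simp add: algebra_simps)
      qed
      then have "integral Q (?H i) \<le> integral Q (\<lambda>x. L * ((?h t x)\<^sup>2 * e 1 t x + (?h t x)\<^sup>2 * e 2 t x))" for i
        unfolding Q_def cube_def using t
        by (intro integral_le integrable_continuous continuous_intros contD1 contD2 conte) (auto simp: Q_def cube_def)
      also have "integral Q (\<lambda>x. L * ((?h t x)\<^sup>2 * e 1 t x + (?h t x)\<^sup>2 * e 2 t x)) = L * E t"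
        unfolding E_def E_eq sum_2 using inte t by (simp add: integral_add)
      finally have "F i \<le> L * E t" for i using F(2)[of i] by (rule order_trans[rotated])
      from this[of 1] this[of 2] show ?thesis by (simp add: sum_2)
    qed
    ultimately show ?thesis by blast
  qed
  \<comment> \<open>Zero energy of a continuous nonnegative density gives pointwise vanishing where
    the weight is positive; d is then constant in time along the segment over x0.\<close>
  have zero: "D1 i (1, 0) (t, x0) = 0" if t: "0 \<le> t" "t \<le> t0" for t
  proof -
    have "E t \<le> 0"
      using t E' by (intro gronwall_zero[where K = "2 * L"] continuous_on_subset[OF contE] E0) auto
    moreover have "local_energy a k (c i) (D1 i) t \<le> E t"
      unfolding E_def using E_nonneg t by (intro member_le_sum) auto
    ultimately have "integral Q (\<lambda>x. (?h t x)\<^sup>2 * e i t x) = 0"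
      using E_nonneg[of t i] t by (simp add: E_eq)
    then have I: "((\<lambda>x. (?h t x)\<^sup>2 * e i t x) has_integral 0) Q"
      using integrable_integral[OF inte[OF t(1), of i]] by simp
    have "(?h t x0)\<^sup>2 * e i t x0 = 0"
    proof (rule has_integral_0_cbox_imp_0[OF _ _ I[unfolded Q_def cube_def]])
      show "continuous_on (cbox (- ((a + 1) *\<^sub>R One)) ((a + 1) *\<^sub>R One)) (\<lambda>x. (?h t x)\<^sup>2 * e i t x)"
        using t by (intro continuous_intros conte)
      show "0 \<le> (?h t x)\<^sup>2 * e i t x" for x by (simp add: e_def energy_density_nonneg)
      show "box (- ((a + 1) *\<^sub>R One)) ((a + 1) *\<^sub>R One) \<noteq> ({} :: 'a set)"
        using a by (simp add: box_ne_empty)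
      have "\<bar>x0 \<bullet> b\<bar> \<le> a + 1" if "b \<in> Basis" for b
        using Basis_le_norm[OF that, of x0] a by linarith
      then show "x0 \<in> cbox (- ((a + 1) *\<^sub>R One)) ((a + 1) *\<^sub>R One)"
        by (force simp: mem_box abs_le_iff)
    qed
    then have "e i t x0 = 0" using h_pos[OF t(2)] by simp
    then have "(D1 i (1, 0) (t, x0))\<^sup>2 + (c i)\<^sup>2 * (\<Sum>b\<in>Basis. (D1 i (0, b) (t, x0))\<^sup>2) = 0"
      by (simp add: e_def energy_density_def)
    then show ?thesis by (simp add: add_nonneg_eq_0_iff sum_nonneg)
  qed
  show ?thesis
  proof (cases "t0 = 0")
    case False
    have "d i (t0, x0) = d i (0, x0)"
    proof (rule DERIV_isconst_end[where f = "\<lambda>t. d i (t, x0)"])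
      show "continuous_on {0..t0} (\<lambda>t. d i (t, x0))"
        by (rule continuous_on_compose2[OF cont]) (auto intro!: continuous_intros)
      show "((\<lambda>t. d i (t, x0)) has_real_derivative 0) (at t)" if "0 < t" "t < t0" for t
        using partial_time_derivative[OF der0[OF that(1), of i x0]] zero[of t] that by simp
    qed (use False t0 in auto)
    then show ?thesis by (simp add: init0)
  qed (simp add: init0)
qed

subsection \<open>A radial bump function\<close>

text \<open>Dividing the classical exp(-1/x) by powers of x gives a family whose linear span is
  closed under differentiation.\<close>

definition flat_exp :: "nat \<Rightarrow> real \<Rightarrow> real" where
  "flat_exp k x = (if 0 < x then exp (- (1 / x)) / x ^ k else 0)"

text \<open>The substitution y = 1/x reduces the right limit to y^k exp(-y) \<rightarrow> 0 at
  infinity.\<close>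

lemma isCont_flat_exp_0: "isCont (flat_exp k) 0"
proof -
  have "((\<lambda>y::real. y ^ k / exp y) \<longlongrightarrow> 0) at_top"
    by (rule tendsto_power_div_exp_0)
  then have "((\<lambda>x::real. inverse x ^ k / exp (inverse x)) \<longlongrightarrow> 0) (at_right 0)"
    by (rule filterlim_compose[OF _ filterlim_inverse_at_top_right])
  then have "(flat_exp k \<longlongrightarrow> 0) (at_right 0)"
    by (rule Lim_transform_eventually)
      (auto simp: flat_exp_def exp_minus field_simps intro!: eventually_mono[OF eventually_at_right_less[of 0]])
  moreover have "(flat_exp k \<longlongrightarrow> 0) (at_left 0)"
    by (rule Lim_transform_eventually[of "\<lambda>_. 0"])
      (auto simp: flat_exp_def intro!: eventually_at_leftI[of "-1"])
  ultimately show ?thesis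
    unfolding isCont_def by (simp add: filterlim_at_split flat_exp_def)
qed

lemma DERIV_flat_exp:
  "(flat_exp k has_real_derivative flat_exp (k + 2) x - real k * flat_exp (k + 1) x) (at x)"
proof -
  consider "x = 0" | "x > 0" | "x < 0" by linarith
  then show ?thesis
  proof cases
    case 1
    \<comment> \<open>At the origin the difference quotient is the next member of the family, so
      differentiability reduces to continuity.\<close>
    have "flat_exp k z - flat_exp k 0 = flat_exp (k + 1) z * (z - 0)" for z
      by (auto simp: flat_exp_def)
    then have "(flat_exp k has_real_derivative 0) (at 0)"
      unfolding CARAT_DERIV
      by (intro exI[of _ "flat_exp (k + 1)"]) (use isCont_flat_exp_0[of "k + 1"] in \<open>auto simp: flat_exp_def\<close>)
    then show ?thesis by (simp add: 1 flat_exp_def)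
  next
    case 2
    have "((\<lambda>x. exp (- (1 / x)) / x ^ k) has_real_derivative
        (exp (- (1 / x)) * (1 / x\<^sup>2) * x ^ k - exp (- (1 / x)) * (real k * x ^ (k - 1))) / (x ^ k * x ^ k)) (at x)"
      using 2 by (auto intro!: derivative_eq_intros simp: power2_eq_square)
    moreover have "(exp (- (1 / x)) * (1 / x\<^sup>2) * x ^ k - exp (- (1 / x)) * (real k * x ^ (k - 1))) / (x ^ k * x ^ k)
        = flat_exp (k + 2) x - real k * flat_exp (k + 1) x"
      using 2 by (cases k) (auto simp: flat_exp_def field_simps power2_eq_square)
    ultimately have "((\<lambda>x. exp (- (1 / x)) / x ^ k) has_real_derivative
        flat_exp (k + 2) x - real k * flat_exp (k + 1) x) (at x)" by simp
    then show ?thesis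
      by (rule has_field_derivative_transform_within_open[of _ _ _ "{0<..}"]) (use 2 in \<open>auto simp: flat_exp_def\<close>)
  next
    case 3
    have "((\<lambda>x. 0) has_real_derivative flat_exp (k + 2) x - real k * flat_exp (k + 1) x) (at x)"
      using 3 by (simp add: flat_exp_def)
    then show ?thesis
      by (rule has_field_derivative_transform_within_open[of _ _ _ "{..<0}"]) (use 3 in \<open>auto simp: flat_exp_def\<close>)
  qed
qed

lemma isCont_flat_exp [continuous_intros]: "isCont (flat_exp k) x"
  using DERIV_flat_exp by (rule DERIV_isCont)

lemma flat_exp_nonneg: "0 \<le> flat_exp k x"
  by (simp add: flat_exp_def)

text \<open>This class of functions is closed under directional derivatives, hence consists of smooth functions.\<close>

inductive bump_algebra :: "('a::euclidean_space \<Rightarrow> real) \<Rightarrow> bool" where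
  const: "bump_algebra (\<lambda>x. a)"
| inner: "bump_algebra (\<lambda>x. x \<bullet> v)"
| bump: "bump_algebra (\<lambda>x. flat_exp k (R - x \<bullet> x))"
| add: "bump_algebra f \<Longrightarrow> bump_algebra g \<Longrightarrow> bump_algebra (\<lambda>x. f x + g x)"
| mult: "bump_algebra f \<Longrightarrow> bump_algebra g \<Longrightarrow> bump_algebra (\<lambda>x. f x * g x)"

lemma bump_algebra_has_derivative:
  assumes "bump_algebra f"
  shows "\<exists>f'. (\<forall>x. (f has_derivative f' x) (at x)) \<and> (\<forall>v. bump_algebra (\<lambda>x. f' x v))"
  using assms
proof induction
  case (const a)
  show ?case
    by (intro exI[of _ "\<lambda>x v. 0"] conjI allI bump_algebra.const has_derivative_const)
next
  case (inner w)
  show ?case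
    by (intro exI[of _ "\<lambda>x v. v \<bullet> w"] conjI allI bump_algebra.const) (auto intro!: derivative_eq_intros)
next
  case (bump k R)
  let ?f' = "\<lambda>x v. (flat_exp (k + 2) (R - x \<bullet> x) + (- real k) * flat_exp (k + 1) (R - x \<bullet> x)) * ((- 2) * (x \<bullet> v))"
  show ?case
  proof (intro exI[of _ ?f'] conjI allI)
    fix x :: 'a
    have "((\<lambda>x. R - x \<bullet> x) has_derivative (\<lambda>v. (- 2) * (x \<bullet> v))) (at x)"
      by (auto intro!: derivative_eq_intros simp: inner_commute)
    from has_derivative_compose[OF this DERIV_flat_exp[unfolded has_field_derivative_def]]
    show "((\<lambda>x. flat_exp k (R - x \<bullet> x)) has_derivative ?f' x) (at x)"
      by simp
  next
    fix v :: 'a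
    show "bump_algebra (\<lambda>x. ?f' x v)"
      by (intro bump_algebra.intros)
  qed
next
  case (add f g)
  then obtain f' g' where "\<forall>x. (f has_derivative f' x) (at x)" "\<forall>v. bump_algebra (\<lambda>x. f' x v)"
    "\<forall>x. (g has_derivative g' x) (at x)" "\<forall>v. bump_algebra (\<lambda>x. g' x v)" by blast
  then show ?case
    by (intro exI[of _ "\<lambda>x v. f' x v + g' x v"]) (auto intro!: has_derivative_add bump_algebra.add)
next
  case (mult f g)
  then obtain f' g' where "\<forall>x. (f has_derivative f' x) (at x)" "\<forall>v. bump_algebra (\<lambda>x. f' x v)"
    "\<forall>x. (g has_derivative g' x) (at x)" "\<forall>v. bump_algebra (\<lambda>x. g' x v)" by blast
  then show ?case using mult.hyps
    by (intro exI[of _ "\<lambda>x v. f x * g' x v + f' x v * g x"])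
      (auto intro!: has_derivative_mult bump_algebra.add bump_algebra.mult)
qed

lemma bump_algebra_smooth_on: "bump_algebra f \<Longrightarrow> smooth_on UNIV (\<lambda>x. f x *\<^sub>R w)"
  unfolding smooth_on_def
proof
  fix k
  show "bump_algebra f \<Longrightarrow> continuously_differentiable_on k UNIV (\<lambda>x. f x *\<^sub>R w)"
  proof (induction k arbitrary: f)
    case 0
    then obtain f' where "\<forall>x. (f has_derivative f' x) (at x)"
      using bump_algebra_has_derivative by blast
    then have "continuous_on UNIV f"
      by (meson continuous_at_imp_continuous_on has_derivative_continuous)
    then show ?case by (auto intro!: continuous_intros)
  next
    case (Suc k)
    then obtain f' where f': "\<And>x. (f has_derivative f' x) (at x)" "\<And>v. bump_algebra (\<lambda>x. f' x v)"
      using bump_algebra_has_derivative by blast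
    have d: "((\<lambda>x. f x *\<^sub>R w) has_derivative (\<lambda>v. f' x v *\<^sub>R w)) (at x)" for x
      by (rule has_derivative_scaleR_left[OF f'(1)])
    have "frechet_derivative (\<lambda>x. f x *\<^sub>R w) (at x) = (\<lambda>v. f' x v *\<^sub>R w)" for x
      using frechet_derivative_at[OF d] by simp
    then show ?case
      using d Suc.IH[OF f'(2)] by (auto simp: differentiable_on_def differentiable_def)
  qed
qed

lemma smooth_compactly_supported_bump:
  "smooth_compactly_supported (\<lambda>x::'a::euclidean_space. flat_exp 0 (R - x \<bullet> x) *\<^sub>R w)"
proof -
  have "support_on UNIV (\<lambda>x. flat_exp 0 (R - x \<bullet> x) *\<^sub>R w) \<subseteq> cball 0 (sqrt R)"
    by (auto simp: support_on_def flat_exp_def dot_square_norm intro!: real_le_rsqrt split: if_splits)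
  then have "bounded (support_on UNIV (\<lambda>x. flat_exp 0 (R - x \<bullet> x) *\<^sub>R w))"
    using bounded_cball bounded_subset by blast
  then show ?thesis
    unfolding smooth_compactly_supported_def
    by (auto intro!: bump_algebra_smooth_on bump_algebra.bump)
qed

lemma smooth_compactly_supported_0: "smooth_compactly_supported (\<lambda>x::'a::euclidean_space. 0)"
  using bump_algebra_smooth_on[OF bump_algebra.const[of 0], of 0]
  by (simp add: smooth_compactly_supported_def support_on_def)

definition radial_bump :: "real \<Rightarrow> real" where
  "radial_bump \<rho> = \<rho> * flat_exp 0 (9 - \<rho>\<^sup>2)"

definition radial_bump' :: "real \<Rightarrow> real" where
  "radial_bump' \<rho> = flat_exp 0 (9 - \<rho>\<^sup>2) - 2 * \<rho>\<^sup>2 * flat_exp 2 (9 - \<rho>\<^sup>2)"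

lemma DERIV_radial_bump: "(radial_bump has_real_derivative radial_bump' \<rho>) (at \<rho>)"
proof -
  have "((\<lambda>\<rho>. flat_exp 0 (9 - \<rho>\<^sup>2)) has_real_derivative flat_exp 2 (9 - \<rho>\<^sup>2) * (- 2 * \<rho>)) (at \<rho>)"
    by (rule DERIV_chain2[where g = "\<lambda>\<rho>. 9 - \<rho>\<^sup>2"], use DERIV_flat_exp[of 0] in \<open>simp add: numeral_2_eq_2\<close>)
      (auto intro!: derivative_eq_intros)
  from DERIV_mult[OF DERIV_ident this] show ?thesis
    unfolding radial_bump_def radial_bump'_def by (simp add: power2_eq_square algebra_simps)
qed

lemma radial_bump_lower:
  assumes "1 \<le> \<rho>" "\<rho> \<le> 2"
  shows "exp (- (1 / 5)) \<le> radial_bump \<rho>"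
proof -
  have "\<rho>\<^sup>2 \<le> 2\<^sup>2" using assms by (intro power_mono) auto
  then have 5: "5 \<le> 9 - \<rho>\<^sup>2" by simp
  then have "1 / (9 - \<rho>\<^sup>2) \<le> 1 / 5" by (intro divide_left_mono) auto
  then have "exp (- (1 / 5)) \<le> exp (- (1 / (9 - \<rho>\<^sup>2)))" by simp
  also have "\<dots> = 1 * flat_exp 0 (9 - \<rho>\<^sup>2)" using 5 by (simp add: flat_exp_def)
  also have "\<dots> \<le> radial_bump \<rho>"
    unfolding radial_bump_def using assms by (intro mult_right_mono flat_exp_nonneg)
  finally show ?thesis .
qed

lemma radial_bump_bound:
  "\<exists>B>0. \<forall>\<rho>. \<bar>radial_bump \<rho>\<bar> \<le> B / (1 + \<bar>\<rho>\<bar>)\<^sup>2 \<and> \<bar>radial_bump' \<rho>\<bar> \<le> B / (1 + \<bar>\<rho>\<bar>)\<^sup>2"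
proof -
  let ?g = "\<lambda>\<rho>. (\<bar>radial_bump \<rho>\<bar> + \<bar>radial_bump' \<rho>\<bar>) * (1 + \<bar>\<rho>\<bar>)\<^sup>2"
  have "continuous_on S (flat_exp k)" for S k
    by (intro continuous_at_imp_continuous_on ballI isCont_flat_exp)
  then have "continuous_on {-3..3} (\<lambda>\<rho>. flat_exp k (9 - \<rho>\<^sup>2))" for k
    by (rule continuous_on_compose2) (auto intro!: continuous_intros)
  then have "continuous_on {-3..3} ?g"
    unfolding radial_bump_def radial_bump'_def by (intro continuous_intros)
  then have "bounded (?g ` {-3..3})"
    by (intro compact_imp_bounded compact_continuous_image) auto
  then obtain B where "0 < B" "\<forall>y\<in>?g ` {-3..3}. norm y \<le> B"
    unfolding bounded_pos by blast
  then have B: "norm (?g \<rho>) \<le> B" if "\<rho> \<in> {-3..3}" for \<rho>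
    using that by blast
  have "?g \<rho> \<le> B" for \<rho>
  proof (cases "\<rho> \<in> {-3..3}")
    case True
    then show ?thesis using B[OF True] by (simp only: real_norm_def)
  next
    case False
    then have "3\<^sup>2 \<le> \<bar>\<rho>\<bar>\<^sup>2" by (intro power_mono) auto
    then have "flat_exp k (9 - \<rho>\<^sup>2) = 0" for k by (simp add: flat_exp_def)
    then show ?thesis using \<open>0 < B\<close> by (simp add: radial_bump_def radial_bump'_def)
  qed
  then have le: "\<bar>radial_bump \<rho>\<bar> + \<bar>radial_bump' \<rho>\<bar> \<le> B / (1 + \<bar>\<rho>\<bar>)\<^sup>2" for \<rho>
    by (simp add: pos_le_divide_eq)
  have "\<bar>radial_bump \<rho>\<bar> \<le> B / (1 + \<bar>\<rho>\<bar>)\<^sup>2 \<and> \<bar>radial_bump' \<rho>\<bar> \<le> B / (1 + \<bar>\<rho>\<bar>)\<^sup>2" for \<rho>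
    using le[of \<rho>] abs_ge_zero[of "radial_bump \<rho>"] abs_ge_zero[of "radial_bump' \<rho>"] by linarith
  with \<open>0 < B\<close> show ?thesis by blast
qed

subsection \<open>Reduction to the radial system\<close>

lemma half_space_interior:
  "(t, x) \<in> interior ({0..} \<times> UNIV :: (real \<times> 'a::euclidean_space) set)" if "0 < t"
proof -
  have "{0<..} \<times> UNIV \<subseteq> interior ({0..} \<times> UNIV :: (real \<times> 'a) set)"
    by (rule interior_maximal) (auto intro: open_Times)
  then show ?thesis using that by blast
qed

text \<open>At t = 0 only derivatives relative to the half-space exist, but a spatial line stays
  inside the slice, so derivatives along it are two-sided.\<close>

lemma partial_space_derivative_within:
  fixes h :: "real \<times> 'a::euclidean_space \<Rightarrow> real"
  assumes "(h has_derivative h') (at (t, x + r *\<^sub>R b) within {0..} \<times> UNIV)" "0 \<le> t"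
  shows "((\<lambda>s. h (t, x + s *\<^sub>R b)) has_real_derivative h' (0, b)) (at r)"
proof -
  have 1: "((\<lambda>s. (t, x + s *\<^sub>R b)) has_derivative (\<lambda>r. (0, r *\<^sub>R b))) (at r)"
    by (auto intro!: derivative_eq_intros)
  have "(h has_derivative h') (at (t, x + r *\<^sub>R b) within range (\<lambda>s. (t, x + s *\<^sub>R b)))"
    by (rule has_derivative_subset[OF assms(1)]) (use assms(2) in auto)
  from has_derivative_in_compose[OF 1 this]
  have "((\<lambda>s. h (t, x + s *\<^sub>R b)) has_derivative (\<lambda>r. h' (0, r *\<^sub>R b))) (at r)" .
  moreover have "(\<lambda>r. h' (0, r *\<^sub>R b)) = (*) (h' (0, b))"
  proof
    show "h' (0, s *\<^sub>R b) = h' (0, b) * s" for s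
      using linear_cmul[OF has_derivative_linear[OF assms(1)], of s "(0, b)"] by (simp add: mult.commute)
  qed
  ultimately show ?thesis by (simp only: has_field_derivative_def)
qed

text \<open>\<open>D1 i v\<close> and \<open>D2 i v w\<close> are the derivatives of the component \<open>d i\<close> in the space-time directions
  \<open>v\<close> and \<open>w\<close>; the time direction is \<open>(1, 0)\<close>.\<close>

lemma trace_orthogonal_invariant:
  fixes B :: "'a::euclidean_space \<Rightarrow> 'a \<Rightarrow> real" and f :: "'a \<Rightarrow> 'a"
  assumes B: "bilinear B" and f: "orthogonal_transformation f"
  shows "(\<Sum>b\<in>Basis. B (f b) (f b)) = (\<Sum>b\<in>Basis. B b b)"
proof -
  \<comment> \<open>\<open>g\<close> is the inverse of \<open>f\<close> and, by orthogonality, its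
    adjoint: coordinates of \<open>f b\<close> are inner products of b with the orthonormal vectors
    \<open>g j\<close>, and summing over b collapses them to Kronecker deltas.\<close>
  obtain g where g0: "\<And>x. f (g x) = x"
    using surj_f_inv_f[OF orthogonal_transformation_surj[OF f]] by blast
  have g: "g x \<bullet> g y = x \<bullet> y" for x y
    using f g0 unfolding orthogonal_transformation_def by metis
  have fg: "f b \<bullet> j = b \<bullet> g j" for b j
  proof -
    have "f b \<bullet> f (g j) = b \<bullet> g j" using f unfolding orthogonal_transformation_def by blast
    then show ?thesis by (simp only: g0)
  qed
  have "(\<Sum>b\<in>Basis. B (f b) (f b)) = (\<Sum>b\<in>Basis. \<Sum>j\<in>Basis. \<Sum>k\<in>Basis. (b \<bullet> g j) * (b \<bullet> g k) * B j k)"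
  proof (rule sum.cong[OF refl])
    fix b
    have "B (f b) (f b) = B (\<Sum>j\<in>Basis. (f b \<bullet> j) *\<^sub>R j) (\<Sum>k\<in>Basis. (f b \<bullet> k) *\<^sub>R k)"
      by (simp add: euclidean_representation)
    also have "\<dots> = (\<Sum>j\<in>Basis. \<Sum>k\<in>Basis. (b \<bullet> g j) * (b \<bullet> g k) * B j k)"
      by (simp add: bilinear_sum[OF B] sum.cartesian_product[symmetric] bilinear_lmul[OF B] bilinear_rmul[OF B] fg mult_ac)
    finally show "B (f b) (f b) = (\<Sum>j\<in>Basis. \<Sum>k\<in>Basis. (b \<bullet> g j) * (b \<bullet> g k) * B j k)" .
  qed
  also have "\<dots> = (\<Sum>j\<in>Basis. \<Sum>k\<in>Basis. \<Sum>b\<in>Basis. (b \<bullet> g j) * (b \<bullet> g k) * B j k)"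
    by (subst sum.swap, rule sum.cong[OF refl], rule sum.swap)
  also have "\<dots> = (\<Sum>j\<in>Basis. \<Sum>k\<in>Basis. (j \<bullet> k) * B j k)"
  proof (intro sum.cong refl)
    fix j k :: 'a
    have "(\<Sum>b\<in>Basis. (b \<bullet> g j) * (b \<bullet> g k)) = g j \<bullet> g k"
      by (simp add: euclidean_inner[of "g j" "g k"] inner_commute)
    also have "\<dots> = j \<bullet> k" by (rule g)
    finally show "(\<Sum>b\<in>Basis. (b \<bullet> g j) * (b \<bullet> g k) * B j k) = (j \<bullet> k) * B j k"
      by (simp add: sum_distrib_right[symmetric])
  qed
  also have "\<dots> = (\<Sum>j\<in>Basis. B j j)"
    by (rule sum.cong[OF refl]) (simp add: inner_Basis if_distrib[of "\<lambda>x. x * _"] sum.delta cong: if_cong)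
  finally show ?thesis .
qed

section \<open>Radial symmetry of the solution\<close>

text \<open>Derivatives are taken relative to the closed half-space so that they reach t = 0, while
  the equation is required for t > 0. Writing the initial velocity as a function of
  \<open>x \<bullet> x\<close> encodes that it is radial.\<close>

locale wave_pair =
  fixes c A :: "2 \<Rightarrow> real" and d :: "2 \<Rightarrow> real \<times> (real^3) \<Rightarrow> real"
    and D1 :: "2 \<Rightarrow> real \<times> (real^3) \<Rightarrow> real \<times> (real^3) \<Rightarrow> real"
    and D2 :: "2 \<Rightarrow> real \<times> (real^3) \<Rightarrow> real \<times> (real^3) \<Rightarrow> real \<times> (real^3) \<Rightarrow> real"
    and \<psi> :: "2 \<Rightarrow> real \<Rightarrow> real"
  assumes c_pos: "0 < c i" and c_less: "c 1 < c 2"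
    and der0: "0 \<le> t \<Longrightarrow> (d i has_derivative (\<lambda>v. D1 i v (t, x))) (at (t, x) within {0..} \<times> UNIV)"
    and der1: "0 \<le> t \<Longrightarrow> (D1 i v has_derivative (\<lambda>w. D2 i v w (t, x))) (at (t, x) within {0..} \<times> UNIV)"
    and cont2: "continuous_on ({0..} \<times> UNIV) (D2 i v w)"
    and eq: "0 < t \<Longrightarrow> D2 i (1, 0) (1, 0) (t, x) - (c i)\<^sup>2 * (\<Sum>b\<in>Basis. D2 i (0, b) (0, b) (t, x))
      = A i * (D1 (i + 1) (1, 0) (t, x))\<^sup>2"
    and init: "d i (0, x) = 0" and init_t: "D1 i (1, 0) (0, x) = \<psi> i (x \<bullet> x)"
begin

lemma interior_der:
  assumes "0 < t"
  shows "(d i has_derivative (\<lambda>v. D1 i v (t, x))) (at (t, x))"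
    and "(D1 i v has_derivative (\<lambda>w. D2 i v w (t, x))) (at (t, x))"
proof -
  have "at (t, x) within {0..} \<times> UNIV = at (t, x)"
    by (rule at_within_interior[OF half_space_interior[OF assms]])
  with der0[OF less_imp_le[OF assms], of i x] der1[OF less_imp_le[OF assms], of i v x]
  show "(d i has_derivative (\<lambda>v. D1 i v (t, x))) (at (t, x))"
    and "(D1 i v has_derivative (\<lambda>w. D2 i v w (t, x))) (at (t, x))"
    by (simp_all only:)
qed

lemma cont0: "continuous_on ({0..} \<times> UNIV) (d i)"
  unfolding continuous_on_eq_continuous_within
proof
  fix p :: "real \<times> (real^3)" assume "p \<in> {0..} \<times> UNIV"
  then show "continuous (at p within {0..} \<times> UNIV) (d i)"
    using has_derivative_continuous[OF der0[of "fst p" i "snd p"]] by auto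
qed

lemma cont1: "continuous_on ({0..} \<times> UNIV) (D1 i v)"
  unfolding continuous_on_eq_continuous_within
proof
  fix p :: "real \<times> (real^3)" assume "p \<in> {0..} \<times> UNIV"
  then show "continuous (at p within {0..} \<times> UNIV) (D1 i v)"
    using has_derivative_continuous[OF der1[of "fst p" i v "snd p"]] by auto
qed

lemma sym:
  assumes "0 < t"
  shows "D2 i v w (t, x) = D2 i w v (t, x)"
proof (rule symmetric_second_derivative[where U = "{0<..} \<times> UNIV" and f = "d i" and ?D1.0 = "D1 i"])
  show "open ({0<..} \<times> UNIV :: (real \<times> (real^3)) set)" by (auto intro: open_Times)
  show "continuous_on ({0<..} \<times> UNIV) (D2 i v w)" for v w
    by (rule continuous_on_subset[OF cont2]) auto
qed (use assms in \<open>auto intro: interior_der\<close>)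

lemma init_x: "D1 i (0, b) (0, x) = 0"
proof -
  have "((\<lambda>s. d i (0, x + s *\<^sub>R b)) has_real_derivative D1 i (0, b) (0, x)) (at 0)"
    using partial_space_derivative_within[of "d i" "\<lambda>v. D1 i v (0, x)" 0 x 0 b] der0[of 0 i x] by simp
  then show ?thesis by (auto simp: init dest: DERIV_unique[OF _ DERIV_const])
qed

lemma D2_bilinear:
  assumes "0 < t"
  shows "bilinear (\<lambda>v w. D2 i (0, v) (0, w) (t, x))"
proof -
  have lin: "linear (\<lambda>w. D2 i v (0, w) (t, x))" for v
  proof -
    have l: "linear (\<lambda>w. D2 i v w (t, x))"
      by (rule has_derivative_linear[OF interior_der(2)[OF assms]])
    show ?thesis
      using linear_compose[OF _ l, of "\<lambda>w. (0, w)"] by (simp add: o_def linear_iff)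
  qed
  moreover have "linear (\<lambda>v. D2 i (0, v) w (t, x))" for w
    unfolding sym[OF assms, of i _ w] by (rule lin)
  ultimately show ?thesis by (simp add: bilinear_def)
qed

text \<open>A rotation carrying x to y takes the solution to another solution with the same data,
  since the Laplacian is a trace and thus rotation invariant; \<open>wave_pair_unique\<close> is
  applied to the difference of the two.\<close>

lemma radial:
  assumes "0 \<le> t" "norm x = norm y"
  shows "d i (t, x) = d i (t, y)"
proof -
  obtain f where f: "orthogonal_transformation f" "f x = y"
    using orthogonal_transformation_exists[OF assms(2)] by blast
  have lin: "linear f" using f by (simp add: orthogonal_transformation_linear)
  have bl: "bounded_linear f" using lin by (simp add: linear_conv_bounded_linear)
  have f0: "f 0 = 0" using lin by (rule linear_0)
  define J where "J p = (fst p, f (snd p))" for p :: "real \<times> (real^3)"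
  have J: "J (s, z) = (s, f z)" for s z by (simp add: J_def)
  have blJ: "bounded_linear J"
    unfolding J_def by (intro bounded_linear_Pair bounded_linear_compose[OF bl] bounded_linear_fst bounded_linear_snd)
  have derJ: "((\<lambda>p. h (J p)) has_derivative (\<lambda>v. h' (J v))) (at (s, z))"
    if "(h has_derivative h') (at (s, f z))" for h :: "real \<times> (real^3) \<Rightarrow> real" and h' s z
    using has_derivative_compose[OF bounded_linear_imp_has_derivative[OF blJ], of h h' "(s, z)" UNIV] that by (simp add: J)
  have contJ: "continuous_on (I \<times> UNIV) (\<lambda>p. h (J p))" if "continuous_on (I \<times> UNIV) h"
    for h :: "real \<times> (real^3) \<Rightarrow> real" and I
    by (rule continuous_on_compose2[OF that]) (auto simp: J_def bl intro!: continuous_intros bounded_linear.continuous_on[OF bl])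
  have cont2': "continuous_on ({0<..} \<times> UNIV) (D2 i v w)" for i v w
    by (rule continuous_on_subset[OF cont2]) auto
  have "d i (t, x) - d i (J (t, x)) = 0"
  proof (rule wave_pair_unique[where d = "\<lambda>i p. d i p - d i (J p)"
        and ?D1.0 = "\<lambda>i v p. D1 i v p - D1 i (J v) (J p)"
        and ?D2.0 = "\<lambda>i v w p. D2 i v w p - D2 i (J v) (J w) (J p)"
        and \<Lambda> = "\<lambda>i p. A i * (D1 (i + 1) (1, 0) p + D1 (i + 1) (1, 0) (J p))"
        and c = c and k = "c 2" and ?t0.0 = t])
    fix i :: 2 and v w :: "real \<times> (real^3)"
    show "continuous_on ({0..} \<times> UNIV) (\<lambda>p. d i p - d i (J p))"
      by (intro continuous_on_diff contJ cont0)
    show "continuous_on ({0..} \<times> UNIV) (\<lambda>p. D1 i v p - D1 i (J v) (J p))"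
      by (intro continuous_on_diff contJ cont1)
    show "continuous_on ({0<..} \<times> UNIV) (\<lambda>p. D2 i v w p - D2 i (J v) (J w) (J p))"
      by (intro continuous_on_diff contJ cont2')
    show "continuous_on ({0..} \<times> UNIV) (\<lambda>p. A i * (D1 (i + 1) (1, 0) p + D1 (i + 1) (1, 0) (J p)))"
      by (intro continuous_on_mult continuous_on_const continuous_on_add contJ cont1)
    show "0 < c i" by (rule c_pos)
    show "c i \<le> c 2" using exhaust_2[of i] c_less by auto
    fix z :: "real^3"
    have ff: "f z \<bullet> f z = z \<bullet> z" using f by (simp add: orthogonal_transformation_def)
    show "d i (0, z) - d i (J (0, z)) = 0" by (simp add: J init)
    show "D1 i (1, 0) (0, z) - D1 i (J (1, 0)) (J (0, z)) = 0" by (simp add: J init_t f0 ff)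
    show "D1 i (0, b) (0, z) - D1 i (J (0, b)) (J (0, z)) = 0" for b by (simp add: J init_x)
    fix s :: real assume s: "0 < s"
    show "((\<lambda>p. d i p - d i (J p)) has_derivative (\<lambda>v. D1 i v (s, z) - D1 i (J v) (J (s, z)))) (at (s, z))"
      unfolding J by (rule has_derivative_diff[OF interior_der(1)[OF s] derJ[OF interior_der(1)[OF s]]])
    show "((\<lambda>p. D1 i v p - D1 i (J v) (J p)) has_derivative (\<lambda>w. D2 i v w (s, z) - D2 i (J v) (J w) (J (s, z)))) (at (s, z))"
      unfolding J by (rule has_derivative_diff[OF interior_der(2)[OF s] derJ[OF interior_der(2)[OF s]]])
    show "D2 i v w (s, z) - D2 i (J v) (J w) (J (s, z)) = D2 i w v (s, z) - D2 i (J w) (J v) (J (s, z))"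
      unfolding J using sym[OF s, of i v w z] sym[OF s, of i "J v" "J w" "f z"] by simp
    have tr: "(\<Sum>b\<in>Basis. D2 i (0, f b) (0, f b) (s, f z)) = (\<Sum>b\<in>Basis. D2 i (0, b) (0, b) (s, f z))"
      by (rule trace_orthogonal_invariant[OF D2_bilinear[OF s] f(1)])
    show "\<bar>D2 i (1, 0) (1, 0) (s, z) - D2 i (J (1, 0)) (J (1, 0)) (J (s, z)) -
         (c i)\<^sup>2 * (\<Sum>b\<in>Basis. D2 i (0, b) (0, b) (s, z) - D2 i (J (0, b)) (J (0, b)) (J (s, z)))\<bar>
      \<le> \<bar>A i * (D1 (i + 1) (1, 0) (s, z) + D1 (i + 1) (1, 0) (J (s, z)))\<bar> *
        \<bar>D1 (i + 1) (1, 0) (s, z) - D1 (i + 1) (J (1, 0)) (J (s, z))\<bar>"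
    proof -
      have "D2 i (1, 0) (1, 0) (s, z) - D2 i (1, 0) (1, 0) (s, f z) -
         (c i)\<^sup>2 * (\<Sum>b\<in>Basis. D2 i (0, b) (0, b) (s, z) - D2 i (0, f b) (0, f b) (s, f z))
        = A i * (D1 (i + 1) (1, 0) (s, z))\<^sup>2 - A i * (D1 (i + 1) (1, 0) (s, f z))\<^sup>2"
        unfolding sum_subtractf tr eq[OF s, symmetric] by (simp add: algebra_simps)
      \<comment> \<open>Difference of squares: the sum of the two time derivatives is the
        coefficient \<Lambda>, and the difference is the time derivative of the function
        tested.\<close>
      also have "\<dots> = A i * (D1 (i + 1) (1, 0) (s, z) + D1 (i + 1) (1, 0) (s, f z)) *
          (D1 (i + 1) (1, 0) (s, z) - D1 (i + 1) (1, 0) (s, f z))"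
        by (simp add: algebra_simps power2_eq_square)
      finally show ?thesis by (simp add: J f0 abs_mult)
    qed
  qed (rule assms(1))
  then show ?thesis by (simp add: J f(2))
qed

end

section \<open>The profile along a coordinate axis\<close>

abbreviation e1 :: "real^3" where "e1 \<equiv> axis 1 1"

context wave_pair
begin

text \<open>The variable r runs over all reals: a negative r is the opposite point of the axis, so
  radial symmetry makes this the even extension through r = 0.\<close>

definition profile where "profile i t r = d i (t, r *\<^sub>R e1)"
definition profile_t where "profile_t i t r = D1 i (1, 0) (t, r *\<^sub>R e1)"
definition profile_r where "profile_r i t r = D1 i (0, e1) (t, r *\<^sub>R e1)"
definition profile_tr where "profile_tr i t r = D2 i (1, 0) (0, e1) (t, r *\<^sub>R e1)"
definition profile_rr where "profile_rr i t r = D2 i (0, e1) (0, e1) (t, r *\<^sub>R e1)"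

text \<open>\<open>incoming i = (\<partial>\<^sub>t - c i \<partial>\<^sub>r) (r profile i)\<close>, written out.\<close>

definition incoming where
  "incoming i t r = r * profile_t i t r - c i * (profile i t r + r * profile_r i t r)"
definition incoming_r where
  "incoming_r i t r = profile_t i t r + r * profile_tr i t r - c i * (2 * profile_r i t r + r * profile_rr i t r)"

lemmas profile_defs = profile_def profile_t_def profile_r_def profile_tr_def profile_rr_def

lemma cont_on_axis:
  assumes "continuous_on ({0..} \<times> UNIV) h"
  shows "continuous_on ({0..} \<times> UNIV) (\<lambda>p. h (fst p, snd p *\<^sub>R e1))"
  by (rule continuous_on_compose2[OF assms]) (auto intro!: continuous_intros)

lemma cont_profiles:
  "continuous_on ({0..} \<times> UNIV) (\<lambda>p. profile i (fst p) (snd p))"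
  "continuous_on ({0..} \<times> UNIV) (\<lambda>p. profile_t i (fst p) (snd p))"
  "continuous_on ({0..} \<times> UNIV) (\<lambda>p. profile_r i (fst p) (snd p))"
  "continuous_on ({0..} \<times> UNIV) (\<lambda>p. profile_tr i (fst p) (snd p))"
  "continuous_on ({0..} \<times> UNIV) (\<lambda>p. profile_rr i (fst p) (snd p))"
  unfolding profile_defs by (rule cont_on_axis cont0 cont1 cont2)+

lemma DERIV_on_axis:
  fixes h :: "real \<times> (real^3) \<Rightarrow> real"
  assumes "(h has_derivative h') (at (t, r *\<^sub>R e1) within {0..} \<times> UNIV)" "0 \<le> t"
  shows "((\<lambda>r. h (t, r *\<^sub>R e1)) has_real_derivative h' (0, e1)) (at r)"
  using partial_space_derivative_within[of h h' t 0 r e1] assms by simp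

lemma DERIV_profiles:
  assumes "0 \<le> t"
  shows "(profile i t has_real_derivative profile_r i t r) (at r)"
    and "(profile_t i t has_real_derivative profile_tr i t r) (at r)"
    and "(profile_r i t has_real_derivative profile_rr i t r) (at r)"
  unfolding profile_defs[abs_def]
  by (rule DERIV_on_axis[OF der0[OF assms] assms] DERIV_on_axis[OF der1[OF assms] assms])+

lemma profile_even: "0 \<le> t \<Longrightarrow> profile i t (- r) = profile i t r"
  unfolding profile_def by (rule radial) auto

text \<open>For t > 0 evenness of the profile is differentiated in time; at t = 0 it is read off
  from the radial initial velocity.\<close>

lemma profile_t_even:
  assumes "0 \<le> t"
  shows "profile_t i t (- r) = profile_t i t r"
proof (cases "t = 0")
  case True
  then show ?thesis by (simp add: profile_t_def init_t)
next
  case False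
  then have t: "0 < t" using assms by simp
  have "((\<lambda>t. profile i t s) has_real_derivative profile_t i t s) (at t)" for s
    unfolding profile_def profile_t_def using partial_time_derivative[OF interior_der(1)[OF t]] .
  then have "((\<lambda>t. profile i t r) has_real_derivative profile_t i t (- r)) (at t)"
    by (rule has_field_derivative_transform_within_open[of _ _ _ "{0<..}"]) (use t in \<open>auto simp: profile_even\<close>)
  then show ?thesis
    using DERIV_unique \<open>\<And>s. ((\<lambda>t. profile i t s) has_real_derivative profile_t i t s) (at t)\<close> by blast
qed

lemma profile_r_odd:
  assumes "0 \<le> t"
  shows "profile_r i t (- r) = - profile_r i t r"
proof -
  have "((\<lambda>r. profile i t (- r)) has_real_derivative profile_r i t (- r) * (- 1)) (at r)"
    by (rule DERIV_chain2[OF DERIV_profiles(1)[OF assms]]) (auto intro!: derivative_eq_intros)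
  then have "(profile i t has_real_derivative - profile_r i t (- r)) (at r)"
    by (simp add: profile_even[OF assms])
  from DERIV_unique[OF this DERIV_profiles(1)[OF assms]] show ?thesis by simp
qed

lemma profile_r_0: "0 \<le> t \<Longrightarrow> profile_r i t 0 = 0"
  using profile_r_odd[of t i 0] by simp

text \<open>On the line r e1 + s b the function is the profile at sqrt(r^2 + s^2), so its first
  derivative is s k(s) with k continuous at 0, and the second derivative at s = 0 is k(0) = u'(r) /
  r. Multiplying by r includes the axis point.\<close>

lemma transversal_second_derivative:
  assumes t: "0 < t" and b: "norm b = 1" "b \<bullet> e1 = 0"
  shows "r * D2 i (0, b) (0, b) (t, r *\<^sub>R e1) = profile_r i t r"
proof (cases "r = 0")
  case True
  then show ?thesis using profile_r_0[of t i] t by simp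
next
  case False
  let ?\<rho> = "\<lambda>s. sqrt (r\<^sup>2 + s\<^sup>2)"
  have t0: "0 \<le> t" using t by simp
  have pos: "0 < r\<^sup>2 + s\<^sup>2" for s using False by (simp add: add_pos_nonneg)
  have norm: "norm (r *\<^sub>R e1 + s *\<^sub>R b) = norm (?\<rho> s *\<^sub>R e1)" for s
  proof -
    have "(norm (r *\<^sub>R e1 + s *\<^sub>R b))\<^sup>2 = r\<^sup>2 + s\<^sup>2"
      using b unfolding power2_norm_eq_inner
      by (simp add: inner_add_left inner_add_right inner_commute power2_eq_square norm_eq_1 inner_axis_axis)
    then have "norm (r *\<^sub>R e1 + s *\<^sub>R b) = ?\<rho> s" by (metis norm_ge_zero real_sqrt_unique)
    then show ?thesis by simp
  qed
  have eq: "d i (t, r *\<^sub>R e1 + s *\<^sub>R b) = profile i t (?\<rho> s)" for s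
    unfolding profile_def by (rule radial[OF t0 norm])
  define k where "k s = profile_r i t (?\<rho> s) / ?\<rho> s" for s
  have D1b: "D1 i (0, b) (t, r *\<^sub>R e1 + s *\<^sub>R b) = k s * s" for s
  proof -
    have "(?\<rho> has_real_derivative s / ?\<rho> s) (at s)"
      using pos[of s] by (auto intro!: derivative_eq_intros simp: divide_simps)
    from DERIV_chain2[OF DERIV_profiles(1)[OF t0] this]
    have "((\<lambda>s. profile i t (?\<rho> s)) has_real_derivative k s * s) (at s)" by (simp add: k_def)
    then have "((\<lambda>s. d i (t, r *\<^sub>R e1 + s *\<^sub>R b)) has_real_derivative k s * s) (at s)" by (simp only: eq)
    from DERIV_unique[OF partial_space_derivative[OF interior_der(1)[OF t]] this] show ?thesis .
  qed
  have "((\<lambda>s. D1 i (0, b) (t, r *\<^sub>R e1 + s *\<^sub>R b)) has_real_derivative k 0) (at 0)"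
  proof -
    have "isCont (profile_r i t) (?\<rho> 0)" by (rule DERIV_isCont[OF DERIV_profiles(3)[OF t0]])
    then have "isCont k 0"
      unfolding k_def using pos[of 0]
      by (intro continuous_intros isCont_o2[of 0 ?\<rho> "profile_r i t"]) auto
    then show ?thesis
      unfolding D1b CARAT_DERIV by (intro exI[of _ k]) auto
  qed
  moreover have "((\<lambda>s. D1 i (0, b) (t, r *\<^sub>R e1 + s *\<^sub>R b)) has_real_derivative D2 i (0, b) (0, b) (t, r *\<^sub>R e1)) (at 0)"
    using partial_space_derivative[of "D1 i (0, b)" "\<lambda>w. D2 i (0, b) w (t, r *\<^sub>R e1)" t "r *\<^sub>R e1" 0 b]
      interior_der(2)[OF t] by simp
  ultimately have "D2 i (0, b) (0, b) (t, r *\<^sub>R e1) = k 0" by (rule DERIV_unique[symmetric])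
  also have "k 0 = profile_r i t \<bar>r\<bar> / \<bar>r\<bar>" by (simp add: k_def)
  also have "\<dots> = profile_r i t r / r"
    using profile_r_odd[OF t0, of i r] by (cases "r \<ge> 0") auto
  finally show ?thesis using False by simp
qed

text \<open>In dimension 3 there are two transversal directions, hence the factor 2; this makes the
  right-hand side the second derivative of r times the profile.\<close>

lemma radial_laplacian:
  assumes t: "0 < t"
  shows "r * (\<Sum>b\<in>Basis. D2 i (0, b) (0, b) (t, r *\<^sub>R e1)) = r * profile_rr i t r + 2 * profile_r i t r"
proof -
  have e1: "e1 \<in> Basis" by simp
  have "r * (\<Sum>b\<in>Basis. D2 i (0, b) (0, b) (t, r *\<^sub>R e1))
      = r * profile_rr i t r + (\<Sum>b\<in>Basis - {e1}. r * D2 i (0, b) (0, b) (t, r *\<^sub>R e1))"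
    by (subst sum.remove[OF finite_Basis e1]) (simp add: profile_rr_def distrib_left sum_distrib_left)
  also have "(\<Sum>b\<in>Basis - {e1}. r * D2 i (0, b) (0, b) (t, r *\<^sub>R e1)) = (\<Sum>b\<in>Basis - {e1}. profile_r i t r)"
  proof (rule sum.cong[OF refl])
    fix b :: "real^3" assume b: "b \<in> Basis - {e1}"
    then have "b \<bullet> e1 = 0" using e1 by (intro inner_not_same_Basis) auto
    then show "r * D2 i (0, b) (0, b) (t, r *\<^sub>R e1) = profile_r i t r"
      using b by (intro transversal_second_derivative[OF t]) auto
  qed
  also have "\<dots> = 2 * profile_r i t r"
  proof -
    have "card (Basis - {e1}) = 2" using e1 by (subst card_Diff_singleton) auto
    then show ?thesis by simp
  qed
  finally show ?thesis .
qed

lemma DERIV_characteristic: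
  fixes h :: "real \<times> (real^3) \<Rightarrow> real"
  assumes "(h has_derivative h') (at (s, (\<rho> + k * s) *\<^sub>R e1))"
  shows "((\<lambda>s. h (s, (\<rho> + k * s) *\<^sub>R e1)) has_real_derivative h' (1, 0) + k * h' (0, e1)) (at s)"
proof -
  have "((\<lambda>s. (s, (\<rho> + k * s) *\<^sub>R e1)) has_derivative (\<lambda>x. (x, (k * x) *\<^sub>R e1))) (at s)"
    by (auto intro!: derivative_eq_intros)
  from has_derivative_compose[OF this assms]
  have "((\<lambda>s. h (s, (\<rho> + k * s) *\<^sub>R e1)) has_derivative (\<lambda>x. h' (x, (k * x) *\<^sub>R e1))) (at s)" .
  moreover have "(\<lambda>x. h' (x, (k * x) *\<^sub>R e1)) = (*) (h' (1, 0) + k * h' (0, e1))"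
  proof
    have l: "linear h'" using assms by (rule has_derivative_linear)
    show "h' (x, (k * x) *\<^sub>R e1) = (h' (1, 0) + k * h' (0, e1)) * x" for x
      using linear_add[OF l, of "x *\<^sub>R (1, 0)" "(k * x) *\<^sub>R (0, e1)"]
        linear_cmul[OF l, of x "(1, 0)"] linear_cmul[OF l, of "k * x" "(0, e1)"]
      by (simp add: algebra_simps)
  qed
  ultimately show ?thesis by (simp only: has_field_derivative_def)
qed

lemma transport_derivative:
  assumes s: "0 < s"
  shows "((\<lambda>s. incoming i s (\<rho> + c i * s)) has_real_derivative
    A i * (\<rho> + c i * s) * (profile_t (i + 1) s (\<rho> + c i * s))\<^sup>2) (at s)"
proof -
  define y where "y = \<rho> + c i * s"
  have d0: "((\<lambda>s. profile i s (\<rho> + c i * s)) has_real_derivative profile_t i s y + c i * profile_r i s y) (at s)"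
    unfolding profile_defs y_def by (rule DERIV_characteristic[OF interior_der(1)[OF s]])
  have d1: "((\<lambda>s. profile_t i s (\<rho> + c i * s)) has_real_derivative D2 i (1, 0) (1, 0) (s, y *\<^sub>R e1) + c i * profile_tr i s y) (at s)"
    unfolding profile_defs y_def by (rule DERIV_characteristic[OF interior_der(2)[OF s]])
  have d2: "((\<lambda>s. profile_r i s (\<rho> + c i * s)) has_real_derivative profile_tr i s y + c i * profile_rr i s y) (at s)"
    unfolding profile_defs y_def sym[OF s, of i "(1, 0)"] by (rule DERIV_characteristic[OF interior_der(2)[OF s]])
  have d3: "((\<lambda>s. \<rho> + c i * s) has_real_derivative c i) (at s)"
    by (auto intro!: derivative_eq_intros)
  have "((\<lambda>s. incoming i s (\<rho> + c i * s)) has_real_derivative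
      (c i * profile_t i s y + (D2 i (1, 0) (1, 0) (s, y *\<^sub>R e1) + c i * profile_tr i s y) * y) -
      c i * ((profile_t i s y + c i * profile_r i s y) + (c i * profile_r i s y + (profile_tr i s y + c i * profile_rr i s y) * y))) (at s)"
    unfolding incoming_def y_def
    by (intro DERIV_diff DERIV_cmult DERIV_add DERIV_mult d0[unfolded y_def] d1[unfolded y_def] d2[unfolded y_def] d3)
  also have "(c i * profile_t i s y + (D2 i (1, 0) (1, 0) (s, y *\<^sub>R e1) + c i * profile_tr i s y) * y) -
      c i * ((profile_t i s y + c i * profile_r i s y) + (c i * profile_r i s y + (profile_tr i s y + c i * profile_rr i s y) * y))
    = y * D2 i (1, 0) (1, 0) (s, y *\<^sub>R e1) - (c i)\<^sup>2 * (y * profile_rr i s y + 2 * profile_r i s y)"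
    by (simp add: algebra_simps power2_eq_square)
  also have "\<dots> = y * (D2 i (1, 0) (1, 0) (s, y *\<^sub>R e1) - (c i)\<^sup>2 * (\<Sum>b\<in>Basis. D2 i (0, b) (0, b) (s, y *\<^sub>R e1)))"
    unfolding radial_laplacian[OF s, symmetric] by (simp add: algebra_simps)
  also have "\<dots> = A i * y * (profile_t (i + 1) s y)\<^sup>2"
    unfolding eq[OF s] profile_t_def by simp
  finally show ?thesis by (simp only: y_def)
qed

lemma cont_incoming: "continuous_on ({0..} \<times> UNIV) (\<lambda>p. incoming i (fst p) (snd p))"
  unfolding incoming_def by (intro continuous_intros cont_profiles)

lemma radial_pair: "radial_pair c A incoming incoming_r profile_t profile_tr"
proof
  show "0 < c i" for i by (rule c_pos)
  show "c 1 < c 2" by (rule c_less)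
  show "continuous_on ({0..} \<times> UNIV) (\<lambda>(t, r). incoming i t r)" for i
    unfolding split_beta by (rule cont_incoming)
  show "continuous_on ({0..} \<times> UNIV) (\<lambda>(t, r). incoming_r i t r)" for i
    unfolding split_beta incoming_r_def by (intro continuous_intros cont_profiles)
  show "continuous_on ({0..} \<times> UNIV) (\<lambda>(t, r). profile_t i t r)" for i
    unfolding split_beta by (rule cont_profiles)
  show "continuous_on ({0..} \<times> UNIV) (\<lambda>(t, r). profile_tr i t r)" for i
    unfolding split_beta by (rule cont_profiles)
  fix i t r
  assume t: "0 \<le> (t::real)"
  note dp = DERIV_profiles[OF t, of i r]
  show "(profile_t i t has_real_derivative profile_tr i t r) (at r)" by (rule dp)
  have "((\<lambda>r. r * profile_t i t r - c i * (profile i t r + r * profile_r i t r)) has_real_derivative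
      (1 * profile_t i t r + profile_tr i t r * r) - c i * (profile_r i t r + (1 * profile_r i t r + profile_rr i t r * r))) (at r)"
    by (intro DERIV_diff DERIV_cmult DERIV_add DERIV_mult DERIV_ident dp)
  then show "(incoming i t has_real_derivative incoming_r i t r) (at r)"
    unfolding incoming_def[abs_def] incoming_r_def by (simp add: algebra_simps)
  show "2 * r * profile_t i t r = incoming i t r - incoming i t (- r)"
    unfolding incoming_def profile_even[OF t] profile_t_even[OF t] profile_r_odd[OF t] by (simp add: algebra_simps)
next
  fix i t \<rho>
  assume t: "0 \<le> (t::real)"
  have "((\<lambda>s. A i * (\<rho> + c i * s) * (profile_t (i + 1) s (\<rho> + c i * s))\<^sup>2) has_integral
      (incoming i t (\<rho> + c i * t) - incoming i 0 (\<rho> + c i * 0))) {0..t}"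
  \<comment> \<open>The transport equation is available only for s > 0; continuity supplies the
    endpoint s = 0.\<close>
  proof (rule fundamental_theorem_of_calculus_interior[where f = "\<lambda>s. incoming i s (\<rho> + c i * s)", OF t])
    show "continuous_on {0..t} (\<lambda>s. incoming i s (\<rho> + c i * s))"
      by (rule continuous_on_half_plane_comp[OF cont_incoming[folded split_beta]]) (auto intro!: continuous_intros)
    show "((\<lambda>s. incoming i s (\<rho> + c i * s)) has_vector_derivative A i * (\<rho> + c i * s) * (profile_t (i + 1) s (\<rho> + c i * s))\<^sup>2) (at s)"
      if "s \<in> {0<..<t}" for s
      using transport_derivative[of s i \<rho>] that by (simp add: has_real_derivative_iff_has_vector_derivative)
  qed
  from integral_unique[OF this] show "incoming i t (\<rho> + c i * t) = incoming i 0 \<rho> +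
      integral {0..t} (\<lambda>s. A i * (\<rho> + c i * s) * (profile_t (i + 1) s (\<rho> + c i * s))\<^sup>2)"
    by simp
qed

lemma init_profile: "profile i 0 r = 0"
  by (simp add: profile_def init)

lemma init_incoming: "incoming i 0 r = r * \<psi> i (r\<^sup>2)"
  by (simp add: incoming_def init_profile profile_t_def profile_r_def init_t init_x power2_eq_square inner_axis_axis)

text \<open>Along the characteristic y = r + c (t - s) the derivative of y u(s, y) in s is
  \<open>incoming\<close>; integration starts from zero initial position.\<close>

lemma integral_representation:
  assumes t: "0 \<le> t"
  shows "r * profile i t r = integral {0..t} (\<lambda>s. incoming i s (r + c i * (t - s)))"
proof -
  define y where "y s = r + c i * (t - s)" for s
  have y: "y = (\<lambda>s. (r + c i * t) + (- c i) * s)" by (auto simp: y_def algebra_simps)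
  have "((\<lambda>s. incoming i s (y s)) has_integral (y t * profile i t (y t) - y 0 * profile i 0 (y 0))) {0..t}"
  proof (rule fundamental_theorem_of_calculus_interior[where f = "\<lambda>s. y s * profile i s (y s)", OF t])
    show "continuous_on {0..t} (\<lambda>s. y s * profile i s (y s))"
      unfolding y by (intro continuous_intros continuous_on_half_plane_comp[OF cont_profiles(1)[folded split_beta]]) auto
    show "((\<lambda>s. y s * profile i s (y s)) has_vector_derivative incoming i s (y s)) (at s)" if "s \<in> {0<..<t}" for s
    proof -
      have s: "0 < s" using that by simp
      have d0: "((\<lambda>s. profile i s (y s)) has_real_derivative profile_t i s (y s) + (- c i) * profile_r i s (y s)) (at s)"
        unfolding profile_defs y by (rule DERIV_characteristic[OF interior_der(1)[OF s]])
      have d1: "(y has_real_derivative - c i) (at s)"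
        unfolding y by (auto intro!: derivative_eq_intros)
      show ?thesis
        using DERIV_mult[OF d1 d0]
        by (simp add: has_real_derivative_iff_has_vector_derivative[symmetric] incoming_def algebra_simps)
    qed
  qed
  then show ?thesis by (simp add: integral_unique init_profile y_def)
qed

end

section \<open>From a global smooth solution to the abstract system\<close>

lemma global_smooth_solution_wave_pair:
  fixes u :: "real \<Rightarrow> real^3 \<Rightarrow> real^2"
  assumes sol: "global_smooth_solution c1 c2 A1 A2 (\<lambda>x. 0) \<phi> u"
    and c: "0 < c1" "c1 < c2" and \<psi>: "\<And>i x. \<phi> x $ i = \<psi> i (x \<bullet> x)"
  obtains D1 D2 where "wave_pair (\<lambda>i. if i = 1 then c1 else c2) (\<lambda>i. if i = 1 then A1 else A2)
    (\<lambda>i p. u (fst p) (snd p) $ i) D1 D2 \<psi>"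
proof -
  define S where "S = ({0..} \<times> UNIV :: (real \<times> (real^3)) set)"
  define F where "F = (\<lambda>p. u (fst p) (snd p))"
  define G where "G v p = frechet_derivative F (at p within S) v" for v p
  define H where "H v w p = frechet_derivative (G v) (at p within S) w" for v w p
  have "smooth_on S F"
    using sol by (simp add: global_smooth_solution_def S_def F_def split_beta')
  then have "continuously_differentiable_on (Suc (Suc 0)) S F" by (simp only: smooth_on_def)
  then have "F differentiable_on S" "G v differentiable_on S" and contH: "continuous_on S (H v w)" for v w
    unfolding continuously_differentiable_on.simps G_def[abs_def] H_def[abs_def] by blast+
  then have derF: "(F has_derivative (\<lambda>v. G v p)) (at p within S)"
    and derG: "(G v has_derivative (\<lambda>w. H v w p)) (at p within S)" if "p \<in> S" for p v
    using that unfolding differentiable_on_def frechet_derivative_works G_def[abs_def] H_def[abs_def] by blast+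
  define D0 where "D0 i p = F p $ i" for i p
  define D1 where "D1 i v p = G v p $ i" for i v p
  define D2 where "D2 i v w p = H v w p $ i" for i v w p
  have der0: "(D0 i has_derivative (\<lambda>v. D1 i v p)) (at p within S)" if "p \<in> S" for i p
    unfolding D0_def[abs_def] D1_def by (rule bounded_linear.has_derivative[OF bounded_linear_vec_nth derF[OF that]])
  have der1: "(D1 i v has_derivative (\<lambda>w. D2 i v w p)) (at p within S)" if "p \<in> S" for i v p
    unfolding D1_def[abs_def] D2_def by (rule bounded_linear.has_derivative[OF bounded_linear_vec_nth derG[OF that]])
  have at_eq: "at (t, x) within S = at (t, x)" if "0 < t" for t and x :: "real^3"
    unfolding S_def by (rule at_within_interior[OF half_space_interior[OF that]])
  have der0': "(D0 i has_derivative (\<lambda>v. D1 i v (t, x))) (at (t, x))" if "0 < t" for i t x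
    using der0[of "(t, x)" i] at_eq[OF that, of x] that by (simp add: S_def)
  have der1': "(D1 i v has_derivative (\<lambda>w. D2 i v w (t, x))) (at (t, x))" if "0 < t" for i v t x
    using der1[of "(t, x)" i v] at_eq[OF that, of x] that by (simp add: S_def)
  have uD0: "u t x $ i = D0 i (t, x)" for t x i by (simp add: D0_def F_def)
  have deriv_t: "deriv (\<lambda>s. u s x $ i) t = D1 i (1, 0) (t, x)" if "0 < t" for i t x
    unfolding uD0 by (rule DERIV_imp_deriv[OF partial_time_derivative[OF der0'[OF that]]])
  have deriv_tt: "(deriv ^^ 2) (\<lambda>s. u s x $ i) t = D2 i (1, 0) (1, 0) (t, x)" if t: "0 < t" for i t x
  proof -
    have "((\<lambda>s. D1 i (1, 0) (s, x)) has_real_derivative D2 i (1, 0) (1, 0) (t, x)) (at t)"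
      by (rule partial_time_derivative[OF der1'[OF t]])
    \<comment> \<open>The identification of \<open>deriv\<close> with \<open>D1\<close> holds for
      positive times only, so it is transferred on the open half-line.\<close>
    then have "(deriv (\<lambda>s. u s x $ i) has_real_derivative D2 i (1, 0) (1, 0) (t, x)) (at t)"
      by (rule has_field_derivative_transform_within_open[of _ _ _ "{0<..}"]) (use t in \<open>auto simp: deriv_t\<close>)
    then show ?thesis by (simp add: numeral_2_eq_2 DERIV_imp_deriv)
  qed
  have deriv_xx: "(deriv ^^ 2) (\<lambda>s. u t (x + s *\<^sub>R b) $ i) 0 = D2 i (0, b) (0, b) (t, x)" if t: "0 < t" for i t x b
  proof -
    have "deriv (\<lambda>s. u t (x + s *\<^sub>R b) $ i) = (\<lambda>s. D1 i (0, b) (t, x + s *\<^sub>R b))"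
      unfolding uD0 by (rule ext, rule DERIV_imp_deriv[OF partial_space_derivative[OF der0'[OF t]]])
    moreover have "((\<lambda>s. D1 i (0, b) (t, x + s *\<^sub>R b)) has_real_derivative D2 i (0, b) (0, b) (t, x)) (at 0)"
      using partial_space_derivative[of "D1 i (0, b)" "\<lambda>w. D2 i (0, b) w (t, x)" t x 0 b] der1'[OF t] by simp
    ultimately show ?thesis by (simp add: numeral_2_eq_2 DERIV_imp_deriv)
  qed
  let ?c = "\<lambda>i::2. if i = 1 then c1 else c2" and ?A = "\<lambda>i::2. if i = 1 then A1 else A2"
  have box: "dalembertian (?c i) (\<lambda>t x. u t x $ i) t x
      = D2 i (1, 0) (1, 0) (t, x) - (?c i)\<^sup>2 * (\<Sum>b\<in>Basis. D2 i (0, b) (0, b) (t, x))" if t: "0 < t" for i t x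
    unfolding dalembertian_def laplacian_def deriv_tt[OF t] deriv_xx[OF t] ..
  have eq: "dalembertian (?c i) (\<lambda>t x. u t x $ i) t x = ?A i * (deriv (\<lambda>s. u s x $ (i + 1)) t)\<^sup>2" if "0 < t" for i t x
    using sol that exhaust_2[of i] by (auto simp: global_smooth_solution_def)
  have "wave_pair ?c ?A D0 D1 D2 \<psi>"
  proof
    show "0 < ?c i" for i using c by simp
    show "?c 1 < ?c 2" using c by simp
    show "(D0 i has_derivative (\<lambda>v. D1 i v (t, x))) (at (t, x) within {0..} \<times> UNIV)" if "0 \<le> t" for i t x
      using der0[of "(t, x)" i] that by (simp add: S_def)
    show "(D1 i v has_derivative (\<lambda>w. D2 i v w (t, x))) (at (t, x) within {0..} \<times> UNIV)" if "0 \<le> t" for i v t x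
      using der1[of "(t, x)" i v] that by (simp add: S_def)
    show "continuous_on ({0..} \<times> UNIV) (D2 i v w)" for i v w
      unfolding D2_def[abs_def] using contH[of v w] by (auto simp: S_def intro!: continuous_intros)
    show "D2 i (1, 0) (1, 0) (t, x) - (?c i)\<^sup>2 * (\<Sum>b\<in>Basis. D2 i (0, b) (0, b) (t, x))
        = ?A i * (D1 (i + 1) (1, 0) (t, x))\<^sup>2" if "0 < t" for i t x
      using eq[OF that, of i x] unfolding box[OF that] deriv_t[OF that] .
    show "D0 i (0, x) = 0" for i x
      using sol by (simp add: global_smooth_solution_def D0_def F_def)
    show "D1 i (1, 0) (0, x) = \<psi> i (x \<bullet> x)" for i x
    proof -
      \<comment> \<open>The initial velocity is prescribed as a one-sided derivative; restricting
        the half-space derivative to the vertical ray and using uniqueness of one-sided derivatives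
        identifies the two.\<close>
      have l: "((\<lambda>t. (t, x)) has_derivative (\<lambda>r. (r, 0))) (at 0 within {0..})"
        by (auto intro!: derivative_eq_intros)
      have "(F has_derivative (\<lambda>v. G v (0, x))) (at (0, x) within (\<lambda>t. (t, x)) ` {0..})"
        by (rule has_derivative_subset[OF derF]) (auto simp: S_def)
      from has_derivative_in_compose[OF l this]
      have d: "((\<lambda>t. u t x) has_derivative (\<lambda>r. G (r, 0) (0, x))) (at 0 within {0..})"
        by (simp add: F_def)
      have lin: "linear (\<lambda>v. G v (0, x))"
        using derF[of "(0, x)"] by (auto simp: S_def intro: has_derivative_linear)
      have "(\<lambda>r. G (r, 0) (0, x)) = (\<lambda>r. r *\<^sub>R G (1, 0) (0, x))"
      proof
        show "G (r, 0) (0, x) = r *\<^sub>R G (1, 0) (0, x)" for r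
          using linear_cmul[OF lin, of r "(1, 0)"] by simp
      qed
      with d have "((\<lambda>t. u t x) has_vector_derivative G (1, 0) (0, x)) (at 0 within {0..})"
        by (simp only: has_vector_derivative_def)
      moreover have "((\<lambda>t. u t x) has_vector_derivative \<phi> x) (at 0 within {0..})"
        using sol by (simp add: global_smooth_solution_def)
      moreover have "at (0::real) within {0..} \<noteq> bot"
        by (simp add: at_within_Ici_at_right)
      ultimately have "G (1, 0) (0, x) = \<phi> x" using vector_derivative_unique_within by blast
      then show ?thesis by (simp add: D1_def \<psi>)
    qed
  qed
  then show ?thesis using that by (simp add: D0_def[abs_def] F_def)
qed

theorem theorem2p4:
  fixes c1 c2 A1 A2 :: real
  assumes "0 < c1" and "c1 < c2" and "A1 \<noteq> 0"
  shows "\<exists>(f :: real^3 \<Rightarrow> real^2) (g :: real^3 \<Rightarrow> real^2) (M :: real) (T0 :: real) (C :: real).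
    smooth_compactly_supported f \<and> smooth_compactly_supported g \<and> M > 0 \<and> T0 \<ge> 2 \<and> C > 0 \<and>
    (\<exists>\<epsilon>0>0. \<forall>\<epsilon>. 0 < \<epsilon> \<and> \<epsilon> < \<epsilon>0 \<longrightarrow>
      (\<forall>u. global_smooth_solution c1 c2 A1 A2 (\<lambda>x. \<epsilon> *\<^sub>R f x) (\<lambda>x. \<epsilon> *\<^sub>R g x) u \<longrightarrow>
        (\<forall>t x. T0 \<le> c1 * t \<and> c1 * t \<le> norm x \<and> norm x \<le> c1 * t + M \<longrightarrow>
          inverse C * \<epsilon> * (1 + \<epsilon> * ln (2 + t)) \<le> \<bar>norm x * u t x $ 1\<bar> \<and>
          \<bar>norm x * u t x $ 1\<bar> \<le> C * \<epsilon> * (1 + \<epsilon> * ln (2 + t)))))"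
proof -
  define c where "c i = (if i = 1 then c1 else c2)" for i :: 2
  define A where "A i = (if i = 1 then A1 else A2)" for i :: 2
  \<comment> \<open>Only the first component needs the sign of \<open>A1\<close>, to align its free
    part with its Duhamel part; the second acts on the first only through a square.\<close>
  define \<sigma> where "\<sigma> i = (if i = 1 then sgn A1 else 1)" for i :: 2
  define g where "g x = flat_exp 0 (9 - x \<bullet> x) *\<^sub>R (\<chi> i. \<sigma> i)" for x :: "real^3"
  obtain B where B: "0 < B" "\<And>\<rho>. \<bar>radial_bump \<rho>\<bar> \<le> B / (1 + \<bar>\<rho>\<bar>)\<^sup>2" "\<And>\<rho>. \<bar>radial_bump' \<rho>\<bar> \<le> B / (1 + \<bar>\<rho>\<bar>)\<^sup>2"
    using radial_bump_bound by blast
  have nonneg: "0 \<le> radial_bump \<rho>" if "0 \<le> \<rho>" for \<rho>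
    using that by (simp add: radial_bump_def flat_exp_nonneg)
  have nonpos: "radial_bump \<rho> \<le> 0" if "\<rho> \<le> 0" for \<rho>
    using that by (simp add: radial_bump_def flat_exp_nonneg mult_nonpos_nonneg)
  have cA: "0 < c i" "c 1 < c 2" "A 1 \<noteq> 0" for i using assms by (auto simp: c_def A_def)
  obtain C \<epsilon>0 where C: "0 < C" and \<epsilon>0: "0 < \<epsilon>0"
    and bounds: "\<And>\<epsilon> w z q dq t r v. 0 < \<epsilon> \<Longrightarrow> \<epsilon> < \<epsilon>0 \<Longrightarrow> radial_pair c A w z q dq \<Longrightarrow>
      (\<And>i \<rho>. w i 0 \<rho> = \<epsilon> * (if i = 1 then sgn (A 1) else 1) * radial_bump \<rho>) \<Longrightarrow>
      2 \<le> c 1 * t \<Longrightarrow> c 1 * t \<le> r \<Longrightarrow> r \<le> c 1 * t + 1 \<Longrightarrow>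
      v = integral {0..t} (\<lambda>s. w 1 s (r + c 1 * (t - s))) \<Longrightarrow>
      inverse C * \<epsilon> * (1 + \<epsilon> * ln (2 + t)) \<le> \<bar>v\<bar> \<and> \<bar>v\<bar> \<le> C * \<epsilon> * (1 + \<epsilon> * ln (2 + t))"
    using radial_pair_two_sided[where c = c and A = A, OF cA B(1) exp_gt_zero nonneg nonpos radial_bump_lower B(2,3) DERIV_radial_bump]
    by blast
  have main: "inverse C * \<epsilon> * (1 + \<epsilon> * ln (2 + t)) \<le> \<bar>norm x * u t x $ 1\<bar> \<and>
      \<bar>norm x * u t x $ 1\<bar> \<le> C * \<epsilon> * (1 + \<epsilon> * ln (2 + t))"
    if \<epsilon>: "0 < \<epsilon>" "\<epsilon> < \<epsilon>0"
      and sol: "global_smooth_solution c1 c2 A1 A2 (\<lambda>x. \<epsilon> *\<^sub>R 0) (\<lambda>x. \<epsilon> *\<^sub>R g x) u"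
      and tx: "2 \<le> c1 * t" "c1 * t \<le> norm x" "norm x \<le> c1 * t + 1" for \<epsilon> u t and x :: "real^3"
  proof -
    have gi: "(\<epsilon> *\<^sub>R g x) $ i = \<epsilon> * \<sigma> i * flat_exp 0 (9 - x \<bullet> x)" for x i
      by (simp add: g_def)
    have "global_smooth_solution c1 c2 A1 A2 (\<lambda>x. 0) (\<lambda>x. \<epsilon> *\<^sub>R g x) u" using sol by simp
    then obtain D1 D2 where "wave_pair (\<lambda>i. if i = 1 then c1 else c2) (\<lambda>i. if i = 1 then A1 else A2)
        (\<lambda>i p. u (fst p) (snd p) $ i) D1 D2 (\<lambda>i s. \<epsilon> * \<sigma> i * flat_exp 0 (9 - s))"
      by (rule global_smooth_solution_wave_pair[OF _ assms(1,2)]) (rule gi)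
    then have "wave_pair c A (\<lambda>i p. u (fst p) (snd p) $ i) D1 D2 (\<lambda>i s. \<epsilon> * \<sigma> i * flat_exp 0 (9 - s))"
      by (simp only: c_def[abs_def] A_def[abs_def])
    then interpret wave_pair c A "\<lambda>i p. u (fst p) (snd p) $ i" D1 D2 "\<lambda>i s. \<epsilon> * \<sigma> i * flat_exp 0 (9 - s)" .
    have t: "0 \<le> t" using tx(1) assms(1) zero_le_mult_iff[of c1 t] by linarith
    have "u t x $ 1 = profile 1 t (norm x)"
      using radial[OF t, of x "norm x *\<^sub>R e1" 1] by (simp add: profile_def)
    moreover have "inverse C * \<epsilon> * (1 + \<epsilon> * ln (2 + t)) \<le> \<bar>norm x * profile 1 t (norm x)\<bar> \<and>
      \<bar>norm x * profile 1 t (norm x)\<bar> \<le> C * \<epsilon> * (1 + \<epsilon> * ln (2 + t))"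
    proof (rule bounds[OF \<epsilon> radial_pair])
      show "incoming i 0 \<rho> = \<epsilon> * (if i = 1 then sgn (A 1) else 1) * radial_bump \<rho>" for i \<rho>
        by (simp add: init_incoming radial_bump_def \<sigma>_def A_def)
      show "norm x * profile 1 t (norm x) = integral {0..t} (\<lambda>s. incoming 1 s (norm x + c 1 * (t - s)))"
        by (rule integral_representation[OF t])
    qed (use tx in \<open>auto simp: c_def\<close>)
    ultimately show ?thesis by simp
  qed
  show ?thesis
  proof (intro exI conjI)
    show "smooth_compactly_supported (\<lambda>x::real^3. 0 :: real^2)" by (rule smooth_compactly_supported_0)
    show "smooth_compactly_supported g"
      unfolding g_def[abs_def] by (rule smooth_compactly_supported_bump)
    \<comment> \<open>M = 1 and T0 = 2 ensure that the window [1, 2] of the bump lies in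
      [r - c1 t, r + c1 t].\<close>
    show "0 < (1::real)" "2 \<le> (2::real)" "0 < C" "0 < \<epsilon>0" using C \<epsilon>0 by auto
  qed (use main in blast)
qed

end
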